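(* Let $A$ be a $C^*$-algebra and let $I$ be a closed two-sided ideal of $A$. Then $A$ has $IR$ if and only if both $I$ and $A/I$ have $IR$ and invertibles lift from $\widetilde{A}/I$ to $\widetilde{A}$ (that is, every invertible element of $\widetilde{A}/I$ is the image of an invertible element of $\widetilde{A}$ under the quotient map).
   Context: For a $C^*$-algebra $A$, $\widetilde{A}$ denotes $A$ with an identity adjoined if $A$ is non-unital, and $\widetilde{A}=A$ if $A$ is unital. For a unital $C^*$-algebra $B$, $GL(B)$ is the set of invertible elements of $B$, and $R(B)$ is the set of all $b\in B$ for which there does not exist a closed two-sided ideal $K$ of $B$ such that $\pi(b)$ is one-sided invertible but not invertible, where $\pi:B\to B/K$ is the quotient map. A unital $C^*$-algebra $B$ has (satisfies) $IR$ if $R(B)$ is contained in the norm closure of $GL(B)$. A non-unital $C^*$-algebra has $IR$ if its unitization $\widetilde{A}$ does. *)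

theory Defs
  imports "HOL-Analysis.Analysis" "HOL-Algebra.QuotRing" "HOL-Algebra.Module"
begin

text \<open>
  Complex \<open>*\<close>-algebras carrying a norm.  The record extends the one of HOL-Algebra, which has a
  field \<open>one\<close>.  C*-algebras need not be unital, so that field is never consulted:
  being unital, and being invertible, are expressed through the existence of a multiplicative
  identity (\<open>is_identity\<close> below).  In particular a closed ideal \<open>I\<close> of \<open>A\<close>, viewed as the algebra
  \<open>A\<lparr>carrier := I\<rparr>\<close>, may be unital with an identity that differs from the one of \<open>A\<close>.
\<close>

record 'a star_alg = "(complex, 'a) module" +
  star :: "'a \<Rightarrow> 'a"
  nrm :: "'a \<Rightarrow> real"

text \<open>
  The value off the carrier is irrelevant; it is set to \<open>0\<close> because \<^locale>\<open>Metric_space\<close> demands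
  nonnegativity and symmetry on the whole type.
\<close>

definition norm_dist :: "('a, 'm) star_alg_scheme \<Rightarrow> 'a \<Rightarrow> 'a \<Rightarrow> real" where
  "norm_dist A x y =
     (if x \<in> carrier A \<and> y \<in> carrier A then nrm A (x \<ominus>\<^bsub>A\<^esub> y) else 0)"

definition norm_topology :: "('a, 'm) star_alg_scheme \<Rightarrow> 'a topology" where
  "norm_topology A = Metric_space.mtopology (carrier A) (norm_dist A)"

locale cstar_algebra = abelian_group A for A (structure) +
  assumes mult_closed: "\<lbrakk>x \<in> carrier A; y \<in> carrier A\<rbrakk> \<Longrightarrow> x \<otimes> y \<in> carrier A"
    and mult_assoc: "\<lbrakk>x \<in> carrier A; y \<in> carrier A; z \<in> carrier A\<rbrakk>
      \<Longrightarrow> (x \<otimes> y) \<otimes> z = x \<otimes> (y \<otimes> z)"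
    and distrib_right: "\<lbrakk>x \<in> carrier A; y \<in> carrier A; z \<in> carrier A\<rbrakk>
      \<Longrightarrow> (x \<oplus> y) \<otimes> z = (x \<otimes> z) \<oplus> (y \<otimes> z)"
    and distrib_left: "\<lbrakk>x \<in> carrier A; y \<in> carrier A; z \<in> carrier A\<rbrakk>
      \<Longrightarrow> z \<otimes> (x \<oplus> y) = (z \<otimes> x) \<oplus> (z \<otimes> y)"
    and scale_closed: "x \<in> carrier A \<Longrightarrow> c \<odot> x \<in> carrier A"
    and scale_add_left: "x \<in> carrier A \<Longrightarrow> (c + d) \<odot> x = (c \<odot> x) \<oplus> (d \<odot> x)"
    and scale_add_right: "\<lbrakk>x \<in> carrier A; y \<in> carrier A\<rbrakk>
      \<Longrightarrow> c \<odot> (x \<oplus> y) = (c \<odot> x) \<oplus> (c \<odot> y)"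
    and scale_scale: "x \<in> carrier A \<Longrightarrow> c \<odot> (d \<odot> x) = (c * d) \<odot> x"
    and scale_one: "x \<in> carrier A \<Longrightarrow> 1 \<odot> x = x"
    and scale_mult_left: "\<lbrakk>x \<in> carrier A; y \<in> carrier A\<rbrakk>
      \<Longrightarrow> (c \<odot> x) \<otimes> y = c \<odot> (x \<otimes> y)"
    and scale_mult_right: "\<lbrakk>x \<in> carrier A; y \<in> carrier A\<rbrakk>
      \<Longrightarrow> x \<otimes> (c \<odot> y) = c \<odot> (x \<otimes> y)"
    and star_closed: "x \<in> carrier A \<Longrightarrow> star A x \<in> carrier A"
    and star_star: "x \<in> carrier A \<Longrightarrow> star A (star A x) = x"
    and star_add: "\<lbrakk>x \<in> carrier A; y \<in> carrier A\<rbrakk>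
      \<Longrightarrow> star A (x \<oplus> y) = star A x \<oplus> star A y"
    and star_scale: "x \<in> carrier A \<Longrightarrow> star A (c \<odot> x) = cnj c \<odot> star A x"
    and star_mult: "\<lbrakk>x \<in> carrier A; y \<in> carrier A\<rbrakk>
      \<Longrightarrow> star A (x \<otimes> y) = star A y \<otimes> star A x"
    and nrm_nonneg: "x \<in> carrier A \<Longrightarrow> 0 \<le> nrm A x"
    and nrm_eq_0_iff: "x \<in> carrier A \<Longrightarrow> nrm A x = 0 \<longleftrightarrow> x = \<zero>"
    and nrm_triangle: "\<lbrakk>x \<in> carrier A; y \<in> carrier A\<rbrakk>
      \<Longrightarrow> nrm A (x \<oplus> y) \<le> nrm A x + nrm A y"
    and nrm_scale: "x \<in> carrier A \<Longrightarrow> nrm A (c \<odot> x) = cmod c * nrm A x"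
    and nrm_mult: "\<lbrakk>x \<in> carrier A; y \<in> carrier A\<rbrakk>
      \<Longrightarrow> nrm A (x \<otimes> y) \<le> nrm A x * nrm A y"
    and cstar_identity: "x \<in> carrier A \<Longrightarrow> nrm A (star A x \<otimes> x) = (nrm A x)\<^sup>2"
    and complete: "Metric_space.mcomplete (carrier A) (norm_dist A)"

definition closed_ideal :: "('a, 'm) star_alg_scheme \<Rightarrow> 'a set \<Rightarrow> bool" where
  "closed_ideal A I \<longleftrightarrow>
     additive_subgroup I A \<and>
     (\<forall>c. \<forall>x\<in>I. c \<odot>\<^bsub>A\<^esub> x \<in> I) \<and>
     (\<forall>a\<in>carrier A. \<forall>x\<in>I. a \<otimes>\<^bsub>A\<^esub> x \<in> I \<and> x \<otimes>\<^bsub>A\<^esub> a \<in> I) \<and>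
     closedin (norm_topology A) I"

text \<open>
  The quotient \<open>A/I\<close>: its elements are the cosets \<open>I +> a\<close>, the operations are those induced from
  representatives (as in \<^const>\<open>FactRing\<close>), and the norm is the quotient norm.
\<close>

definition quotient_alg :: "'a star_alg \<Rightarrow> 'a set \<Rightarrow> 'a set star_alg" where
  "quotient_alg A I =
     \<lparr>carrier = a_rcosets\<^bsub>A\<^esub> I,
      monoid.mult = rcoset_mult A I,
      one = I +>\<^bsub>A\<^esub> \<one>\<^bsub>A\<^esub>,
      zero = I,
      add = set_add A,
      smult = (\<lambda>c X. \<Union>x\<in>X. I +>\<^bsub>A\<^esub> (c \<odot>\<^bsub>A\<^esub> x)),
      star = (\<lambda>X. \<Union>x\<in>X. I +>\<^bsub>A\<^esub> star A x),
      nrm = (\<lambda>X. INF x\<in>X. nrm A x)\<rparr>"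

text \<open>
  \<open>A\<close> with an identity adjoined, for non-unital \<open>A\<close>: the pair \<open>(a, s)\<close> stands for \<open>a + s1\<close>.  The
  norm is the operator norm of left multiplication by \<open>a + s1\<close> on \<open>A\<close>, which for non-unital \<open>A\<close> is
  the C*-norm of the unitization.
\<close>

definition adjoin_identity :: "'a star_alg \<Rightarrow> ('a \<times> complex) star_alg" where
  "adjoin_identity A =
     \<lparr>carrier = carrier A \<times> UNIV,
      monoid.mult = (\<lambda>(a, s) (b, t).
        ((a \<otimes>\<^bsub>A\<^esub> b) \<oplus>\<^bsub>A\<^esub> (s \<odot>\<^bsub>A\<^esub> b) \<oplus>\<^bsub>A\<^esub> (t \<odot>\<^bsub>A\<^esub> a), s * t)),
      one = (\<zero>\<^bsub>A\<^esub>, 1),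
      zero = (\<zero>\<^bsub>A\<^esub>, 0),
      add = (\<lambda>(a, s) (b, t). (a \<oplus>\<^bsub>A\<^esub> b, s + t)),
      smult = (\<lambda>c (a, s). (c \<odot>\<^bsub>A\<^esub> a, c * s)),
      star = (\<lambda>(a, s). (star A a, cnj s)),
      nrm = (\<lambda>(a, s). SUP b\<in>{b \<in> carrier A. nrm A b \<le> 1}.
        nrm A ((a \<otimes>\<^bsub>A\<^esub> b) \<oplus>\<^bsub>A\<^esub> (s \<odot>\<^bsub>A\<^esub> b)))\<rparr>"

definition is_identity :: "('a, 'm) star_alg_scheme \<Rightarrow> 'a \<Rightarrow> bool" where
  "is_identity A e \<longleftrightarrow>
     e \<in> carrier A \<and> (\<forall>x\<in>carrier A. e \<otimes>\<^bsub>A\<^esub> x = x \<and> x \<otimes>\<^bsub>A\<^esub> e = x)"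

definition unital :: "('a, 'm) star_alg_scheme \<Rightarrow> bool" where
  "unital A \<longleftrightarrow> (\<exists>e. is_identity A e)"

definition left_invertible :: "('a, 'm) star_alg_scheme \<Rightarrow> 'a \<Rightarrow> bool" where
  "left_invertible B b \<longleftrightarrow> b \<in> carrier B \<and> (\<exists>c\<in>carrier B. is_identity B (c \<otimes>\<^bsub>B\<^esub> b))"

definition right_invertible :: "('a, 'm) star_alg_scheme \<Rightarrow> 'a \<Rightarrow> bool" where
  "right_invertible B b \<longleftrightarrow> b \<in> carrier B \<and> (\<exists>c\<in>carrier B. is_identity B (b \<otimes>\<^bsub>B\<^esub> c))"

definition GL :: "('a, 'm) star_alg_scheme \<Rightarrow> 'a set" where
  "GL B = {b \<in> carrier B. \<exists>c\<in>carrier B.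
             is_identity B (c \<otimes>\<^bsub>B\<^esub> b) \<and> is_identity B (b \<otimes>\<^bsub>B\<^esub> c)}"

definition R_set :: "'a star_alg \<Rightarrow> 'a set" where
  "R_set B = {b \<in> carrier B. \<not> (\<exists>K. closed_ideal B K \<and>
       (left_invertible (quotient_alg B K) (K +>\<^bsub>B\<^esub> b) \<or>
        right_invertible (quotient_alg B K) (K +>\<^bsub>B\<^esub> b)) \<and>
       K +>\<^bsub>B\<^esub> b \<notin> GL (quotient_alg B K))}"

definition unital_IR :: "'a star_alg \<Rightarrow> bool" where
  "unital_IR B \<longleftrightarrow> R_set B \<subseteq> norm_topology B closure_of GL B"

definition has_IR :: "'a star_alg \<Rightarrow> bool" where
  "has_IR A \<longleftrightarrow> (if unital A then unital_IR A else unital_IR (adjoin_identity A))"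

definition invertibles_lift :: "'a star_alg \<Rightarrow> 'a set \<Rightarrow> bool" where
  "invertibles_lift B J \<longleftrightarrow> (\<forall>u\<in>GL (quotient_alg B J). \<exists>v\<in>GL B. u = J +>\<^bsub>B\<^esub> v)"

end

theory Submission
  imports Defs
begin

text \<open>
  Everything takes place modulo closed ideals \<open>K\<close> of a unital C*-algebra \<open>B\<close>.  The key is a
  perturbation result: if \<open>a \<in> R(B)\<close>, \<open>J\<close> is a closed ideal and \<open>b\<close> is close to \<open>a\<close> and invertible modulo \<open>J\<close>,
  then some \<open>b' \<in> R(B) \<inter> (b + J)\<close> is close to \<open>b\<close>.  One multiplies \<open>b\<close> on both sides by self-adjoint elements
  of \<open>1 + J\<close> that are not invertible modulo \<open>K\<close> whenever \<open>b\<close> is not, so that \<open>b'\<close> is either invertible or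
  invertible from neither side.  The same device lifts elements of \<open>R(B/J)\<close> approximately to \<open>R(B)\<close>.

  If \<open>B\<close> has IR, the lifting result gives IR for \<open>B/J\<close> and the lifting of invertibles.  An element of
  \<open>R(J + \<complex>1)\<close> lies in \<open>R(B)\<close>; if its scalar part is nonzero, an approximating invertible of \<open>B\<close> can be
  corrected to one in \<open>J + \<complex>1\<close>, and the case of scalar part 0 reduces to this one by the perturbation result.
  Conversely, \<open>a \<in> R(B)\<close> is close to \<open>v + x\<close> with \<open>v\<close> invertible and \<open>x \<in> J\<close>; replacing \<open>v + x\<close> by \<open>b' \<in> R(B)\<close>,
  the element \<open>v\<^sup>-\<^sup>1b' \<in> 1 + J\<close> is in \<open>R(J + \<complex>1)\<close>, hence approximable by invertibles.

  The functional calculus needed reduces to resolvents of self-adjoint elements and to one square root.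
\<close>

section \<open>Invertibility modulo an ideal\<close>

text \<open>The obstacle in both directions is that \<open>R\<close> need not be stable under small
  changes, even inside a coset of \<open>J\<close>: an element close to \<open>a\<close> can be left
  but not right invertible modulo some closed ideal \<open>K\<close>, and then neither IR nor its
  version for \<open>J\<close> applies to it. The cure rests on one remark: a self-adjoint element
  that is one-sided invertible modulo a closed ideal is invertible there. Self-adjoint outer factors
  can thus be stripped off a one-sided invertible product, from either side; it suffices that their
  invertibility modulo \<open>K\<close> forces that of \<open>b\<close>.

  Such a factor must serve all \<open>K\<close> at once, while an inverse is available modulo one
  ideal at a time. But the elements that become small, uniformly over all \<open>K\<close> where a
  suitable factor is invertible, form a closed ideal themselves, and inverting \<open>b\<close>
  modulo this single ideal is enough.

  All algebras involved are realized in one ring with varying seminorms, so that the algebra, the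
  ideal and the quotient all turn into closed ideals of that ring.\<close>

definition two_sided_ideal :: "'p::ring_1 set \<Rightarrow> bool" where
  "two_sided_ideal K \<longleftrightarrow> 0 \<in> K \<and> (\<forall>x\<in>K. \<forall>y\<in>K. x + y \<in> K) \<and> (\<forall>x\<in>K. \<forall>a. a * x \<in> K \<and> x * a \<in> K)"

definition linv :: "'p::ring_1 set \<Rightarrow> 'p \<Rightarrow> bool" where
  "linv K b \<longleftrightarrow> (\<exists>c. c * b - 1 \<in> K)"

definition rinv :: "'p::ring_1 set \<Rightarrow> 'p \<Rightarrow> bool" where
  "rinv K b \<longleftrightarrow> (\<exists>c. b * c - 1 \<in> K)"

definition invm :: "'p::ring_1 set \<Rightarrow> 'p \<Rightarrow> bool" where
  "invm K b \<longleftrightarrow> linv K b \<and> rinv K b"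

lemma ideal_zero: "two_sided_ideal K \<Longrightarrow> 0 \<in> K"
  and ideal_add: "two_sided_ideal K \<Longrightarrow> x \<in> K \<Longrightarrow> y \<in> K \<Longrightarrow> x + y \<in> K"
  and ideal_lmult: "two_sided_ideal K \<Longrightarrow> x \<in> K \<Longrightarrow> a * x \<in> K"
  and ideal_rmult: "two_sided_ideal K \<Longrightarrow> x \<in> K \<Longrightarrow> x * a \<in> K"
  by (auto simp: two_sided_ideal_def)

lemma ideal_uminus: "two_sided_ideal K \<Longrightarrow> x \<in> K \<Longrightarrow> - x \<in> K"
  using ideal_lmult[of K x "-1"] by simp

lemma ideal_diff: "two_sided_ideal K \<Longrightarrow> x \<in> K \<Longrightarrow> y \<in> K \<Longrightarrow> x - y \<in> K"
  using ideal_add[of K x "- y"] ideal_uminus[of K y] by simp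

lemma ideal_minus_commute: "two_sided_ideal K \<Longrightarrow> x - y \<in> K \<Longrightarrow> y - x \<in> K"
  using ideal_uminus[of K "x - y"] by simp

lemma ideal_scaleR:
  fixes K :: "'p::real_algebra_1 set"
  shows "two_sided_ideal K \<Longrightarrow> x \<in> K \<Longrightarrow> r *\<^sub>R x \<in> K"
  using ideal_lmult[of K x "r *\<^sub>R 1"] by simp

lemmas ideal_intros = ideal_zero ideal_add ideal_lmult ideal_rmult ideal_uminus ideal_diff ideal_scaleR

lemma ideal_cong_trans:
  assumes "two_sided_ideal K" "x - y \<in> K" "y - z \<in> K"
  shows "x - z \<in> K"
  using ideal_add[OF assms] by simp

lemma ideal_cong_mult:
  assumes "two_sided_ideal K" "x - x' \<in> K" "y - y' \<in> K"
  shows "x * y - x' * y' \<in> K"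
proof -
  have "x * y - x' * y' = (x - x') * y + x' * (y - y')" by (simp add: algebra_simps)
  then show ?thesis using assms by (simp add: ideal_intros)
qed

lemma ideal_cong_mem: "two_sided_ideal K \<Longrightarrow> x - y \<in> K \<Longrightarrow> y \<in> K \<Longrightarrow> x \<in> K"
  using ideal_add[of K "x - y" y] by simp

lemma ideal_cong_mem_iff: "two_sided_ideal K \<Longrightarrow> x - y \<in> K \<Longrightarrow> x \<in> K \<longleftrightarrow> y \<in> K"
  using ideal_cong_mem ideal_minus_commute by blast

lemma invm_mono: "K \<subseteq> L \<Longrightarrow> invm K b \<Longrightarrow> invm L b"
  by (auto simp: linv_def rinv_def invm_def)

lemma linv_mult:
  assumes "two_sided_ideal K" "linv K a" "linv K b"
  shows "linv K (a * b)"
proof -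
  obtain c d where c: "c * a - 1 \<in> K" and d: "d * b - 1 \<in> K"
    using assms by (auto simp: linv_def)
  have "(d * c) * (a * b) - 1 = d * (c * a - 1) * b + (d * b - 1)" by (simp add: algebra_simps)
  then show ?thesis unfolding linv_def using assms(1) c d by (metis ideal_add ideal_lmult ideal_rmult)
qed

lemma rinv_mult:
  assumes "two_sided_ideal K" "rinv K a" "rinv K b"
  shows "rinv K (a * b)"
proof -
  obtain c d where c: "a * c - 1 \<in> K" and d: "b * d - 1 \<in> K"
    using assms by (auto simp: rinv_def)
  have "(a * b) * (d * c) - 1 = a * (b * d - 1) * c + (a * c - 1)" by (simp add: algebra_simps)
  then show ?thesis unfolding rinv_def using assms(1) c d by (metis ideal_add ideal_lmult ideal_rmult)
qed

lemma linv_cong: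
  assumes "two_sided_ideal K" "a - b \<in> K" "linv K a"
  shows "linv K b"
proof -
  obtain c where c: "c * a - 1 \<in> K" using assms by (auto simp: linv_def)
  have "c * b - 1 = (c * a - 1) - c * (a - b)" by (simp add: algebra_simps)
  then show ?thesis unfolding linv_def using assms(1,2) c by (metis ideal_diff ideal_lmult)
qed

lemma rinv_cong:
  assumes "two_sided_ideal K" "a - b \<in> K" "rinv K a"
  shows "rinv K b"
proof -
  obtain c where c: "a * c - 1 \<in> K" using assms by (auto simp: rinv_def)
  have "b * c - 1 = (a * c - 1) - (a - b) * c" by (simp add: algebra_simps)
  then show ?thesis unfolding rinv_def using assms(1,2) c by (metis ideal_diff ideal_rmult)
qed

lemma linv_factor: "linv K (a * b) \<Longrightarrow> linv K b"
  unfolding linv_def by (metis mult.assoc)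

lemma rinv_factor: "rinv K (a * b) \<Longrightarrow> rinv K a"
  unfolding rinv_def by (metis mult.assoc)

text \<open>Modulo \<open>K\<close>, \<open>c * a\<close> is a left inverse of \<open>b\<close>. As
  \<open>b\<close> also has a right inverse, the two agree, and \<open>b * (c * a)\<close> is
  congruent to 1.\<close>

lemma linv_cancel_right:
  assumes K: "two_sided_ideal K" and "linv K (a * b)" "rinv K b"
  shows "linv K a"
proof -
  obtain c d where c: "c * (a * b) - 1 \<in> K" and d: "b * d - 1 \<in> K"
    using assms by (auto simp: linv_def rinv_def)
  have "(b * c) * a - 1 = (b * d - 1) + b * (c * (a * b) - 1) * d - b * c * a * (b * d - 1)"
    by (simp add: algebra_simps)
  also have "\<dots> \<in> K" using K c d by (simp only: ideal_intros)
  finally show ?thesis unfolding linv_def by blast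
qed

lemma rinv_cancel_left:
  assumes K: "two_sided_ideal K" and "rinv K (a * b)" "linv K a"
  shows "rinv K b"
proof -
  obtain c d where c: "(a * b) * c - 1 \<in> K" and d: "d * a - 1 \<in> K"
    using assms by (auto simp: linv_def rinv_def)
  have "b * (c * a) - 1 = (d * a - 1) + d * ((a * b) * c - 1) * a - (d * a - 1) * b * c * a"
    by (simp add: algebra_simps)
  also have "\<dots> \<in> K" using K c d by (simp only: ideal_intros)
  finally show ?thesis unfolding rinv_def by blast
qed

lemma left_right_inverse_cong:
  assumes K: "two_sided_ideal K" and "c * b - 1 \<in> K" "b * d - 1 \<in> K"
  shows "c - d \<in> K"
proof -
  have "c - d = (c * b - 1) * d - c * (b * d - 1)" by (simp add: algebra_simps)
  then show ?thesis using assms by (simp add: ideal_intros)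
qed

lemma invm_left_is_right:
  assumes K: "two_sided_ideal K" and "c * b - 1 \<in> K" "rinv K b"
  shows "b * c - 1 \<in> K"
proof -
  obtain d where d: "b * d - 1 \<in> K" using assms by (auto simp: rinv_def)
  have "b * c - 1 = b * (c - d) + (b * d - 1)" by (simp add: algebra_simps)
  also have "\<dots> \<in> K" using left_right_inverse_cong[OF K assms(2) d] K d by (simp only: ideal_intros)
  finally show ?thesis .
qed

lemma invm_obtain:
  assumes "two_sided_ideal K" "invm K b"
  obtains c where "c * b - 1 \<in> K" "b * c - 1 \<in> K"
  using assms invm_left_is_right by (auto simp: invm_def linv_def)

lemma invmI: "c * b - 1 \<in> K \<Longrightarrow> b * c - 1 \<in> K \<Longrightarrow> invm K b"
  by (auto simp: invm_def linv_def rinv_def)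

lemma invm_linv: "invm K b \<Longrightarrow> linv K b" and invm_rinv: "invm K b \<Longrightarrow> rinv K b"
  by (simp_all add: invm_def)

lemma invm_mult: "two_sided_ideal K \<Longrightarrow> invm K a \<Longrightarrow> invm K b \<Longrightarrow> invm K (a * b)"
  by (simp add: invm_def linv_mult rinv_mult)

lemma invm_cong: "two_sided_ideal K \<Longrightarrow> a - b \<in> K \<Longrightarrow> invm K a \<Longrightarrow> invm K b"
  unfolding invm_def using linv_cong rinv_cong by blast

lemma ideal_cancel_left:
  assumes K: "two_sided_ideal K" and "a * b \<in> K" "linv K a"
  shows "b \<in> K"
proof -
  obtain d where d: "d * a - 1 \<in> K" using assms by (auto simp: linv_def)
  have "b = d * (a * b) - (d * a - 1) * b" by (simp add: algebra_simps)
  then show ?thesis using K assms(2) d by (metis ideal_diff ideal_lmult ideal_rmult)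
qed

text \<open>Expand the product of \<open>cb - 1 \<in> J\<close> and \<open>db - 1 \<in> L\<close>.\<close>

lemma linv_product:
  assumes "linv J b" "linv L b" and JL: "\<And>x y. x \<in> J \<Longrightarrow> y \<in> L \<Longrightarrow> x * y \<in> K"
    and K: "two_sided_ideal K"
  shows "linv K b"
proof -
  obtain c d where c: "c * b - 1 \<in> J" and d: "d * b - 1 \<in> L" using assms by (auto simp: linv_def)
  have "(c + d - c * b * d) * b - 1 = - ((c * b - 1) * (d * b - 1))" by (simp add: algebra_simps)
  then show ?thesis unfolding linv_def using JL[OF c d] K by (metis ideal_uminus)
qed

lemma rinv_product:
  assumes "rinv J b" "rinv L b" and JL: "\<And>x y. x \<in> J \<Longrightarrow> y \<in> L \<Longrightarrow> x * y \<in> K"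
    and K: "two_sided_ideal K"
  shows "rinv K b"
proof -
  obtain c d where c: "b * c - 1 \<in> J" and d: "b * d - 1 \<in> L" using assms by (auto simp: rinv_def)
  have "b * (c + d - c * b * d) - 1 = - ((b * c - 1) * (b * d - 1))" by (simp add: algebra_simps)
  then show ?thesis unfolding rinv_def using JL[OF c d] K by (metis ideal_uminus)
qed

section \<open>C*-seminorms\<close>

text \<open>A seminorm rather than a norm: a quotient then lives on the same ring with a larger
  kernel, and every result of this locale applies to it after exchanging \<open>n\<close>. The type
  class supplies real scalars; the central element \<open>iu\<close> with square -1 supplies the
  complex ones.\<close>

locale cstar_seminorm =
  fixes st :: "'p::real_algebra_1 \<Rightarrow> 'p" and iu :: 'p and n :: "'p \<Rightarrow> real"
  assumes st_add: "st (x + y) = st x + st y"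
    and st_mult: "st (x * y) = st y * st x"
    and st_st [simp]: "st (st x) = x"
    and st_scaleR: "st (r *\<^sub>R x) = r *\<^sub>R st x"
    and iu_square: "iu * iu = -1"
    and iu_commute: "iu * x = x * iu"
    and st_iu: "st iu = - iu"
    and n_triangle: "n (x + y) \<le> n x + n y"
    and n_scaleR: "n (r *\<^sub>R x) = \<bar>r\<bar> * n x"
    and n_mult: "n (x * y) \<le> n x * n y"
    and n_cstar: "(n x)\<^sup>2 \<le> n (st x * x)"
    and n_complete: "(\<forall>e>0. \<exists>N. \<forall>i\<ge>N. \<forall>j\<ge>N. n (f i - f j) < e)
      \<Longrightarrow> \<exists>l. \<forall>e>0. \<exists>N::nat. \<forall>i\<ge>N. n (f i - l) < e"
begin

lemma n_zero [simp]: "n 0 = 0" using n_scaleR[of 0 0] by simp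
lemma n_uminus [simp]: "n (- x) = n x" using n_scaleR[of "-1" x] by simp
lemma n_nonneg [simp]: "0 \<le> n x" using n_triangle[of x "- x"] by simp
lemma n_diff: "n (x - y) \<le> n x + n y" using n_triangle[of x "- y"] by simp
lemma n_minus_commute: "n (x - y) = n (y - x)" using n_uminus[of "x - y"] by simp
lemma n_diff_triangle: "n (x - z) \<le> n (x - y) + n (y - z)" using n_triangle[of "x - y" "y - z"] by simp
lemma n_diff_ge: "n x - n y \<le> n (x - y)" using n_triangle[of "x - y" y] by simp

lemma n_mult_le: "n x \<le> a \<Longrightarrow> n y \<le> b \<Longrightarrow> n (x * y) \<le> a * b"
  by (meson n_mult n_nonneg mult_mono order_trans)

lemma n_mult_le_left: "n x \<le> 1 \<Longrightarrow> n (x * y) \<le> n y"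
  using n_mult_le[of x 1 y "n y"] by simp

lemma n_mult_le_right: "n y \<le> 1 \<Longrightarrow> n (x * y) \<le> n x"
  using n_mult_le[of x "n x" y 1] by simp

lemma n_triangle_le: "n x \<le> a \<Longrightarrow> n y \<le> b \<Longrightarrow> n (x + y) \<le> a + b"
  using n_triangle[of x y] by simp

lemma n_diff_le: "n x \<le> a \<Longrightarrow> n y \<le> b \<Longrightarrow> n (x - y) \<le> a + b"
  using n_diff[of x y] by simp

lemma st_zero [simp]: "st 0 = 0" using st_scaleR[of 0 0] by simp
lemma st_uminus [simp]: "st (- x) = - st x" using st_scaleR[of "-1" x] by simp
lemma st_diff: "st (x - y) = st x - st y" using st_add[of x "- y"] by simp
lemma st_one [simp]: "st 1 = 1" using st_mult[of "st 1" 1] by simp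

lemmas st_simps = st_add st_diff st_mult st_scaleR st_iu

text \<open>Equality would fail for the quotient modulo the whole ring, whose seminorm is 0.\<close>

lemma n_one_le: "n 1 \<le> 1"
proof (rule ccontr)
  assume "\<not> n 1 \<le> 1"
  moreover have "(n 1)\<^sup>2 \<le> n 1" using n_cstar[of 1] by simp
  ultimately show False by (simp add: power2_eq_square)
qed

lemma n_scaleR_one_le: "n (r *\<^sub>R 1) \<le> \<bar>r\<bar>"
  using n_scaleR[of r 1] n_one_le mult_left_mono[of "n 1" 1 "\<bar>r\<bar>"] by simp

lemma n_st_le: "n x \<le> n (st x)"
proof (cases "n x = 0")
  case False
  have "n x * n x \<le> n (st x) * n x" using n_cstar[of x] n_mult[of "st x" x] by (simp add: power2_eq_square)
  then show ?thesis using False n_nonneg[of x] by (simp add: mult_le_cancel_right del: n_nonneg)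
qed simp

lemma n_st [simp]: "n (st x) = n x"
  using n_st_le[of x] n_st_le[of "st x"] by simp

lemma n_iu_mult [simp]: "n (iu * x) = n x"
proof -
  have le: "n (iu * x) \<le> n x" for x
  proof -
    have "st (iu * x) * (iu * x) = - (st x * (iu * iu) * x)"
      by (simp add: st_simps mult.assoc)
    then have "st (iu * x) * (iu * x) = st x * x" by (simp add: iu_square)
    then have "(n (iu * x))\<^sup>2 \<le> (n x)\<^sup>2"
      using n_cstar[of "iu * x"] n_mult[of "st x" x] by (simp add: power2_eq_square)
    then show ?thesis by (rule power2_le_imp_le) simp
  qed
  have "iu * (iu * x) = - x" by (simp add: iu_square flip: mult.assoc)
  then show ?thesis using le[of x] le[of "iu * x"] by simp
qed

section \<open>Closed ideals, and equality up to the kernel of the seminorm\<close>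

definition cideal :: "'p set \<Rightarrow> bool" where
  "cideal K \<longleftrightarrow> two_sided_ideal K \<and> (\<forall>x. (\<forall>e>0. \<exists>y\<in>K. n (x - y) < e) \<longrightarrow> x \<in> K)"

definition null :: "'p set" where
  "null = {x. n x = 0}"

lemma cidealD: "cideal K \<Longrightarrow> two_sided_ideal K"
  by (simp add: cideal_def)

lemma cideal_closed: "cideal K \<Longrightarrow> (\<And>e. e > 0 \<Longrightarrow> \<exists>y\<in>K. n (x - y) < e) \<Longrightarrow> x \<in> K"
  by (auto simp: cideal_def)

lemma null_subset: "cideal K \<Longrightarrow> null \<subseteq> K"
proof
  fix x assume K: "cideal K" and "x \<in> null"
  then have "\<forall>e>0. \<exists>y\<in>K. n (x - y) < e"
    by (intro allI impI bexI[of _ 0]) (auto simp: null_def ideal_zero[OF cidealD])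
  then show "x \<in> K" using K by (simp add: cideal_def)
qed

lemma cideal_null: "cideal null"
  unfolding cideal_def two_sided_ideal_def
proof (intro conjI ballI allI impI)
  show "x + y \<in> null" if "x \<in> null" "y \<in> null" for x y
    using that n_triangle[of x y] n_nonneg[of "x + y"] by (simp add: null_def del: n_nonneg)
  show "a * x \<in> null" "x * a \<in> null" if "x \<in> null" for x a
    using that n_mult[of a x] n_mult[of x a] n_nonneg[of "a * x"] n_nonneg[of "x * a"]
    by (simp_all add: null_def del: n_nonneg)
  fix x assume h: "\<forall>e>0. \<exists>y\<in>null. n (x - y) < e"
  have "n x \<le> e" if e: "e > 0" for e
  proof -
    obtain y where "n y = 0" "n (x - y) < e" using h e unfolding null_def by blast
    then show ?thesis using n_triangle[of "x - y" y] by simp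
  qed
  then have "n x \<le> 0" by (rule dense_ge)
  then show "x \<in> null" using n_nonneg[of x] by (simp add: null_def del: n_nonneg)
qed (simp add: null_def)

lemmas null_ideal = cidealD[OF cideal_null]

lemma n_cong: "x - y \<in> null \<Longrightarrow> n x = n y"
  using n_diff_ge[of x y] n_diff_ge[of y x] n_minus_commute[of x y] by (simp add: null_def)

lemma null_cong_mem: "cideal K \<Longrightarrow> x - y \<in> null \<Longrightarrow> x \<in> K \<longleftrightarrow> y \<in> K"
  by (meson ideal_cong_mem_iff cidealD null_subset subsetD)

text \<open>Equality in the Hausdorff quotient. Whatever is obtained as a limit is determined only
  in this sense.\<close>

definition eqn :: "'p \<Rightarrow> 'p \<Rightarrow> bool" (infix "\<asymp>" 50) where
  "x \<asymp> y \<longleftrightarrow> x - y \<in> null"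

lemma eqn_refl [simp]: "x \<asymp> x" by (simp add: eqn_def null_def)

lemma eqn_sym: "x \<asymp> y \<Longrightarrow> y \<asymp> x"
  unfolding eqn_def by (rule ideal_minus_commute[OF null_ideal])

lemma eqn_trans [trans]: "x \<asymp> y \<Longrightarrow> y \<asymp> z \<Longrightarrow> x \<asymp> z"
  unfolding eqn_def by (rule ideal_cong_trans[OF null_ideal])

lemma eqn_mult: "x \<asymp> x' \<Longrightarrow> y \<asymp> y' \<Longrightarrow> x * y \<asymp> x' * y'"
  unfolding eqn_def by (rule ideal_cong_mult[OF null_ideal])

lemma eqn_multl: "y \<asymp> y' \<Longrightarrow> x * y \<asymp> x * y'" by (rule eqn_mult) simp_all
lemma eqn_multr: "x \<asymp> x' \<Longrightarrow> x * y \<asymp> x' * y" by (rule eqn_mult) simp_all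

lemma eqn_add: "x \<asymp> x' \<Longrightarrow> y \<asymp> y' \<Longrightarrow> x + y \<asymp> x' + y'"
  unfolding eqn_def using ideal_add[OF null_ideal, of "x - x'" "y - y'"] by (simp add: algebra_simps)

lemma eqn_diff: "x \<asymp> x' \<Longrightarrow> y \<asymp> y' \<Longrightarrow> x - y \<asymp> x' - y'"
  unfolding eqn_def using ideal_diff[OF null_ideal, of "x - x'" "y - y'"] by (simp add: algebra_simps)

lemma eqn_scaleR: "x \<asymp> y \<Longrightarrow> r *\<^sub>R x \<asymp> r *\<^sub>R y"
  unfolding eqn_def using ideal_scaleR[OF null_ideal, of "x - y" r] by (simp add: algebra_simps)

lemma eqn_st: "x \<asymp> y \<Longrightarrow> st x \<asymp> st y"
  by (simp add: eqn_def null_def flip: st_diff)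

lemma eqn_n: "x \<asymp> y \<Longrightarrow> n x = n y"
  unfolding eqn_def by (rule n_cong)

lemma eqn_0_iff: "x \<asymp> 0 \<longleftrightarrow> n x = 0" by (simp add: eqn_def null_def)

lemma eqn_mem: "cideal K \<Longrightarrow> x \<asymp> y \<Longrightarrow> x \<in> K \<longleftrightarrow> y \<in> K"
  unfolding eqn_def by (rule null_cong_mem)

lemma eqn_cong_mem: "cideal K \<Longrightarrow> x \<asymp> y \<Longrightarrow> x - y \<in> K"
  unfolding eqn_def using null_subset by blast

subsection \<open>Limits\<close>

definition conv :: "(nat \<Rightarrow> 'p) \<Rightarrow> 'p \<Rightarrow> bool" where
  "conv f l \<longleftrightarrow> (\<lambda>i. n (f i - l)) \<longlonglongrightarrow> 0"

lemma conv_squeeze: "conv f l \<Longrightarrow> (\<And>i. n (g i - m) \<le> C * n (f i - l)) \<Longrightarrow> conv g m"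
  unfolding conv_def
  by (rule real_tendsto_sandwich[of "\<lambda>_. 0" _ _ "\<lambda>i. C * n (f i - l)"]) (auto intro!: tendsto_mult_right_zero)

lemma conv_multl: "conv f l \<Longrightarrow> conv (\<lambda>i. a * f i) (a * l)"
  by (erule conv_squeeze[where C = "n a"]) (simp_all add: n_mult flip: right_diff_distrib)

lemma conv_multr: "conv f l \<Longrightarrow> conv (\<lambda>i. f i * a) (l * a)"
proof (erule conv_squeeze[where C = "n a"])
  show "n (f i * a - l * a) \<le> n a * n (f i - l)" for i
    using n_mult[of "f i - l" a] by (simp add: left_diff_distrib mult.commute)
qed

lemma conv_st: "conv f l \<Longrightarrow> conv (\<lambda>i. st (f i)) (st l)"
  by (erule conv_squeeze[where C = 1]) (simp_all flip: st_diff)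

lemma conv_sum:
  assumes "conv f l" "conv g m"
  shows "conv (\<lambda>i. f i + g i) (l + m)"
proof -
  have "(\<lambda>i. n (f i - l) + n (g i - m)) \<longlonglongrightarrow> 0"
    using tendsto_add[OF assms[unfolded conv_def]] by simp
  then show ?thesis unfolding conv_def
  proof (rule real_tendsto_sandwich[OF _ _ tendsto_const, rotated 2])
    show "\<forall>\<^sub>F i in sequentially. n (f i + g i - (l + m)) \<le> n (f i - l) + n (g i - m)"
    proof (rule always_eventually, rule allI)
      show "n (f i + g i - (l + m)) \<le> n (f i - l) + n (g i - m)" for i
        using n_triangle[of "f i - l" "g i - m"] by (simp add: algebra_simps)
    qed
  qed simp
qed

lemma conv_scaleR: "conv f l \<Longrightarrow> conv (\<lambda>i. r *\<^sub>R f i) (r *\<^sub>R l)"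
  by (erule conv_squeeze[where C = "\<bar>r\<bar>"]) (simp_all add: n_scaleR flip: scaleR_right_diff_distrib)

lemma conv_const: "conv (\<lambda>i. l) l" by (simp add: conv_def)

lemma conv_unique:
  assumes "conv f l" "conv g m" "\<And>i. f i \<asymp> g i"
  shows "l \<asymp> m"
proof -
  have "n (l - m) \<le> n (f i - l) + n (g i - m)" for i
  proof -
    have "n (l - m) = n ((f i - g i) + ((l - f i) + (g i - m)))" by simp
    also have "\<dots> \<le> 0 + (n (l - f i) + n (g i - m))"
      using assms(3)[of i] by (intro n_triangle_le n_triangle) (simp add: eqn_def null_def)
    finally show ?thesis by (simp add: n_minus_commute)
  qed
  moreover have "(\<lambda>i. n (f i - l) + n (g i - m)) \<longlonglongrightarrow> 0"
    using tendsto_add[OF assms(1,2)[unfolded conv_def]] by simp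
  ultimately have "n (l - m) \<le> 0" by (intro LIMSEQ_le_const) auto
  then show ?thesis using n_nonneg[of "l - m"] by (simp add: eqn_def null_def del: n_nonneg)
qed

lemma conv_bound:
  assumes "conv f l" "\<And>i. n (f i) \<le> C"
  shows "n l \<le> C"
proof -
  have "n l \<le> C + n (f i - l)" for i
    using n_diff_ge[of l "f i"] n_minus_commute[of l "f i"] assms(2)[of i] by simp
  moreover have "(\<lambda>i. C + n (f i - l)) \<longlonglongrightarrow> C + 0"
    using assms(1) unfolding conv_def by (intro tendsto_add tendsto_const)
  ultimately show ?thesis by (intro LIMSEQ_le_const[of "\<lambda>i. C + n (f i - l)"]) auto
qed

lemma conv_Suc: "conv f l \<Longrightarrow> conv (\<lambda>i. f (Suc i)) l"
  unfolding conv_def by (rule LIMSEQ_Suc)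

lemma conv_mult:
  assumes "conv f l" "conv g m" "\<And>i. n (f i) \<le> C"
  shows "conv (\<lambda>i. f i * g i) (l * m)"
proof -
  have C: "0 \<le> C" using assms(3)[of 0] n_nonneg[of "f 0"] by linarith
  have "(\<lambda>i. n (f i - l) * n m + C * n (g i - m)) \<longlonglongrightarrow> 0 * n m + C * 0"
    using assms(1,2) unfolding conv_def by (intro tendsto_intros)
  then have "(\<lambda>i. n (f i - l) * n m + C * n (g i - m)) \<longlonglongrightarrow> 0" by simp
  then show ?thesis unfolding conv_def
  proof (rule real_tendsto_sandwich[OF _ _ tendsto_const, rotated 2])
    show "\<forall>\<^sub>F i in sequentially. n (f i * g i - l * m) \<le> n (f i - l) * n m + C * n (g i - m)"
    proof (rule always_eventually, rule allI)
      fix i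
      have "f i * g i - l * m = (f i - l) * m + f i * (g i - m)" by (simp add: algebra_simps)
      then show "n (f i * g i - l * m) \<le> n (f i - l) * n m + C * n (g i - m)"
        using n_triangle_le[OF n_mult n_mult_le[OF assms(3) order_refl]] by metis
    qed
  qed simp
qed

text \<open>The majorant is an arbitrary convergent sequence instead of a geometric series, because
  the square root iteration is dominated by a real recursion that need not converge
  geometrically.\<close>

lemma conv_dominated:
  fixes g :: "nat \<Rightarrow> real"
  assumes "convergent g" and le: "\<And>i j. j \<le> i \<Longrightarrow> n (f i - f j) \<le> g i - g j"
  obtains l where "conv f l"
proof -
  have "\<forall>e>0. \<exists>N. \<forall>i\<ge>N. \<forall>j\<ge>N. n (f i - f j) < e"
  proof (intro allI impI)
    fix e :: real assume "e > 0"
    have "Cauchy g" using assms(1) by (simp add: Cauchy_convergent_iff)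
    then obtain N where N: "\<forall>i\<ge>N. \<forall>j\<ge>N. \<bar>g i - g j\<bar> < e"
      using metric_CauchyD[of g e] \<open>e > 0\<close> unfolding dist_real_def by blast
    have "n (f i - f j) < e" if ij: "i \<ge> N" "j \<ge> N" for i j
    proof (cases "j \<le> i")
      case True
      then show ?thesis using le[OF True] N[rule_format, OF ij] by linarith
    next
      case False
      then show ?thesis using le[of i j] N[rule_format, OF ij] n_minus_commute[of "f i" "f j"] by linarith
    qed
    then show "\<exists>N. \<forall>i\<ge>N. \<forall>j\<ge>N. n (f i - f j) < e" by blast
  qed
  then obtain l where "\<forall>e>0. \<exists>N. \<forall>i\<ge>N. n (f i - l) < e" using n_complete by blast
  then show thesis using that unfolding conv_def LIMSEQ_def by (simp add: dist_real_def)
qed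

subsection \<open>The Neumann series and the Cayley transform\<close>

lemma neumann:
  assumes y: "n y < 1"
  obtains c where "c * (1 - y) \<asymp> 1" "(1 - y) * c \<asymp> 1" "n c \<le> 1 / (1 - n y)"
proof -
  define f where "f k = (\<Sum>j<k. y ^ j)" for k
  define g where "g k = (\<Sum>j<k. n y ^ j)" for k
  have pw: "n (y ^ j) \<le> n y ^ j" for j
    by (induction j) (simp_all add: n_one_le n_mult_le)
  have sums: "(\<lambda>j. n y ^ j) sums (1 / (1 - n y))" using y by (intro geometric_sums) simp
  then have glim: "g \<longlonglongrightarrow> 1 / (1 - n y)" by (simp add: sums_def g_def[abs_def])
  have gle: "g k \<le> 1 / (1 - n y)" for k
    unfolding g_def using sums by (intro sum_le_suminf[THEN order_trans]) (auto simp: sums_iff)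
  have dom: "n (f i - f j) \<le> g i - g j" if "j \<le> i" for i j
    using that
  proof (induction i rule: dec_induct)
    case (step i)
    have "f (Suc i) - f j = (f i - f j) + y ^ i" by (simp add: f_def)
    then have "n (f (Suc i) - f j) \<le> (g i - g j) + n y ^ i"
      using n_triangle_le[OF step.IH pw] by metis
    then show ?case by (simp add: g_def)
  qed simp
  have "convergent g" using glim by (auto simp: convergent_def)
  then obtain c where c: "conv f c" using conv_dominated dom by blast
  have nc: "n c \<le> 1 / (1 - n y)"
  proof (rule conv_bound[OF c])
    show "n (f i) \<le> 1 / (1 - n y)" for i
      using dom[of 0 i] gle[of i] by (simp add: f_def g_def)
  qed
  have fS: "f (Suc k) = f k + y ^ k" for k by (simp add: f_def)
  have fl: "f k * (1 - y) = 1 - y ^ k" for k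
  proof (induction k)
    case (Suc k)
    have "f (Suc k) * (1 - y) = f k * (1 - y) + y ^ k - y ^ k * y" by (simp add: fS algebra_simps)
    then show ?case by (simp add: Suc.IH power_commutes)
  qed (simp add: f_def)
  have fr: "(1 - y) * f k = 1 - y ^ k" for k
  proof (induction k)
    case (Suc k)
    have "(1 - y) * f (Suc k) = (1 - y) * f k + y ^ k - y * y ^ k" by (simp add: fS algebra_simps)
    then show ?case by (simp add: Suc.IH)
  qed (simp add: f_def)
  have "(\<lambda>k. n y ^ k) \<longlonglongrightarrow> 0" using y by (intro LIMSEQ_power_zero) simp
  then have "(\<lambda>k. n (1 - y ^ k - 1)) \<longlonglongrightarrow> 0"
    by (rule real_tendsto_sandwich[OF _ _ tendsto_const, rotated 2]) (simp_all add: pw)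
  then have one: "conv (\<lambda>k. 1 - y ^ k) 1" by (simp add: conv_def)
  have "c * (1 - y) \<asymp> 1" by (rule conv_unique[OF conv_multr[OF c] one]) (simp add: fl)
  moreover have "(1 - y) * c \<asymp> 1" by (rule conv_unique[OF conv_multl[OF c] one]) (simp add: fr)
  ultimately show thesis using nc that by blast
qed

lemma neumann_half:
  assumes y: "n y \<le> 1/2"
  obtains c where "c * (1 - y) \<asymp> 1" "(1 - y) * c \<asymp> 1" "n c \<le> 2"
proof -
  obtain c where c: "c * (1 - y) \<asymp> 1" "(1 - y) * c \<asymp> 1" "n c \<le> 1 / (1 - n y)"
    using neumann[of y] y by auto
  have "1 / (1 - n y) \<le> 2" using y by (simp add: divide_le_eq)
  then show thesis using that c by fastforce
qed

lemma eqn_left_right_inverse: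
  assumes "c * b \<asymp> 1" "b * d \<asymp> 1"
  shows "c \<asymp> d"
  using left_right_inverse_cong[OF null_ideal] assms by (simp add: eqn_def)

lemma mult_inner: "b * c \<asymp> 1 \<Longrightarrow> a * (b * (c * x)) \<asymp> a * x"
  by (metis eqn_multl eqn_multr mult.assoc mult_1_left)

lemma mult_inner': "b * c \<asymp> 1 \<Longrightarrow> a * (b * c) \<asymp> a"
  by (metis eqn_multl mult_1_right)

section \<open>The Cayley transform of a self-adjoint element\<close>

context
  fixes h d D E e C
  assumes h: "st h = h" and D_def: "D = 1 - iu * h" and dr: "D * d \<asymp> 1" and dl: "d * D \<asymp> 1"
    and E_def: "E = st D" and e_def: "e = st d" and C_def: "C = E * d"
begin

lemma E_eq: "E = 1 + iu * h"
  by (simp add: E_def D_def st_simps h iu_commute)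

lemma DE: "D * E = 1 + h * h" and ED: "E * D = 1 + h * h"
proof -
  have "iu * h * (iu * h) = (iu * iu) * (h * h)"
    by (metis iu_commute mult.assoc)
  then have a: "iu * h * (iu * h) = - (h * h)" by (simp add: iu_square)
  show "D * E = 1 + h * h" "E * D = 1 + h * h"
    by (simp_all add: D_def E_eq ring_distribs a)
qed

lemma el: "e * E \<asymp> 1" and er: "E * e \<asymp> 1"
  using eqn_st[OF dr] eqn_st[OF dl] by (simp_all add: st_simps E_def e_def)

lemma q_right: "(1 + h * h) * (d * e) \<asymp> 1"
proof -
  have "(1 + h * h) * (d * e) = E * (D * (d * e))" by (simp flip: ED add: mult.assoc)
  also have "\<dots> \<asymp> E * e" by (rule mult_inner[OF dr])
  also have "\<dots> \<asymp> 1" by (rule er)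
  finally show ?thesis .
qed

lemma q_left': "(e * d) * (1 + h * h) \<asymp> 1"
proof -
  have "(e * d) * (1 + h * h) = e * (d * (D * E))" by (simp flip: DE add: mult.assoc)
  also have "\<dots> \<asymp> e * E" by (rule mult_inner[OF dl])
  also have "\<dots> \<asymp> 1" by (rule el)
  finally show ?thesis .
qed

lemma de_commute: "e * d \<asymp> d * e"
  by (rule eqn_left_right_inverse[OF q_left' q_right])

lemma q_left: "(d * e) * (1 + h * h) \<asymp> 1"
  using eqn_trans[OF eqn_multr[OF eqn_sym[OF de_commute]] q_left'] .

lemma st_C: "st C = e * D" by (simp add: C_def E_def e_def st_simps)

text \<open>\<open>D\<close> and \<open>E\<close> commute exactly, since both products are
  \<open>1 + h * h\<close>; their inverses commute only up to \<open>\<asymp>\<close>.\<close>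

lemma C_unitary: "st C * C \<asymp> 1" "C * st C \<asymp> 1"
proof -
  have "st C * C = e * ((D * E) * d)" unfolding st_C by (simp add: C_def mult.assoc)
  also have "D * E = E * D" by (simp add: DE ED)
  also have "e * (E * D * d) = e * (E * (D * d))" by (simp add: mult.assoc)
  also have "\<dots> \<asymp> e * E" by (rule mult_inner'[of D d, THEN eqn_multl, OF dr])
  also have "\<dots> \<asymp> 1" by (rule el)
  finally show "st C * C \<asymp> 1" .
  have "C * st C = E * ((d * e) * D)" unfolding st_C by (simp add: C_def mult.assoc)
  also have "\<dots> \<asymp> E * ((e * d) * D)" by (intro eqn_multl eqn_multr eqn_sym[OF de_commute])
  also have "\<dots> = E * (e * (d * D))" by (simp add: mult.assoc)
  also have "\<dots> \<asymp> E * e" by (rule mult_inner'[of d D, THEN eqn_multl, OF dl])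
  also have "\<dots> \<asymp> 1" by (rule er)
  finally show "C * st C \<asymp> 1" .
qed

lemma n_C: "n C \<le> 1"
proof -
  have "(n C)\<^sup>2 \<le> 1" using n_cstar[of C] eqn_n[OF C_unitary(1)] n_one_le by simp
  then show ?thesis using power2_le_imp_le[of "n C" 1] by simp
qed

text \<open>\<open>D + E = 2\<close>. In this way the bound on the unitary \<open>C\<close> becomes
  \<open>n d \<le> 1\<close>, and further bounds on functions of \<open>h\<close> follow without any
  spectral theory.\<close>

lemma two_d: "d + d \<asymp> 1 + C"
proof -
  have "d + d = D * d + C" by (simp add: C_def E_eq D_def algebra_simps)
  also have "\<dots> \<asymp> 1 + C" using dr by (intro eqn_add) simp_all
  finally show ?thesis .
qed

lemma n_d: "n d \<le> 1"
proof -
  have "n (d + d) \<le> 1 + 1" using eqn_n[OF two_d] n_triangle_le[OF n_one_le n_C] by simp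
  moreover have "d + d = 2 *\<^sub>R d" by (simp add: scaleR_2)
  ultimately show ?thesis by (simp add: n_scaleR)
qed

lemma four_q: "(d + d) * (e + e) \<asymp> 1 + C + st C + 1"
proof -
  have "e + e \<asymp> 1 + st C" using eqn_st[OF two_d] by (simp add: e_def st_simps)
  then have "(d + d) * (e + e) \<asymp> (1 + C) * (1 + st C)" by (rule eqn_mult[OF two_d])
  also have "\<dots> = 1 + C + st C + C * st C" by (simp add: algebra_simps)
  also have "\<dots> \<asymp> 1 + C + st C + 1" using C_unitary by (intro eqn_add) simp_all
  finally show ?thesis .
qed

text \<open>The real part of the Cayley transform: twice the element is
  \<open>- (C + st C)\<close>.\<close>

lemma n_1_2q: "n (1 - (d * e + d * e)) \<le> 1"
proof -
  let ?x = "1 - (d * e + d * e)"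
  have "?x + ?x = 1 + 1 - (d + d) * (e + e)" by (simp add: algebra_simps)
  also have "\<dots> \<asymp> 1 + 1 - (1 + C + st C + 1)" by (intro eqn_diff four_q) simp
  also have "\<dots> = - (C + st C)" by simp
  finally have "?x + ?x \<asymp> - (C + st C)" .
  from eqn_n[OF this] have "n (?x + ?x) \<le> 1 + 1"
    using n_triangle_le[of C 1 "st C" 1] n_C n_uminus[of "C + st C"] by simp
  then show ?thesis by (simp add: n_scaleR flip: scaleR_2)
qed

text \<open>The imaginary part of the Cayley transform: four times \<open>iu * (h * (d * e))\<close>
  is \<open>C - st C\<close>.\<close>

lemma n_hq: "n (h * (d * e)) \<le> 1/2"
proof -
  let ?x = "iu * (h * (d * e))"
  have "?x + ?x = (E - D) * (d * e)" by (simp add: E_eq D_def algebra_simps)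
  also have "\<dots> = C * e - (D * d) * e" by (simp add: C_def algebra_simps)
  also have "\<dots> \<asymp> C * e - 1 * e" using dr by (intro eqn_diff eqn_multr) simp_all
  finally have "?x + ?x \<asymp> (C - 1) * e" by (simp add: algebra_simps)
  then have "(?x + ?x) + (?x + ?x) \<asymp> (C - 1) * e + (C - 1) * e" by (intro eqn_add)
  also have "\<dots> = (C - 1) * (e + e)" by (simp add: algebra_simps)
  also have "\<dots> \<asymp> (C - 1) * (1 + st C)"
    using eqn_st[OF two_d] by (intro eqn_multl) (simp add: e_def st_simps)
  also have "\<dots> = C + (C * st C - 1) - st C" by (simp add: algebra_simps)
  also have "\<dots> \<asymp> C + (1 - 1) - st C" using C_unitary by (intro eqn_add eqn_diff) simp_all
  finally have "(?x + ?x) + (?x + ?x) \<asymp> C + (1 - 1) - st C" .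
  from eqn_n[OF this] have "n ((?x + ?x) + (?x + ?x)) \<le> 1 + 1"
    using n_diff_le[of C 1 "st C" 1] n_C by simp
  then show ?thesis by (simp add: n_scaleR flip: scaleR_2)
qed

end

text \<open>Since \<open>(1 - ith)\<^sup>-\<^sup>1\<close> has norm at most 1 (by the Cayley transform \<open>C\<close>), it extends from \<open>t\<close> to \<open>t + s\<close>
  with \<open>s\<close> bounded below independently of \<open>t\<close>.\<close>

lemma resolvent_step:
  assumes h: "st h = h" and s: "\<bar>s\<bar> * n h < 1" and inv: "invm null (1 - iu * (t *\<^sub>R h))"
  shows "invm null (1 - iu * ((t + s) *\<^sub>R h))"
proof -
  let ?D = "1 - iu * (t *\<^sub>R h)"
  obtain d where d: "d * ?D \<asymp> 1" "?D * d \<asymp> 1"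
    using invm_obtain[OF null_ideal inv] by (auto simp: eqn_def)
  have nd: "n d \<le> 1" by (rule n_d[OF _ refl d(2,1) refl refl refl]) (simp add: st_scaleR h)
  let ?y = "s *\<^sub>R (d * (iu * h))"
  have "n ?y \<le> \<bar>s\<bar> * n h" using nd n_mult_le_left[of d "iu * h"] by (simp add: n_scaleR mult_left_mono)
  then obtain c where "c * (1 - ?y) \<asymp> 1" "(1 - ?y) * c \<asymp> 1" using neumann[of ?y] s by force
  then have "invm null (?D * (1 - ?y))"
    using invm_mult[OF null_ideal inv] invmI[of c "1 - ?y" null] by (simp add: eqn_def)
  moreover have "?D * (1 - ?y) \<asymp> 1 - iu * ((t + s) *\<^sub>R h)"
  proof -
    have "?D * (1 - ?y) = ?D - s *\<^sub>R ((?D * d) * (iu * h))" by (simp add: algebra_simps)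
    also have "\<dots> \<asymp> ?D - s *\<^sub>R (1 * (iu * h))" using d by (intro eqn_diff eqn_scaleR eqn_multr) simp_all
    also have "\<dots> = 1 - iu * ((t + s) *\<^sub>R h)" by (simp add: algebra_simps)
    finally show ?thesis .
  qed
  ultimately show ?thesis using invm_cong[OF null_ideal] by (simp add: eqn_def)
qed

lemma resolvent_exists:
  assumes h: "st h = h"
  shows "invm null (1 - iu * h)"
proof -
  \<comment> \<open>Steps of length \<open>1 / N\<close> are short enough for
    \<open>resolvent_step\<close>, and \<open>N\<close> of them lead from \<open>t = 0\<close> to
    \<open>t = 1\<close>.\<close>
  obtain N :: nat where N: "n h < real N" using reals_Archimedean2 by blast
  then have N0: "N > 0" using n_nonneg[of h] by (cases N) (auto simp del: n_nonneg)
  have "invm null (1 - iu * ((real k / real N) *\<^sub>R h))" for k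
  proof (induction k)
    case 0
    show ?case by (intro invmI[of 1]) (simp_all add: null_def)
  next
    case (Suc k)
    have "\<bar>1 / real N\<bar> * n h < 1" using N N0 by (simp add: divide_less_eq)
    from resolvent_step[OF h this Suc.IH] show ?case by (simp add: add_divide_distrib add.commute)
  qed
  from this[of N] show ?thesis using N0 by simp
qed

text \<open>\<open>q\<close> is the function \<open>1 / (1 + x * x)\<close> of \<open>h\<close>. The
  bounds are the suprema over the real line of this function, of \<open>1 - 2 / (1 + x * x)\<close>
  and of \<open>x / (1 + x * x)\<close>.\<close>

lemma inverse_one_plus_square:
  assumes h: "st h = h"
  obtains q where "st q = q" "n q \<le> 1" "n (1 - (q + q)) \<le> 1" "n (h * q) \<le> 1/2"
    "(1 + h * h) * q \<asymp> 1" "q * (1 + h * h) \<asymp> 1"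
proof -
  let ?D = "1 - iu * h"
  obtain d where d: "d * ?D \<asymp> 1" "?D * d \<asymp> 1"
    using invm_obtain[OF null_ideal resolvent_exists[OF h]] by (auto simp: eqn_def)
  note c = h refl d(2,1) refl refl refl
  show thesis
    by (rule that[of "d * st d"])
      (use n_d[OF c] n_mult_le_left[of d "st d"] n_1_2q[OF c] n_hq[OF c] q_right[OF c] q_left[OF c] in
        \<open>auto simp: st_mult\<close>)
qed

subsection \<open>Square roots and cutoffs\<close>

text \<open>\<open>1 - wG\<close> is a square root of \<open>1 - w\<close>.  The iterates are dominated by those for \<open>w = 1\<close> in the reals,
  which increase to 1; so the case \<open>n w = 1\<close> is covered.\<close>

lemma sqrt_iteration:
  fixes w
  assumes w: "n w \<le> 1" "st w = w"
  obtains G where "n G \<le> 1" "st G \<asymp> G" "G + G \<asymp> 1 + w * G * G"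
    "\<And>c. c * w \<asymp> w * c \<Longrightarrow> c * G \<asymp> G * c"
proof -
  \<comment> \<open>A fixed point satisfies \<open>2 G = 1 + w G G\<close>, which is
    \<open>(1 - w G) (1 - w G) = 1 - w\<close> with a factor \<open>w\<close> divided out. Solving
    for \<open>G\<close> instead of \<open>w G\<close> keeps the factor \<open>w\<close> visible;
    \<open>unit_cutoff\<close> relies on it to make \<open>\<tau>\<close> a multiple of
    \<open>h\<close>.\<close>
  define g where "g = rec_nat 0 (\<lambda>_ x. (1/2) *\<^sub>R (1 + w * x * x))"
  define a where "a = rec_nat (0::real) (\<lambda>_ x. (1 + x * x) / 2)"
  have g0 [simp]: "g 0 = 0" and gS: "g (Suc k) = (1/2) *\<^sub>R (1 + w * g k * g k)" for k
    by (simp_all add: g_def)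
  have a0 [simp]: "a 0 = 0" and aS: "a (Suc k) = (1 + a k * a k) / 2" for k
    by (simp_all add: a_def)
  have a01: "0 \<le> a k \<and> a k \<le> 1" for k
  proof (induction k)
    case (Suc k)
    then have "a k * a k \<le> 1 * 1" by (intro mult_mono) auto
    then show ?case by (simp add: aS)
  qed simp
  have a_mono: "a k \<le> a (Suc k)" for k
  proof -
    have "a (Suc k) - a k = (1 - a k)\<^sup>2 / 2" by (simp add: aS power2_eq_square field_simps)
    then show ?thesis using zero_le_power2[of "1 - a k"] by linarith
  qed
  have gcomm: "c * g k \<asymp> g k * c" if c: "c * w \<asymp> w * c" for c k
  proof (induction k)
    case (Suc k)
    have "c * (w * g k * g k) = (c * w) * g k * g k" by (simp add: mult.assoc)
    also have "\<dots> \<asymp> (w * c) * g k * g k" by (intro eqn_multr c)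
    also have "\<dots> = w * (c * g k) * g k" by (simp add: mult.assoc)
    also have "\<dots> \<asymp> w * (g k * c) * g k" by (intro eqn_multr eqn_multl Suc.IH)
    also have "\<dots> = w * g k * (c * g k)" by (simp add: mult.assoc)
    also have "\<dots> \<asymp> w * g k * (g k * c)" by (intro eqn_multl Suc.IH)
    finally have "c + c * (w * g k * g k) \<asymp> c + w * g k * (g k * c)" by (intro eqn_add) simp_all
    then show ?case unfolding gS by (simp add: algebra_simps eqn_scaleR flip: scaleR_right_distrib)
  qed simp
  have gcomm_exact: "w * g k = g k * w" for k
    by (induction k) (simp_all add: gS algebra_simps, metis mult.assoc)
  have gg: "g j * g k = g k * g j" for j k
  proof (induction k)
    case (Suc k)
    have "g j * (w * g k * g k) = (w * g k * g k) * g j"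
      by (metis Suc.IH gcomm_exact mult.assoc)
    then show ?case unfolding gS by (simp add: ring_distribs)
  qed simp
  have ng: "n (g k) \<le> a k" for k
  proof (induction k)
    case (Suc k)
    have "n (w * g k * g k) \<le> 1 * a k * a k" by (intro n_mult_le w Suc.IH)
    then have "n (1 + w * g k * g k) \<le> 1 + a k * a k" using n_triangle_le[OF n_one_le] by simp
    then show ?case by (simp add: gS aS n_scaleR)
  qed simp
  have step: "n (g (Suc k) - g k) \<le> a (Suc k) - a k" for k
  proof (induction k)
    case 0
    show ?case using n_one_le by (simp add: gS aS n_scaleR)
  next
    case (Suc k)
    \<comment> \<open>A difference of two squares, factored with the help of \<open>gg\<close>. The
      real sequence \<open>a\<close> obeys the same identity, so the bound propagates.\<close>
    have "g (Suc (Suc k)) - g (Suc k) = (1/2) *\<^sub>R (w * ((g (Suc k) - g k) * (g (Suc k) + g k)))"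
      unfolding gS[of "Suc k"] gS[of k, symmetric]
    proof -
      have "(1/2) *\<^sub>R (1 + w * g (Suc k) * g (Suc k)) - g (Suc k)
          = (1/2) *\<^sub>R (w * (g (Suc k) * g (Suc k) - g k * g k))"
        using gS[of k] by (simp add: algebra_simps)
      also have "g (Suc k) * g (Suc k) - g k * g k = (g (Suc k) - g k) * (g (Suc k) + g k)"
        using gg[of "Suc k" k] by (simp add: algebra_simps)
      finally show "(1/2) *\<^sub>R (1 + w * g (Suc k) * g (Suc k)) - g (Suc k) =
        (1/2) *\<^sub>R (w * ((g (Suc k) - g k) * (g (Suc k) + g k)))" .
    qed
    moreover have "n (w * ((g (Suc k) - g k) * (g (Suc k) + g k)))
        \<le> 1 * ((a (Suc k) - a k) * (a (Suc k) + a k))"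
      by (intro n_mult_le w Suc.IH n_triangle_le ng)
    moreover have "a (Suc (Suc k)) - a (Suc k) = (1/2) * ((a (Suc k) - a k) * (a (Suc k) + a k))"
      unfolding aS[of "Suc k"] using aS[of k] by (simp add: field_simps)
    ultimately show ?case by (simp add: n_scaleR)
  qed
  have dom: "n (g i - g j) \<le> a i - a j" if "j \<le> i" for i j
    using that
  proof (induction i rule: dec_induct)
    case (step i)
    have "g (Suc i) - g j = (g (Suc i) - g i) + (g i - g j)" by simp
    then have "n (g (Suc i) - g j) \<le> (a (Suc i) - a i) + (a i - a j)"
      using n_triangle_le[OF \<open>n (g (Suc i) - g i) \<le> a (Suc i) - a i\<close> step.IH] by metis
    then show ?case by simp
  qed simp
  have "incseq a" using a_mono by (rule incseq_SucI)
  then have "convergent a" using incseq_convergent[of a 1] a01 by (metis convergent_def)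
  then obtain G where G: "conv g G" using conv_dominated dom by blast
  have ng1: "n (g k) \<le> 1" for k using ng[of k] a01[of k] by linarith
  have nG: "n G \<le> 1" using conv_bound[OF G ng1] .
  have "conv (\<lambda>k. w * g k * g k) (w * G * G)"
    using n_mult_le[OF w(1) ng1] by (intro conv_mult[OF conv_multl[OF G] G]) simp
  from conv_scaleR[OF conv_sum[OF conv_const[of 1] this], of "1/2"]
  have "G \<asymp> (1/2) *\<^sub>R (1 + w * G * G)"
    by (rule conv_unique[OF conv_Suc[OF G]]) (simp add: gS)
  from eqn_scaleR[OF this, of 2] have GG: "G + G \<asymp> 1 + w * G * G" by (simp add: scaleR_2)
  have stg: "st (g k) = g k" for k
    by (induction k) (simp_all add: gS st_simps w(2), metis gcomm_exact mult.assoc)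
  have stG: "st G \<asymp> G" by (rule conv_unique[OF conv_st[OF G] G]) (simp add: stg)
  show thesis
  proof (rule that[OF nG stG GG])
    fix c assume c: "c * w \<asymp> w * c"
    show "c * G \<asymp> G * c"
      by (rule conv_unique[OF conv_multl[OF G] conv_multr[OF G] gcomm[OF c]])
  qed
qed

lemma inverse_commute:
  assumes "a * b \<asymp> b * a" "c * a \<asymp> 1" "a * c \<asymp> 1"
  shows "c * b \<asymp> b * c"
proof -
  have "c * b \<asymp> c * (b * (a * c))" using assms(3) by (metis eqn_multl eqn_sym mult_1_right)
  also have "\<dots> = c * (b * a) * c" by (simp add: mult.assoc)
  also have "\<dots> \<asymp> c * (a * b) * c" by (intro eqn_multl eqn_multr eqn_sym[OF assms(1)])
  also have "\<dots> = (c * a) * (b * c)" by (simp add: mult.assoc)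
  also have "\<dots> \<asymp> 1 * (b * c)" by (rule eqn_multr[OF assms(2)])
  finally show ?thesis by simp
qed

lemma n_le_double: "n (x + x) \<le> 2 * a \<Longrightarrow> n x \<le> a"
  by (simp add: n_scaleR flip: scaleR_2)

text \<open>\<open>q\<close> and \<open>\<tau>\<close> are the functions \<open>1/(1 + h\<^sup>2)\<close> and \<open>min (q, 1 - q)\<close> of \<open>h\<close>.  With
  \<open>z = 1 - 2q\<close>, the absolute value of \<open>z\<close> is \<open>1 - 2\<tau>\<close>.\<close>

lemma unit_cutoff:
  assumes h: "st h = h"
  obtains q \<tau> where "st q = q" "st \<tau> = \<tau>" "n q \<le> 1" "n \<tau> \<le> 1/2" "n (h * q) \<le> 1/2"
    "q * (h * h) \<asymp> 1 - q" "h * h * q \<asymp> 1 - q" "q * h \<asymp> h * q" "\<tau> * h \<asymp> h * \<tau>" "\<tau> * q \<asymp> q * \<tau>"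
    "\<tau> - \<tau> * \<tau> \<asymp> q - q * q" "n (h * \<tau>) \<le> 1" "n (1 - (q + q)) \<le> 1" "n (1 - (\<tau> + \<tau>)) \<le> 1"
    "\<exists>u. \<tau> \<asymp> h * u"
proof -
  obtain q where q: "st q = q" "n q \<le> 1" "n (1 - (q + q)) \<le> 1" "n (h * q) \<le> 1/2"
    "(1 + h * h) * q \<asymp> 1" "q * (1 + h * h) \<asymp> 1"
    using inverse_one_plus_square[OF h] by blast
  have hhq: "h * h * q \<asymp> 1 - q" and qhh: "q * (h * h) \<asymp> 1 - q"
    using eqn_diff[OF q(5) eqn_refl[of q]] eqn_diff[OF q(6) eqn_refl[of q]] by (simp_all add: algebra_simps)
  have qh: "q * h \<asymp> h * q"
    by (rule inverse_commute[OF _ q(6,5)]) (simp add: algebra_simps)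
  \<comment> \<open>This is \<open>4 q (1 - q) = 1 - z * z\<close>, so that \<open>1 - w * G\<close>
    will be the absolute value of \<open>z\<close>.\<close>
  define w where "w = (q + q) * (1 - q) + (q + q) * (1 - q)"
  have w_sq: "(1 - (q + q)) * (1 - (q + q)) = 1 - w" by (simp add: w_def algebra_simps)
  have w_st: "st w = w" by (simp add: w_def st_simps q(1) algebra_simps)
  \<comment> \<open>Since \<open>1 - q\<close> is \<open>h * h * q\<close>, \<open>w\<close> is the
    square of \<open>2 h q\<close>; this is where \<open>n w \<le> 1\<close> comes from.\<close>
  have w_eq: "w \<asymp> (h * q + h * q) * (h * q + h * q)"
  proof -
    have "w \<asymp> (q + q) * (h * h * q) + (q + q) * (h * h * q)"
      unfolding w_def by (intro eqn_add eqn_multl eqn_sym[OF hhq])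
    also have "\<dots> = (q * h + q * h) * (h * q + h * q)" by (simp add: algebra_simps)
    also have "\<dots> \<asymp> (h * q + h * q) * (h * q + h * q)" by (intro eqn_multr eqn_add qh)
    finally show ?thesis .
  qed
  have "n (h * q + h * q) \<le> 1/2 + 1/2" by (intro n_triangle_le q)
  then have nw: "n w \<le> 1" using eqn_n[OF w_eq] n_mult_le[of "h * q + h * q" 1 "h * q + h * q" 1] by simp
  obtain G where G: "n G \<le> 1" "st G \<asymp> G" "G + G \<asymp> 1 + w * G * G"
    and Gc: "\<And>c. c * w \<asymp> w * c \<Longrightarrow> c * G \<asymp> G * c"
    using sqrt_iteration[OF nw w_st] by blast
  have qw: "q * w \<asymp> w * q" by (simp add: w_def algebra_simps)
  have hw: "h * w \<asymp> w * h"
  proof -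
    have hq': "h * (q * x) \<asymp> q * (h * x)" for x
      using eqn_multr[OF eqn_sym[OF qh], of x] by (simp add: mult.assoc)
    have "h * (q * q) \<asymp> q * (h * q)" by (rule hq')
    also have "\<dots> \<asymp> q * (q * h)" by (intro eqn_multl eqn_sym[OF qh])
    finally have hqq: "h * (q * q) \<asymp> q * (q * h)" .
    have "(h * q + h * q + h * q + h * q) - (h * (q * q) + h * (q * q) + h * (q * q) + h * (q * q))
        \<asymp> (q * h + q * h + q * h + q * h) - (q * (q * h) + q * (q * h) + q * (q * h) + q * (q * h))"
      by (intro eqn_diff eqn_add hqq eqn_sym[OF qh])
    then show ?thesis by (simp add: w_def algebra_simps)
  qed
  have wG: "w * G \<asymp> G * w" by (rule Gc) simp
  \<comment> \<open>Half of \<open>1 - (1 - w * G)\<close>. The limit \<open>G\<close> is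
    self-adjoint only up to \<open>\<asymp>\<close>, hence the symmetrization in
    \<open>\<tau>\<close>, which makes \<open>st \<tau> = \<tau>\<close> exact.\<close>
  define \<tau>0 where "\<tau>0 = (1/2) *\<^sub>R (w * G)"
  define \<tau> where "\<tau> = (1/2) *\<^sub>R (\<tau>0 + st \<tau>0)"
  have st0: "st \<tau>0 \<asymp> \<tau>0"
  proof -
    have "st \<tau>0 = (1/2) *\<^sub>R (st G * w)" by (simp add: \<tau>0_def st_simps w_st)
    also have "\<dots> \<asymp> (1/2) *\<^sub>R (G * w)" by (intro eqn_scaleR eqn_multr G)
    also have "\<dots> \<asymp> \<tau>0" unfolding \<tau>0_def by (intro eqn_scaleR eqn_sym[OF wG])
    finally show ?thesis .
  qed
  have \<tau>0: "\<tau> \<asymp> \<tau>0"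
  proof -
    have "\<tau> \<asymp> (1/2) *\<^sub>R (\<tau>0 + \<tau>0)" unfolding \<tau>_def by (intro eqn_scaleR eqn_add st0) simp
    then show ?thesis by simp
  qed
  have \<tau>_st: "st \<tau> = \<tau>" by (simp add: \<tau>_def st_simps add.commute)
  have n\<tau>: "n \<tau> \<le> 1/2"
    using n_mult_le[OF nw G(1)] eqn_n[OF \<tau>0] by (simp add: \<tau>0_def n_scaleR)
  have \<tau>c: "\<tau> * c \<asymp> c * \<tau>" if c: "c * w \<asymp> w * c" for c
  proof -
    have "\<tau> * c \<asymp> \<tau>0 * c" by (intro eqn_multr \<tau>0)
    also have "\<dots> = (1/2) *\<^sub>R (w * (G * c))" by (simp add: \<tau>0_def mult.assoc)
    also have "\<dots> \<asymp> (1/2) *\<^sub>R (w * (c * G))" by (intro eqn_scaleR eqn_multl eqn_sym[OF Gc[OF c]])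
    also have "\<dots> = (1/2) *\<^sub>R ((w * c) * G)" by (simp add: mult.assoc)
    also have "\<dots> \<asymp> (1/2) *\<^sub>R ((c * w) * G)" by (intro eqn_scaleR eqn_multr eqn_sym[OF c])
    also have "\<dots> = c * \<tau>0" by (simp add: \<tau>0_def mult.assoc)
    also have "\<dots> \<asymp> c * \<tau>" by (intro eqn_multl eqn_sym[OF \<tau>0])
    finally show ?thesis .
  qed
  \<comment> \<open>Both sides are \<open>w / 4\<close>; for \<open>\<tau>\<close> this is the
    square root equation of \<open>G\<close>, multiplied by \<open>w\<close>.\<close>
  have \<tau>q_eq: "\<tau> - \<tau> * \<tau> \<asymp> q - q * q"
  proof -
    have "4 *\<^sub>R (\<tau> * \<tau>) \<asymp> 4 *\<^sub>R (\<tau>0 * \<tau>0)" by (intro eqn_scaleR eqn_mult \<tau>0)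
    also have "\<dots> = w * (G * w) * G" by (simp add: \<tau>0_def mult.assoc)
    also have "\<dots> \<asymp> w * (w * G) * G" by (intro eqn_multr eqn_multl eqn_sym[OF wG])
    also have "\<dots> = w * ((1 + w * G * G) - 1)" by (simp add: mult.assoc)
    also have "\<dots> \<asymp> w * ((G + G) - 1)" by (intro eqn_multl eqn_diff eqn_sym[OF G(3)]) simp
    finally have a: "4 *\<^sub>R (\<tau> * \<tau>) \<asymp> w * ((G + G) - 1)" .
    have \<tau>04: "4 *\<^sub>R \<tau>0 = w * (G + G)" by (simp add: \<tau>0_def algebra_simps flip: scaleR_2)
    have "4 *\<^sub>R (\<tau> - \<tau> * \<tau>) \<asymp> 4 *\<^sub>R \<tau>0 - w * ((G + G) - 1)"
      unfolding scaleR_right_diff_distrib by (intro eqn_diff eqn_scaleR \<tau>0 a)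
    also have "4 *\<^sub>R \<tau>0 - w * ((G + G) - 1) = w" by (simp add: \<tau>04 algebra_simps)
    finally have b: "(1/4) *\<^sub>R (4 *\<^sub>R (\<tau> - \<tau> * \<tau>)) \<asymp> (1/4) *\<^sub>R w" by (rule eqn_scaleR)
    have "w = 4 *\<^sub>R (q - q * q)"
    proof -
      have "w = 2 *\<^sub>R (2 *\<^sub>R (q - q * q))" by (simp only: scaleR_2 w_def) (simp add: algebra_simps)
      then show ?thesis by simp
    qed
    then show ?thesis using b by simp
  qed
  have n1q: "n (1 - q) \<le> 1"
  proof (rule n_le_double)
    have "(1 - q) + (1 - q) = 1 + (1 - (q + q))" by simp
    then show "n ((1 - q) + (1 - q)) \<le> 2 * 1" using n_triangle_le[OF n_one_le q(3)] by (simp only:)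
  qed
  have \<tau>_factor: "\<tau> \<asymp> (q + q) * ((1 - q) * G)"
  proof -
    have "\<tau>0 = (1/2) *\<^sub>R (2 *\<^sub>R ((q + q) * ((1 - q) * G)))"
      unfolding scaleR_2 by (simp add: \<tau>0_def w_def distrib_right mult.assoc)
    then show ?thesis using \<tau>0 by simp
  qed
  \<comment> \<open>The factor \<open>q + q\<close> of \<open>\<tau>\<close> absorbs
    \<open>h\<close>.\<close>
  have "n (h * \<tau>) \<le> 1"
  proof -
    have "h * \<tau> \<asymp> (h * q + h * q) * ((1 - q) * G)"
      using eqn_multl[OF \<tau>_factor, of h] by (simp add: algebra_simps)
    from eqn_n[OF this] show ?thesis
      using n_mult_le[OF n_triangle_le[OF q(4) q(4)] n_mult_le[OF n1q G(1)]] by simp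
  qed
  \<comment> \<open>The factor \<open>1 - q\<close> of \<open>\<tau>\<close> is a multiple of
    \<open>h\<close>.\<close>
  moreover have "\<tau> \<asymp> h * (h * q * (q * G + q * G))"
  proof -
    have "\<tau> \<asymp> (1 - q) * (q * G + q * G)" using \<tau>_factor by (simp add: algebra_simps)
    also have "\<dots> \<asymp> h * h * q * (q * G + q * G)" by (intro eqn_multr eqn_sym[OF hhq])
    finally show ?thesis by (simp add: mult.assoc)
  qed
  \<comment> \<open>By \<open>\<tau>q_eq\<close>, \<open>1 - 2 \<tau>\<close> and
    \<open>1 - 2 q\<close> have the same square, so the bound on the latter carries over.\<close>
  moreover have "n (1 - (\<tau> + \<tau>)) \<le> 1"
  proof -
    let ?m = "1 - (\<tau> + \<tau>)"
    have "st ?m * ?m = 1 - ((\<tau> - \<tau> * \<tau>) + (\<tau> - \<tau> * \<tau>) + (\<tau> - \<tau> * \<tau>) + (\<tau> - \<tau> * \<tau>))"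
      by (simp add: st_simps \<tau>_st algebra_simps)
    also have "\<dots> \<asymp> 1 - ((q - q * q) + (q - q * q) + (q - q * q) + (q - q * q))"
      by (intro eqn_diff eqn_add \<tau>q_eq) simp
    also have "\<dots> = (1 - (q + q)) * (1 - (q + q))" by (simp add: algebra_simps)
    finally have "n (st ?m * ?m) \<le> 1 * 1" using n_mult_le[OF q(3) q(3)] eqn_n by metis
    then have "(n ?m)\<^sup>2 \<le> 1\<^sup>2" using n_cstar[of ?m] by simp
    then show ?thesis by (rule power2_le_imp_le) simp
  qed
  ultimately show thesis
    using that[of q \<tau>] q \<tau>_st n\<tau> qhh hhq qh \<tau>c[OF hw] \<tau>c[OF qw] \<tau>q_eq by blast
qed

text \<open>\<open>\<psi>\<close> and \<open>k\<close> are the positive and negative part of \<open>z\<close> for \<open>ch\<close> in place of \<open>h\<close>: \<open>\<psi>\<close> lives where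
  \<open>|ch| \<ge> 1\<close>, and \<open>k\<close> where \<open>|ch| \<le> 1\<close>.\<close>

lemma cutoff:
  assumes h: "st h = h" and c: "c > 0"
  obtains \<psi> k where "st \<psi> = \<psi>" "st k = k" "n \<psi> \<le> 1" "n k \<le> 1" "\<psi> * k \<asymp> 0" "k * \<psi> \<asymp> 0"
    "n (h * (1 - \<psi>)) \<le> 3 / (2 * c)" "\<exists>u. 1 - k \<asymp> h * u"
    "\<And>K. cideal K \<Longrightarrow> \<psi> \<in> K \<Longrightarrow> \<exists>t. n t \<le> 1 / c\<^sup>2 \<and> h * h - t \<in> K"
    "\<And>K. cideal K \<Longrightarrow> k \<in> K \<Longrightarrow> \<exists>l. n l \<le> c \<and> l * h - 1 \<in> K"
    "\<And>r. \<psi> * r \<asymp> 0 \<Longrightarrow> n (h * r) \<le> n r / c"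
proof -
  define X where "X = c *\<^sub>R h"
  have X: "st X = X" by (simp add: X_def st_simps h)
  obtain q \<tau> where q: "st q = q" "st \<tau> = \<tau>" "n q \<le> 1" "n \<tau> \<le> 1/2" "n (X * q) \<le> 1/2"
    "q * (X * X) \<asymp> 1 - q" "X * X * q \<asymp> 1 - q" "q * X \<asymp> X * q" "\<tau> * X \<asymp> X * \<tau>" "\<tau> * q \<asymp> q * \<tau>"
    "\<tau> - \<tau> * \<tau> \<asymp> q - q * q" "n (X * \<tau>) \<le> 1" "n (1 - (q + q)) \<le> 1" "n (1 - (\<tau> + \<tau>)) \<le> 1"
    "\<exists>u. \<tau> \<asymp> X * u"
    using unit_cutoff[OF X] by blast
  \<comment> \<open>As \<open>\<tau>\<close> is \<open>min (q, 1 - q)\<close>, these are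
    \<open>max (1 - 2 q, 0)\<close> and \<open>max (2 q - 1, 0)\<close>.\<close>
  define \<psi> k where "\<psi> = 1 - q - \<tau>" and "k = q - \<tau>"
  obtain \<rho> where \<rho>: "\<rho> * (1 - \<tau>) \<asymp> 1" "(1 - \<tau>) * \<rho> \<asymp> 1" "n \<rho> \<le> 2"
    using neumann_half[OF q(4)] by blast
  show thesis
  proof (rule that[of \<psi> k])
    show "st \<psi> = \<psi>" "st k = k" by (simp_all add: \<psi>_def k_def st_simps q)
    have "\<psi> + \<psi> = (1 - (q + q)) + (1 - (\<tau> + \<tau>))" "k + k = (1 - (\<tau> + \<tau>)) - (1 - (q + q))"
      by (simp_all add: \<psi>_def k_def)
    then have "n (\<psi> + \<psi>) \<le> 1 + 1" "n (k + k) \<le> 1 + 1"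
      using n_triangle_le[OF q(13,14)] n_diff_le[OF q(14,13)] by (simp_all only:)
    then show "n \<psi> \<le> 1" "n k \<le> 1" by (auto intro: n_le_double)
    have "\<psi> * k = (q - q * q) - (\<tau> - \<tau> * \<tau>) + (q * \<tau> - \<tau> * q)"
      by (simp add: \<psi>_def k_def algebra_simps)
    also have "\<dots> \<asymp> (q - q * q) - (q - q * q) + (q * \<tau> - q * \<tau>)"
      by (intro eqn_add eqn_diff q) simp_all
    finally show "\<psi> * k \<asymp> 0" by simp
    have "k * \<psi> = (q - q * q) - (\<tau> - \<tau> * \<tau>) + (\<tau> * q - q * \<tau>)"
      by (simp add: \<psi>_def k_def algebra_simps)
    also have "\<dots> \<asymp> (q - q * q) - (q - q * q) + (q * \<tau> - q * \<tau>)"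
      by (intro eqn_add eqn_diff q) simp_all
    finally show "k * \<psi> \<asymp> 0" by simp
    have "c *\<^sub>R (h * (1 - \<psi>)) = X * q + X * \<tau>" by (simp add: X_def \<psi>_def algebra_simps)
    then have "n (c *\<^sub>R (h * (1 - \<psi>))) \<le> 1/2 + 1"
      using n_triangle_le[OF q(5,12)] by (simp only:)
    then have "c * n (h * (1 - \<psi>)) \<le> 1/2 + 1" using c by (simp only: n_scaleR)
    then show "n (h * (1 - \<psi>)) \<le> 3 / (2 * c)" using c by (simp add: field_simps)
    obtain u where u: "\<tau> \<asymp> X * u" using q(15) by blast
    have "1 - k = (1 - q) + \<tau>" by (simp add: k_def)
    also have "\<dots> \<asymp> X * X * q + X * u" by (intro eqn_add u eqn_sym[OF q(7)])
    also have "\<dots> = h * (c *\<^sub>R (X * q + u))" by (simp add: X_def algebra_simps)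
    finally show "\<exists>u. 1 - k \<asymp> h * u" by blast
  next
    fix K assume K: "cideal K" and "\<psi> \<in> K"
    note Ki = cidealD[OF K]
    \<comment> \<open>Modulo \<open>\<psi>\<close>, \<open>q\<close> is \<open>1 - \<tau>\<close>,
      with inverse \<open>\<rho>\<close>, and \<open>X * X * q\<close>, being \<open>1 - q\<close>,
      is \<open>\<tau>\<close>. Hence \<open>X * X\<close> is \<open>\<tau> * \<rho>\<close>, of
      seminorm at most \<open>1/2 * 2\<close>.\<close>
    have "X * X - \<tau> * \<rho> = X * X * (1 - (1 - \<tau>) * \<rho>) + X * X * \<psi> * \<rho> + (X * X * q - (1 - q)) * \<rho> + \<psi> * \<rho>"
      by (simp add: \<psi>_def algebra_simps)
    also have "\<dots> \<in> K"
      using \<open>\<psi> \<in> K\<close> Ki eqn_cong_mem[OF K q(7)] eqn_cong_mem[OF K eqn_sym[OF \<rho>(2)]]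
      by (simp only: ideal_intros)
    finally have "(1 / c\<^sup>2) *\<^sub>R (X * X - \<tau> * \<rho>) \<in> K" using Ki by (simp only: ideal_intros)
    then have "h * h - (1 / c\<^sup>2) *\<^sub>R (\<tau> * \<rho>) \<in> K"
      using c by (simp add: X_def algebra_simps power2_eq_square)
    moreover have "n ((1 / c\<^sup>2) *\<^sub>R (\<tau> * \<rho>)) \<le> 1 / c\<^sup>2"
      using n_mult_le[OF q(4) \<rho>(3)] c by (simp add: n_scaleR divide_right_mono)
    ultimately show "\<exists>t. n t \<le> 1 / c\<^sup>2 \<and> h * h - t \<in> K" by blast
  next
    fix K assume K: "cideal K" and "k \<in> K"
    note Ki = cidealD[OF K]
    \<comment> \<open>Modulo \<open>k\<close>, \<open>q\<close> is \<open>\<tau>\<close>, so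
      \<open>q * (X * X)\<close>, being \<open>1 - q\<close>, is \<open>1 - \<tau>\<close>, and
      \<open>\<rho> * (q * X)\<close> is a left inverse of \<open>X\<close>.\<close>
    have "\<rho> * (q * X) * X - 1 = \<rho> * (q * (X * X) - (1 - q)) + (\<rho> * (1 - \<tau>) - 1) - \<rho> * k"
      by (simp add: k_def algebra_simps)
    also have "\<dots> \<in> K"
      using \<open>k \<in> K\<close> Ki eqn_cong_mem[OF K q(6)] eqn_cong_mem[OF K \<rho>(1)]
      by (simp only: ideal_intros)
    finally have "(c *\<^sub>R (\<rho> * (q * X))) * h - 1 \<in> K" by (simp add: X_def)
    moreover have "n (c *\<^sub>R (\<rho> * (q * X))) \<le> c"
    proof -
      have "n (q * X) \<le> 1/2" using n_st[of "q * X"] q(5) by (simp add: st_mult X q(1))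
      then have "n (\<rho> * (q * X)) \<le> 1" using n_mult_le[OF \<rho>(3)] by fastforce
      then show ?thesis using c by (simp add: n_scaleR)
    qed
    ultimately show "\<exists>l. n l \<le> c \<and> l * h - 1 \<in> K" by blast
  next
    fix r assume r: "\<psi> * r \<asymp> 0"
    \<comment> \<open>Where \<open>\<psi>\<close> vanishes, \<open>1 - \<tau>\<close> and
      \<open>q\<close> agree. So \<open>X * r\<close> can be rewritten with the factor
      \<open>X * q\<close>, whose bound \<open>1/2\<close> compensates
      \<open>n \<rho> \<le> 2\<close>.\<close>
    have a: "(1 - \<tau>) * r \<asymp> q * r"
      using eqn_add[OF r eqn_refl[of "q * r"]] by (simp add: \<psi>_def algebra_simps)
    have "X * r \<asymp> \<rho> * (1 - \<tau>) * (X * r)" using eqn_multr[OF eqn_sym[OF \<rho>(1)], of "X * r"] by simp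
    also have "\<dots> = \<rho> * ((X - \<tau> * X) * r)" by (simp add: algebra_simps)
    also have "\<dots> \<asymp> \<rho> * ((X - X * \<tau>) * r)" by (intro eqn_multl eqn_multr eqn_diff q) simp
    also have "\<dots> = \<rho> * (X * ((1 - \<tau>) * r))" by (simp add: algebra_simps)
    also have "\<dots> \<asymp> \<rho> * (X * (q * r))" by (intro eqn_multl a)
    also have "\<dots> = \<rho> * ((X * q) * r)" by (simp add: mult.assoc)
    finally have "X * r \<asymp> \<rho> * ((X * q) * r)" .
    from eqn_n[OF this] have "n (X * r) \<le> 2 * (1/2 * n r)"
      using n_mult_le[OF \<rho>(3) n_mult_le[OF q(5) order_refl[of "n r"]]] by simp
    moreover have "n (X * r) = c * n (h * r)" using c by (simp add: X_def n_scaleR)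
    ultimately show "n (h * r) \<le> n r / c" using c by (simp add: field_simps)
  qed
qed

text \<open>\<open>1 - q\<close> plays the approximate unit: being a multiple of \<open>h\<close> up
  to \<open>\<asymp>\<close>, it lies in every closed ideal that contains \<open>h\<close>. In the
  applications \<open>h\<close> is \<open>st y * y\<close>, and the C*-inequality then controls
  \<open>y * q\<close>.\<close>

lemma approximate_unit:
  assumes h: "st h = h" and e: "e > 0"
  obtains q where "st q = q" "n q \<le> 1" "n (h * q) \<le> e" "\<exists>u. 1 - q \<asymp> h * u"
proof -
  \<comment> \<open>The bound \<open>n (X * q) \<le> 1/2\<close>, divided by \<open>c\<close>, gives
    \<open>e\<close>.\<close>
  define c where "c = 1 / (2 * e)"
  have c: "c > 0" using e by (simp add: c_def)
  define X where "X = c *\<^sub>R h"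
  have X: "st X = X" by (simp add: X_def st_simps h)
  obtain q where q: "st q = q" "n q \<le> 1" "n (X * q) \<le> 1/2" "(1 + X * X) * q \<asymp> 1"
    using inverse_one_plus_square[OF X] by blast
  have "1 - q \<asymp> h * (c *\<^sub>R (X * q))"
    using eqn_sym[OF eqn_diff[OF q(4) eqn_refl[of q]]] by (simp add: X_def algebra_simps)
  moreover have "n (h * q) \<le> e"
    using q(3) c e by (simp add: X_def n_scaleR c_def field_simps)
  ultimately show thesis using that[of q] q by blast
qed

lemma n_mult_square_le:
  assumes "st q = q" "n q \<le> 1"
  shows "(n (y * q))\<^sup>2 \<le> n (st y * y * q)"
proof -
  have "(n (y * q))\<^sup>2 \<le> n (q * (st y * y * q))"
    using n_cstar[of "y * q"] by (simp add: st_mult assms(1) mult.assoc)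
  then show ?thesis using n_mult_le_left[OF assms(2), of "st y * y * q"] by simp
qed

text \<open>If \<open>1 - q\<close> is a multiple of \<open>st y * y\<close>, then
  \<open>y * (1 - q)\<close> lies in \<open>K\<close>, and the error \<open>y * q\<close> is small.
  Applied to \<open>st y\<close>, this shows that closed ideals are self-adjoint.\<close>

lemma cideal_square:
  assumes K: "cideal K" and y: "st y * y \<in> K"
  shows "y \<in> K"
proof (rule cideal_closed[OF K])
  fix e :: real assume e: "e > 0"
  have e2: "e\<^sup>2 / 2 > 0" using e by simp
  have sa: "st (st y * y) = st y * y" by (simp add: st_mult)
  obtain q where q: "st q = q" "n q \<le> 1" "n (st y * y * q) \<le> e\<^sup>2 / 2" and "\<exists>u. 1 - q \<asymp> st y * y * u"
    using approximate_unit[OF sa e2] by metis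
  then obtain u where "1 - q \<asymp> st y * y * u" by blast
  then have "1 - q \<in> K" using eqn_mem[OF K] ideal_rmult[OF cidealD[OF K] y] by blast
  then have "y * (1 - q) \<in> K" by (rule ideal_lmult[OF cidealD[OF K]])
  moreover have "n (y - y * (1 - q)) < e"
  proof -
    have "(n (y * q))\<^sup>2 \<le> e\<^sup>2 / 2" using n_mult_square_le[OF q(1,2), of y] q(3) by simp
    also have "\<dots> < e\<^sup>2" using e2 by linarith
    finally have "n (y * q) < e" by (rule power2_less_imp_less) (use e in simp)
    then show ?thesis by (simp add: algebra_simps)
  qed
  ultimately show "\<exists>z\<in>K. n (y - z) < e" by blast
qed

lemma cideal_st: "cideal K \<Longrightarrow> y \<in> K \<Longrightarrow> st y \<in> K"
  by (rule cideal_square) (simp_all add: ideal_rmult[OF cidealD])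

lemma linv_st:
  assumes K: "cideal K"
  shows "linv K (st b) \<longleftrightarrow> rinv K b"
proof
  assume "linv K (st b)"
  then obtain c where "c * st b - 1 \<in> K" by (auto simp: linv_def)
  from cideal_st[OF K this] show "rinv K b" by (auto simp: rinv_def st_diff st_mult)
next
  assume "rinv K b"
  then obtain c where "b * c - 1 \<in> K" by (auto simp: rinv_def)
  from cideal_st[OF K this] show "linv K (st b)" by (auto simp: linv_def st_diff st_mult)
qed

lemma rinv_st: "cideal K \<Longrightarrow> rinv K (st b) \<longleftrightarrow> linv K b"
  using linv_st[of K "st b"] by simp

lemma invm_st: "cideal K \<Longrightarrow> invm K (st b) \<longleftrightarrow> invm K b"
  by (auto simp: invm_def linv_st rinv_st)

text \<open>The adjoint of a left inverse is a right inverse. This is the reason for using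
  self-adjoint factors throughout.\<close>

lemma linv_self_adjoint: "cideal K \<Longrightarrow> st b = b \<Longrightarrow> linv K b \<Longrightarrow> invm K b"
  using rinv_st[of K b] by (simp add: invm_def)

lemma rinv_self_adjoint: "cideal K \<Longrightarrow> st b = b \<Longrightarrow> rinv K b \<Longrightarrow> invm K b"
  using linv_st[of K b] by (simp add: invm_def)

subsection \<open>The quotient seminorm\<close>

definition nq :: "'p set \<Rightarrow> 'p \<Rightarrow> real" where
  "nq K x = (INF y\<in>K. n (x - y))"

context
  fixes K assumes K: "cideal K"
begin

lemma Ki: "two_sided_ideal K" by (rule cidealD[OF K])

lemma nq_bdd: "bdd_below ((\<lambda>y. n (x - y)) ` K)"
  by (rule bdd_belowI2[of _ 0]) simp

lemma nq_less_iff: "nq K x < e \<longleftrightarrow> (\<exists>y\<in>K. n (x - y) < e)"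
proof -
  have "K \<noteq> {}" using ideal_zero[OF Ki] by blast
  then show ?thesis unfolding nq_def using cINF_less_iff[OF _ nq_bdd] by simp
qed

lemma nq_le: "y \<in> K \<Longrightarrow> nq K x \<le> n (x - y)"
  unfolding nq_def by (rule cINF_lower[OF nq_bdd])

lemma nq_le_n: "nq K x \<le> n x"
  using nq_le[OF ideal_zero[OF Ki], of x] by simp

lemma nq_nonneg: "0 \<le> nq K x"
  using nq_less_iff[of x 0] n_nonneg by (meson not_le)

lemma nq_cong: "x - y \<in> K \<Longrightarrow> nq K x = nq K y"
proof -
  have "nq K x \<le> nq K y" if "x - y \<in> K" for x y
  proof (rule ccontr)
    assume "\<not> nq K x \<le> nq K y"
    then obtain z where z: "z \<in> K" "n (y - z) < nq K x" using nq_less_iff[of y "nq K x"] by auto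
    have "nq K x \<le> n (x - ((x - y) + z))" using that z ideal_add[OF Ki] nq_le by blast
    then show False using z by simp
  qed
  then show "x - y \<in> K \<Longrightarrow> nq K x = nq K y" using ideal_minus_commute[OF Ki] by (meson antisym)
qed

lemma nq_eq_0_iff: "nq K x = 0 \<longleftrightarrow> x \<in> K"
proof
  assume "nq K x = 0"
  then show "x \<in> K" using nq_less_iff[of x] by (intro cideal_closed[OF K]) auto
next
  assume "x \<in> K"
  then show "nq K x = 0" using nq_le[of x x] nq_nonneg[of x] by simp
qed

lemma nq_triangle: "nq K (x + y) \<le> nq K x + nq K y"
proof (rule field_le_epsilon)
  fix e :: real assume "e > 0"
  then obtain a b where ab: "a \<in> K" "n (x - a) < nq K x + e/2" "b \<in> K" "n (y - b) < nq K y + e/2"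
    using nq_less_iff[of x "nq K x + e/2"] nq_less_iff[of y "nq K y + e/2"] by auto
  have "nq K (x + y) \<le> n ((x + y) - (a + b))" using ab ideal_add[OF Ki] nq_le by blast
  also have "\<dots> = n ((x - a) + (y - b))" by (simp add: algebra_simps)
  finally show "nq K (x + y) \<le> nq K x + nq K y + e" using n_triangle[of "x - a" "y - b"] ab by linarith
qed

lemma nq_mult: "nq K (x * y) \<le> nq K x * nq K y"
proof (rule tendsto_lowerbound)
  show "((\<lambda>e. (nq K x + e) * (nq K y + e)) \<longlongrightarrow> nq K x * nq K y) (at_right 0)"
    by (auto intro!: tendsto_eq_intros)
  show "\<forall>\<^sub>F e in at_right 0. nq K (x * y) \<le> (nq K x + e) * (nq K y + e)"
    unfolding eventually_at_filter
  proof (intro always_eventually allI impI)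
    fix e :: real assume "e \<noteq> 0" "e \<in> {0<..}"
    then have "e > 0" by simp
    then obtain a b where ab: "a \<in> K" "n (x - a) < nq K x + e" "b \<in> K" "n (y - b) < nq K y + e"
      using nq_less_iff[of x "nq K x + e"] nq_less_iff[of y "nq K y + e"] by auto
    have "(x - a) * (y - b) - x * y = - (a * (y - b)) - x * b" by (simp add: algebra_simps)
    also have "\<dots> \<in> K" using Ki ab by (simp only: ideal_intros)
    finally have "nq K (x * y) = nq K ((x - a) * (y - b))" using nq_cong by metis
    also have "\<dots> \<le> n ((x - a) * (y - b))" by (rule nq_le_n)
    also have "\<dots> \<le> (nq K x + e) * (nq K y + e)" using ab by (intro n_mult_le) simp_all
    finally show "nq K (x * y) \<le> (nq K x + e) * (nq K y + e)" .
  qed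
qed simp

lemma nq_scaleR: "nq K (r *\<^sub>R x) = \<bar>r\<bar> * nq K x"
proof (cases "r = 0")
  case True
  then show ?thesis using nq_eq_0_iff[of 0] ideal_zero[OF Ki] by simp
next
  case False
  have le: "nq K (r *\<^sub>R x) \<le> \<bar>r\<bar> * nq K x" if r0: "r \<noteq> 0" for r x
  proof (rule field_le_epsilon)
    fix e :: real assume "e > 0"
    then obtain a where a: "a \<in> K" "n (x - a) < nq K x + e / \<bar>r\<bar>"
      using nq_less_iff[of x "nq K x + e / \<bar>r\<bar>"] r0 by auto
    have "nq K (r *\<^sub>R x) \<le> n (r *\<^sub>R x - r *\<^sub>R a)" using a ideal_scaleR[OF Ki] nq_le by blast
    also have "\<dots> = \<bar>r\<bar> * n (x - a)" by (simp add: n_scaleR flip: scaleR_right_diff_distrib)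
    also have "\<dots> \<le> \<bar>r\<bar> * (nq K x + e / \<bar>r\<bar>)" using a by (intro mult_left_mono) simp_all
    also have "\<dots> = \<bar>r\<bar> * nq K x + e" using r0 by (simp add: distrib_left)
    finally show "nq K (r *\<^sub>R x) \<le> \<bar>r\<bar> * nq K x + e" .
  qed
  have "nq K x \<le> \<bar>1/r\<bar> * nq K (r *\<^sub>R x)" using le[of "1/r" "r *\<^sub>R x"] False by simp
  then have "\<bar>r\<bar> * nq K x \<le> nq K (r *\<^sub>R x)" using False by (simp add: field_simps)
  then show ?thesis using le[OF False, of x] by simp
qed

text \<open>Choose \<open>x\<close> in \<open>K\<close> nearly optimal for \<open>st y * y\<close>,
  and \<open>q\<close> for \<open>st x * x\<close>. Then \<open>y * q\<close> represents the class
  of \<open>y\<close>, and the square of its seminorm is at most \<open>n (st y * y * q)\<close>,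
  where \<open>x\<close> may be subtracted because \<open>x * q\<close> is small.\<close>

lemma nq_cstar: "(nq K y)\<^sup>2 \<le> nq K (st y * y)"
proof (rule field_le_epsilon)
  fix e :: real assume e: "e > 0"
  obtain x where x: "x \<in> K" "n (st y * y - x) < nq K (st y * y) + e/2"
    using nq_less_iff[of "st y * y" "nq K (st y * y) + e/2"] e by auto
  define e' where "e' = (e/2)\<^sup>2"
  have e': "e' > 0" using e by (simp add: e'_def)
  obtain q u where q: "st q = q" "n q \<le> 1" "n (st x * x * q) \<le> e'" "1 - q \<asymp> st x * x * u"
    using approximate_unit[OF _ e', of "st x * x"] by (metis st_mult st_st)
  have "st x * x * u \<in> K" using Ki x(1) by (simp only: ideal_intros)
  then have q1: "1 - q \<in> K" using q(4) eqn_mem[OF K] by blast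
  have "y - y * q = y * (1 - q)" by (simp add: algebra_simps)
  then have "nq K y = nq K (y * q)" using nq_cong q1 ideal_lmult[OF Ki] by metis
  then have "(nq K y)\<^sup>2 \<le> (n (y * q))\<^sup>2" using nq_le_n[of "y * q"] nq_nonneg[of "y * q"] by (simp add: power_mono)
  also have "\<dots> \<le> n (st y * y * q)" by (rule n_mult_square_le[OF q(1,2)])
  also have "\<dots> = n ((st y * y - x) * q + x * q)" by (simp add: algebra_simps)
  also have "\<dots> \<le> n (st y * y - x) + e/2"
  proof (rule n_triangle_le)
    show "n ((st y * y - x) * q) \<le> n (st y * y - x)" by (rule n_mult_le_right[OF q(2)])
    have "(n (x * q))\<^sup>2 \<le> (e/2)\<^sup>2" using n_mult_square_le[OF q(1,2), of x] q(3) by (simp add: e'_def)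
    then show "n (x * q) \<le> e/2" by (rule power2_le_imp_le) (use e in simp)
  qed
  finally show "(nq K y)\<^sup>2 \<le> nq K (st y * y) + e" using x(2) by linarith
qed

lemma nq_complete:
  assumes cauchy: "\<forall>e>0. \<exists>N. \<forall>i\<ge>N. \<forall>j\<ge>N. nq K (f i - f j) < e"
  shows "\<exists>l. \<forall>e>0. \<exists>N::nat. \<forall>i\<ge>N. nq K (f i - l) < e"
proof -
  have "\<exists>N. \<forall>i\<ge>N. \<forall>j\<ge>N. nq K (f i - f j) < (1/2)^k" for k :: nat using cauchy by simp
  then obtain M where M: "nq K (f i - f j) < (1/2)^k" if "i \<ge> M k" "j \<ge> M k" for i j k by metis
  \<comment> \<open>Summing makes the indices monotone while keeping \<open>N k \<ge> M k\<close>.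
    The subsequence is then corrected by elements of \<open>K\<close> so that it becomes Cauchy for
    \<open>n\<close> itself.\<close>
  define N where "N k = (\<Sum>j\<le>k. M j)" for k
  have NM: "M k \<le> N k" for k unfolding N_def by (rule member_le_sum) auto
  have NS: "N k \<le> N (Suc k)" for k by (simp add: N_def)
  have "\<exists>y\<in>K. n (f (N (Suc k)) - f (N k) - y) < (1/2)^k" for k
    using M[of k "N (Suc k)" "N k"] NM[of k] NS[of k] by (simp add: nq_less_iff)
  then obtain y where y: "y k \<in> K" "n (f (N (Suc k)) - f (N k) - y k) < (1/2)^k" for k by metis
  define g where "g k = f (N k) - (\<Sum>j<k. y j)" for k
  have gK: "f (N k) - g k \<in> K" for k
  proof -
    have "(\<Sum>j<k. y j) \<in> K" by (induction k) (simp_all add: ideal_zero[OF Ki] ideal_add[OF Ki] y)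
    then show ?thesis by (simp add: g_def)
  qed
  \<comment> \<open>\<open>a i - a j\<close> is the sum of \<open>(1/2)^m\<close> over
    \<open>j \<le> m < i\<close>.\<close>
  define a where "a k = - (2 * (1/2)^k :: real)" for k :: nat
  have "a \<longlonglongrightarrow> - (2 * 0)" unfolding a_def by (intro tendsto_intros LIMSEQ_power_zero) simp
  then have "convergent a" by (auto simp: convergent_def)
  moreover have "n (g i - g j) \<le> a i - a j" if "j \<le> i" for i j
    using that
  proof (induction i rule: dec_induct)
    case (step i)
    have "g (Suc i) - g j = (f (N (Suc i)) - f (N i) - y i) + (g i - g j)" by (simp add: g_def)
    then have "n (g (Suc i) - g j) \<le> (1/2)^i + (a i - a j)"
      using n_triangle_le[OF less_imp_le[OF y(2)] step.IH] by metis
    then show ?case by (simp add: a_def)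
  qed simp
  ultimately obtain l where l: "conv g l" using conv_dominated by blast
  show ?thesis
  proof (rule exI[of _ l], intro allI impI)
    fix e :: real assume e: "e > 0"
    obtain k1 where k1: "\<forall>k\<ge>k1. n (g k - l) < e/2"
      using l e unfolding conv_def LIMSEQ_def by (auto simp: dist_real_def dest!: spec[of _ "e/2"])
    obtain k2 where k2: "(1/2)^k2 < e/2" using real_arch_pow_inv[of "e/2" "1/2"] e by auto
    define k where "k = max k1 k2"
    have "(1/2)^k \<le> (1/2::real)^k2" unfolding k_def by (intro power_decreasing) auto
    then have k: "(1/2)^k < e/2" using k2 by linarith
    show "\<exists>N. \<forall>i\<ge>N. nq K (f i - l) < e"
    proof (rule exI[of _ "N k"], intro allI impI)
      fix i assume "i \<ge> N k"
      then have 1: "nq K (f i - f (N k)) < e/2" using M[of k i "N k"] NM[of k] k by force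
      have "nq K (f (N k) - l) = nq K (g k - l)" by (rule nq_cong) (simp add: gK)
      also have "\<dots> < e/2" using nq_le_n[of "g k - l"] k1[rule_format, of k] by (simp add: k_def)
      finally have 2: "nq K (f (N k) - l) < e/2" .
      have "f i - l = (f i - f (N k)) + (f (N k) - l)" by simp
      then show "nq K (f i - l) < e" using nq_triangle[of "f i - f (N k)" "f (N k) - l"] 1 2 by (simp only:)
    qed
  qed
qed

lemma nq_cstar_seminorm: "cstar_seminorm st iu (nq K)"
proof
  show "(\<forall>e>0. \<exists>N. \<forall>i\<ge>N. \<forall>j\<ge>N. nq K (f i - f j) < e) \<Longrightarrow>
     \<exists>l. \<forall>e>0. \<exists>N::nat. \<forall>i\<ge>N. nq K (f i - l) < e" for f
    by (rule nq_complete)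
  show "iu * x = x * iu" for x by (rule iu_commute)
qed (simp_all add: st_simps iu_square nq_triangle nq_scaleR nq_mult nq_cstar)

lemma nq_null: "cstar_seminorm.null (nq K) = K"
  using cstar_seminorm.null_def[OF nq_cstar_seminorm] by (auto simp: nq_eq_0_iff)

lemma nq_cideal_iff: "cstar_seminorm.cideal (nq K) L \<longleftrightarrow> cideal L \<and> K \<subseteq> L"
proof -
  interpret q: cstar_seminorm st iu "nq K" by (rule nq_cstar_seminorm)
  show ?thesis
  proof
    assume L: "q.cideal L"
    have "\<And>x e. (\<forall>e>0. \<exists>y\<in>L. n (x - y) < e) \<Longrightarrow> e > 0 \<Longrightarrow> \<exists>y\<in>L. nq K (x - y) < e"
      using nq_le_n by (meson le_less_trans)
    then show "cideal L \<and> K \<subseteq> L"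
      using q.null_subset[OF L] nq_null q.cidealD[OF L] q.cideal_closed[OF L] unfolding cideal_def by metis
  next
    assume L: "cideal L \<and> K \<subseteq> L"
    show "q.cideal L" unfolding q.cideal_def
    proof (intro conjI allI impI)
      show "two_sided_ideal L" using L cidealD by blast
      fix x assume x: "\<forall>e>0. \<exists>y\<in>L. nq K (x - y) < e"
      show "x \<in> L"
      proof (rule cideal_closed)
        fix e :: real assume "e > 0"
        then obtain y z where "y \<in> L" "z \<in> K" "n (x - y - z) < e" using x nq_less_iff by blast
        then show "\<exists>y\<in>L. n (x - y) < e"
          using L ideal_add[OF cidealD] by (intro bexI[of _ "y + z"]) (auto simp: algebra_simps)
      qed (use L in blast)
    qed
  qed
qed

lemma nq_less_1_invm: 
  assumes "nq K (a - 1) < 1"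
  shows "invm K a"
proof -
  obtain y where y: "y \<in> K" "n ((a - 1) - y) < 1" using assms nq_less_iff by blast
  then have "n (1 - (a - y)) < 1" using n_minus_commute[of "a - 1" y] n_uminus[of "(a - 1) - y"] by (simp add: algebra_simps)
  then obtain c where c: "c * (1 - (1 - (a - y))) \<asymp> 1" "(1 - (1 - (a - y))) * c \<asymp> 1"
    using neumann by blast
  then have "invm K (a - y)"
    using eqn_cong_mem[OF K] by (intro invmI[of c]) auto
  then show ?thesis by (rule invm_cong[OF Ki, rotated]) (simp add: ideal_uminus[OF Ki y(1)])
qed

end

subsection \<open>Elements without one-sided invertible images\<close>

definition R :: "'p set" where
  "R = {b. \<forall>K. cideal K \<longrightarrow> linv K b \<or> rinv K b \<longrightarrow> invm K b}"

lemma R_D: "b \<in> R \<Longrightarrow> cideal K \<Longrightarrow> linv K b \<or> rinv K b \<Longrightarrow> invm K b"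
  by (auto simp: R_def)

lemma R_st: "b \<in> R \<Longrightarrow> st b \<in> R"
  unfolding R_def by (auto simp: linv_st rinv_st invm_st)

lemma R_mult_invm:
  assumes w: "invm null w" and b: "b \<in> R"
  shows "w * b \<in> R"
  unfolding R_def
proof (intro CollectI allI impI)
  fix K assume K: "cideal K" and lr: "linv K (w * b) \<or> rinv K (w * b)"
  note Ki = cidealD[OF K]
  have wK: "invm K w" using w null_subset[OF K] invm_mono by blast
  from lr have "linv K b \<or> rinv K b"
    using linv_factor rinv_cancel_left[OF Ki _ invm_linv[OF wK]] by metis
  then show "invm K (w * b)" by (rule invm_mult[OF Ki wK R_D[OF b K]])
qed

text \<open>If the product is left invertible modulo \<open>K\<close>, so is its last factor, which
  is self-adjoint, hence invertible and can be cancelled. After \<open>r\<close> and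
  \<open>\<psi>\<close> the hypothesis makes \<open>a\<close> invertible, and the stripping
  continues. Right invertibility is treated from the other end, which explains the second pair of
  factors.\<close>

lemma sandwich_in_R:
  assumes sa: "st r = r" "st \<psi> = \<psi>" "st r' = r'" "st \<psi>' = \<psi>'"
    and a: "\<And>K. cideal K \<Longrightarrow> invm K r \<Longrightarrow> invm K \<psi> \<Longrightarrow> invm K a"
    and a': "\<And>K. cideal K \<Longrightarrow> invm K r' \<Longrightarrow> invm K \<psi>' \<Longrightarrow> invm K a"
  shows "r' * \<psi>' * a * \<psi> * r \<in> R"
  unfolding R_def
proof (intro CollectI allI impI)
  fix K assume K: "cideal K" and lr: "linv K (r' * \<psi>' * a * \<psi> * r) \<or> rinv K (r' * \<psi>' * a * \<psi> * r)"
  note Ki = cidealD[OF K]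
  have "invm K r \<and> invm K \<psi> \<and> invm K r' \<and> invm K \<psi>' \<and> invm K a"
    using lr
  proof
    assume l: "linv K (r' * \<psi>' * a * \<psi> * r)"
    then have r: "invm K r" by (rule linv_self_adjoint[OF K sa(1) linv_factor])
    have l1: "linv K (r' * \<psi>' * a * \<psi>)" by (rule linv_cancel_right[OF Ki l invm_rinv[OF r]])
    then have \<psi>: "invm K \<psi>" by (rule linv_self_adjoint[OF K sa(2) linv_factor])
    have aK: "invm K a" by (rule a[OF K r \<psi>])
    have l2: "linv K (r' * \<psi>' * a)" by (rule linv_cancel_right[OF Ki l1 invm_rinv[OF \<psi>]])
    have l3: "linv K (r' * \<psi>')" by (rule linv_cancel_right[OF Ki l2 invm_rinv[OF aK]])
    then have \<psi>': "invm K \<psi>'" by (rule linv_self_adjoint[OF K sa(4) linv_factor])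
    have "linv K r'" by (rule linv_cancel_right[OF Ki l3 invm_rinv[OF \<psi>']])
    then have "invm K r'" by (rule linv_self_adjoint[OF K sa(3)])
    with r \<psi> aK \<psi>' show ?thesis by simp
  next
    assume "rinv K (r' * \<psi>' * a * \<psi> * r)"
    then have l: "rinv K (r' * (\<psi>' * (a * (\<psi> * r))))" by (simp only: mult.assoc)
    then have r: "invm K r'" by (rule rinv_self_adjoint[OF K sa(3) rinv_factor])
    have l1: "rinv K (\<psi>' * (a * (\<psi> * r)))" by (rule rinv_cancel_left[OF Ki l invm_linv[OF r]])
    then have \<psi>: "invm K \<psi>'" by (rule rinv_self_adjoint[OF K sa(4) rinv_factor])
    have aK: "invm K a" by (rule a'[OF K r \<psi>])
    have l2: "rinv K (a * (\<psi> * r))" by (rule rinv_cancel_left[OF Ki l1 invm_linv[OF \<psi>]])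
    have l3: "rinv K (\<psi> * r)" by (rule rinv_cancel_left[OF Ki l2 invm_linv[OF aK]])
    then have \<psi>': "invm K \<psi>" by (rule rinv_self_adjoint[OF K sa(2) rinv_factor])
    have "rinv K r" by (rule rinv_cancel_left[OF Ki l3 invm_linv[OF \<psi>']])
    then have "invm K r" by (rule rinv_self_adjoint[OF K sa(1)])
    with r \<psi> aK \<psi>' show ?thesis by simp
  qed
  then show "invm K (r' * \<psi>' * a * \<psi> * r)" by (simp add: invm_mult[OF Ki])
qed

text \<open>Gauges are combined as \<open>r * s * r\<close> instead of \<open>r * s\<close> in order
  to stay self-adjoint.\<close>

lemma invm_sandwich:
  assumes K: "cideal K" and sa: "st r = r" "st s = s" and i: "invm K (r * s * r)"
  shows "invm K r" "invm K s"
proof -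
  note Ki = cidealD[OF K]
  show r: "invm K r" by (rule linv_self_adjoint[OF K sa(1) linv_factor[OF invm_linv[OF i]]])
  have "linv K (r * s)" by (rule linv_cancel_right[OF Ki invm_linv[OF i] invm_rinv[OF r]])
  then show "invm K s" by (rule linv_self_adjoint[OF K sa(2) linv_factor])
qed

text \<open>This ideal replaces a compactness argument: if \<open>1 - cb\<close> lies in it, then one single \<open>r\<close> makes
  \<open>b\<close> left invertible modulo every \<open>K \<in> H\<close> modulo which \<open>r\<close> is invertible.\<close>

definition gauge_ideal :: "'p set \<Rightarrow> 'p set set \<Rightarrow> 'p set" where
  "gauge_ideal S H = {y. \<forall>e>0. \<exists>r\<in>S. \<forall>K\<in>H. invm K r \<longrightarrow> nq K y < e}"

lemma gauge_idealD:
  assumes "y \<in> gauge_ideal S H" "e > 0"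
  obtains r where "r \<in> S" "\<And>K. K \<in> H \<Longrightarrow> invm K r \<Longrightarrow> nq K y < e"
  using assms by (auto simp: gauge_ideal_def)

lemma cideal_gauge_ideal:
  assumes S: "1 \<in> S" "\<And>r. r \<in> S \<Longrightarrow> st r = r" "\<And>r s. r \<in> S \<Longrightarrow> s \<in> S \<Longrightarrow> r * s * r \<in> S"
    and H: "\<And>K. K \<in> H \<Longrightarrow> cideal K"
  shows "cideal (gauge_ideal S H)"
  unfolding cideal_def two_sided_ideal_def
proof (intro conjI ballI allI impI)
  let ?T = "gauge_ideal S H"
  show "0 \<in> ?T" unfolding gauge_ideal_def
    using S(1) nq_le_n[OF H, of _ 0] by (fastforce simp: le_less_trans)
  show "x + y \<in> ?T" if xy: "x \<in> ?T" "y \<in> ?T" for x y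
    unfolding gauge_ideal_def
  proof (intro CollectI allI impI)
    fix e :: real assume "e > 0"
    then have e: "e/2 > 0" by simp
    obtain r where r: "r \<in> S" "\<And>K. K \<in> H \<Longrightarrow> invm K r \<Longrightarrow> nq K x < e/2" by (rule gauge_idealD[OF xy(1) e]) blast
    obtain s where s: "s \<in> S" "\<And>K. K \<in> H \<Longrightarrow> invm K s \<Longrightarrow> nq K y < e/2" by (rule gauge_idealD[OF xy(2) e]) blast
    have "nq K (x + y) < e" if K: "K \<in> H" "invm K (r * s * r)" for K
      using invm_sandwich[OF H[OF K(1)] S(2) S(2) K(2)] r s K(1) nq_triangle[OF H[OF K(1)], of x y] by fastforce
    then show "\<exists>t\<in>S. \<forall>K\<in>H. invm K t \<longrightarrow> nq K (x + y) < e" using S(3)[OF r(1) s(1)] by blast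
  qed
  have mult: "z \<in> ?T" if x: "x \<in> ?T" and z: "\<And>K. K \<in> H \<Longrightarrow> nq K z \<le> n a * nq K x" for x z a
    unfolding gauge_ideal_def
  proof (intro CollectI allI impI)
    fix e :: real assume "e > 0"
    have pos: "n a + 1 > 0" using n_nonneg[of a] by linarith
    then have e: "e / (n a + 1) > 0" using \<open>e > 0\<close> by simp
    obtain r where r: "r \<in> S" "\<And>K. K \<in> H \<Longrightarrow> invm K r \<Longrightarrow> nq K x < e / (n a + 1)"
      by (rule gauge_idealD[OF x e]) blast
    have "nq K z < e" if K: "K \<in> H" "invm K r" for K
    proof -
      have "nq K z \<le> n a * nq K x" by (rule z[OF K(1)])
      also have "\<dots> \<le> (n a + 1) * nq K x" using nq_nonneg[OF H[OF K(1)], of x] by (simp add: distrib_right)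
      also have "\<dots> < (n a + 1) * (e / (n a + 1))" using r(2)[OF K] pos by (rule mult_strict_left_mono)
      finally show ?thesis using pos by simp
    qed
    then show "\<exists>t\<in>S. \<forall>K\<in>H. invm K t \<longrightarrow> nq K z < e" using r(1) by blast
  qed
  show "a * x \<in> ?T" "x * a \<in> ?T" if x: "x \<in> ?T" for x a
  proof -
    have "nq K (a * x) \<le> n a * nq K x" "nq K (x * a) \<le> n a * nq K x" if "K \<in> H" for K
      using nq_mult[OF H[OF that], of a x] nq_mult[OF H[OF that], of x a]
        mult_right_mono[OF nq_le_n[OF H[OF that], of a] nq_nonneg[OF H[OF that], of x]]
      by (simp_all add: mult.commute)
    then show "a * x \<in> ?T" "x * a \<in> ?T" using mult[OF x] by blast+
  qed
  fix x assume x: "\<forall>e>0. \<exists>y\<in>?T. n (x - y) < e"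
  show "x \<in> ?T" unfolding gauge_ideal_def
  proof (intro CollectI allI impI)
    fix e :: real assume "e > 0"
    then have e: "e/2 > 0" by simp
    then obtain y where y: "y \<in> ?T" "n (x - y) < e/2" using x by blast
    obtain r where r: "r \<in> S" "\<And>K. K \<in> H \<Longrightarrow> invm K r \<Longrightarrow> nq K y < e/2" by (rule gauge_idealD[OF y(1) e]) blast
    have "nq K x < e" if K: "K \<in> H" "invm K r" for K
      using nq_triangle[OF H[OF K(1)], of "x - y" y] nq_le_n[OF H[OF K(1)], of "x - y"] r(2)[OF K] y(2) by simp
    then show "\<exists>t\<in>S. \<forall>K\<in>H. invm K t \<longrightarrow> nq K x < e" using r(1) by blast
  qed
qed

text \<open>Take for \<open>r\<close> the part \<open>k\<close> of \<open>h = st x * x\<close> near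
  0. Where \<open>k\<close> is invertible, \<open>k * \<psi> \<asymp> 0\<close> puts
  \<open>\<psi>\<close> into \<open>K\<close>, and \<open>h\<close> is small modulo
  \<open>K\<close>. As \<open>1 - k\<close> is a multiple of \<open>h\<close>, it lies in
  \<open>J\<close> and is annihilated by whatever annihilates \<open>st x\<close> from the
  left.\<close>

lemma gauge_exists:
  assumes J: "cideal J" and x: "x \<in> J" and e: "e > 0"
  obtains r where "st r = r" "n r \<le> 1" "r - 1 \<in> J" "\<And>p. p * st x \<asymp> 0 \<Longrightarrow> p * (r - 1) \<asymp> 0"
    "\<And>K. cideal K \<Longrightarrow> invm K r \<Longrightarrow> nq K x < e"
proof -
  define h where "h = st x * x"
  \<comment> \<open>The cutoff leaves \<open>nq K h \<le> 1 / c\<close>, and \<open>1 / c\<close> is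
    half of the square of \<open>e\<close>; the factor one half makes the final inequality
    strict.\<close>
  define c where "c = 2 / e\<^sup>2"
  have c: "c > 0" using e by (simp add: c_def)
  have h: "st h = h" by (simp add: h_def st_mult)
  note Ji = cidealD[OF J]
  obtain \<psi> k where k: "st k = k" "n k \<le> 1" "k * \<psi> \<asymp> 0" "\<exists>u. 1 - k \<asymp> h * u"
    and sm: "\<And>K. cideal K \<Longrightarrow> \<psi> \<in> K \<Longrightarrow> \<exists>t. n t \<le> 1 / c\<^sup>2 \<and> h * h - t \<in> K"
    by (rule cutoff[OF h c]) blast
  obtain u where u: "1 - k \<asymp> h * u" using k(4) by blast
  have ku: "k - 1 \<asymp> - (h * u)" using eqn_diff[OF eqn_refl[of 0] u] by simp
  show thesis
  proof (rule that[of k])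
    show "k - 1 \<in> J" using eqn_mem[OF J ku] Ji x by (simp add: h_def ideal_intros)
    show "p * (k - 1) \<asymp> 0" if p: "p * st x \<asymp> 0" for p
    proof -
      have "p * (k - 1) \<asymp> p * (- (h * u))" by (rule eqn_multl[OF ku])
      also have "\<dots> = (p * st x) * (- (x * u))" by (simp add: h_def mult.assoc)
      also have "\<dots> \<asymp> 0 * (- (x * u))" by (rule eqn_multr[OF p])
      finally show ?thesis by simp
    qed
    fix K assume K: "cideal K" and iK: "invm K k"
    have "\<psi> \<in> K"
    proof (rule ideal_cancel_left[OF cidealD[OF K]])
      show "k * \<psi> \<in> K" using eqn_mem[OF K k(3)] ideal_zero[OF cidealD[OF K]] by simp
      show "linv K k" using iK by (simp add: invm_def)
    qed
    then obtain t where t: "n t \<le> 1 / c\<^sup>2" "h * h - t \<in> K" using sm[OF K] by blast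
    have "nq K (h * h) \<le> (1 / c)\<^sup>2"
      using nq_cong[OF K t(2)] nq_le_n[OF K, of t] t(1) by (simp add: power_divide)
    then have "(nq K h)\<^sup>2 \<le> (1 / c)\<^sup>2" using nq_cstar[OF K, of h] by (simp add: h)
    then have "nq K h \<le> 1 / c" by (rule power2_le_imp_le) (use c in simp)
    then have "(nq K x)\<^sup>2 \<le> e\<^sup>2 / 2" using nq_cstar[OF K, of x] by (simp add: h_def c_def)
    also have "\<dots> < e\<^sup>2" using e by (simp add: zero_less_power)
    finally show "nq K x < e" by (rule power2_less_imp_less) (use e in simp)
  qed (use k in auto)
qed

lemma cutoff_bound:
  assumes "n (st b * b * \<rho>) \<le> \<beta>" "n \<rho> \<le> 2"
  shows "(n (b * \<rho>))\<^sup>2 \<le> 2 * \<beta>"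
proof -
  have "(n (b * \<rho>))\<^sup>2 \<le> n (st \<rho> * (st b * b * \<rho>))" using n_cstar[of "b * \<rho>"] by (simp add: st_mult mult.assoc)
  also have "\<dots> \<le> 2 * \<beta>" using assms by (intro n_mult_le) simp_all
  finally show ?thesis .
qed

text \<open>The left inverse survives the passage from \<open>b\<close> to \<open>a\<close>;
  membership in \<open>R\<close> makes it two-sided; passing back gives a right inverse of
  \<open>b\<close>. The bound is 1/4 because the left inverse \<open>c * l\<close> of
  \<open>a\<close> may be twice as large as \<open>l\<close>, and the second Neumann series needs
  1/2.\<close>

lemma R_perturb_invm:
  assumes a: "a \<in> R" and K: "cideal K" and l: "l * b - 1 \<in> K" and small: "n l * n (a - b) \<le> 1/4"
  shows "invm K b"
proof -
  note Ki = cidealD[OF K]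
  let ?y = "l * (b - a)"
  have "n ?y \<le> 1/4" using n_mult[of l "b - a"] small n_minus_commute[of a b] by simp
  then obtain c where c: "c * (1 - ?y) \<asymp> 1" "n c \<le> 2" using neumann_half[of ?y] by auto
  have la: "c * l * a - 1 \<in> K"
  proof -
    have "c * l * a - 1 = c * (l * b - 1) + (c * (1 - ?y) - 1)" by (simp add: algebra_simps)
    also have "\<dots> \<in> K" using Ki l eqn_cong_mem[OF K c(1)] by (simp only: ideal_intros)
    finally show ?thesis .
  qed
  then have "rinv K a" using R_D[OF a K] by (auto simp: linv_def invm_def)
  then have al: "a * (c * l) - 1 \<in> K" using invm_left_is_right[OF Ki la] by blast
  let ?z = "(a - b) * (c * l)"
  have "n ?z \<le> n (a - b) * (2 * n l)" by (rule n_mult_le[OF order_refl n_mult_le[OF c(2) order_refl]])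
  also have "\<dots> = 2 * (n l * n (a - b))" by simp
  finally have "n ?z \<le> 1/2" using small by simp
  then obtain d where d: "(1 - ?z) * d \<asymp> 1" using neumann_half by blast
  have "b * (c * l * d) - 1 = (a * (c * l) - 1) * d + ((1 - ?z) * d - 1)" by (simp add: algebra_simps)
  also have "\<dots> \<in> K" using Ki al eqn_cong_mem[OF K d] by (simp only: ideal_intros)
  finally show ?thesis using l by (auto simp: invm_def linv_def rinv_def)
qed

lemma mult_divide_cancel_pos: "(x::real) > 0 \<Longrightarrow> x * (y / x) = y" "x > 0 \<Longrightarrow> y / x * x = y"
  by simp_all

text \<open>This ideal is the largest partner of \<open>J\<close> to which
  \<open>linv_product\<close> and \<open>rinv_product\<close> apply with target
  \<open>T\<close>.\<close>

lemma cideal_transporter: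
  assumes J: "cideal J" and T: "cideal T"
  shows "cideal {t. \<forall>x\<in>J. x * t \<in> T}" (is "cideal ?L")
  unfolding cideal_def two_sided_ideal_def
proof (intro conjI ballI allI impI)
  note Ji = cidealD[OF J] and Ti = cidealD[OF T]
  show "0 \<in> ?L" using ideal_zero[OF Ti] by simp
  show "x + y \<in> ?L" if "x \<in> ?L" "y \<in> ?L" for x y using that ideal_add[OF Ti] by (simp add: distrib_left)
  show "a * x \<in> ?L" "x * a \<in> ?L" if "x \<in> ?L" for x a
    using that ideal_rmult[OF Ji, of _ a] ideal_rmult[OF Ti, of _ a] by (simp_all flip: mult.assoc)
  fix t assume t: "\<forall>e>0. \<exists>y\<in>?L. n (t - y) < e"
  have "x * t \<in> T" if x: "x \<in> J" for x
  proof (rule cideal_closed[OF T])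
    fix e :: real assume "e > 0"
    have pos: "n x + 1 > 0" using n_nonneg[of x] by linarith
    then have "e / (n x + 1) > 0" using \<open>e > 0\<close> by simp
    then obtain y where y: "y \<in> ?L" "n (t - y) < e / (n x + 1)" using t by blast
    have "n (x * t - x * y) \<le> n x * n (t - y)" using n_mult[of x "t - y"] by (simp add: right_diff_distrib)
    also have "\<dots> \<le> (n x + 1) * n (t - y)" by (simp add: distrib_right)
    also have "\<dots> < (n x + 1) * (e / (n x + 1))" using y(2) pos by (rule mult_strict_left_mono)
    finally show "\<exists>z\<in>T. n (x * t - z) < e" using y(1) x pos by auto
  qed
  then show "t \<in> ?L" by simp
qed

text \<open>Take \<open>k\<close> to be the part of \<open>b\<^sup>*b\<close> near 0.  Modulo an ideal containing \<open>k\<close>, \<open>b\<close> is bounded below, so \<open>a\<close>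
  is one-sided invertible, hence invertible, and \<open>b\<close> is invertible too.  As \<open>b\<close> is also invertible modulo \<open>J\<close>,
  it is invertible modulo the ideal generated by \<open>kJk\<close>, and a gauge \<open>r \<in> 1 + kJk\<close> detects this.  Multiplying \<open>b\<close> by \<open>r\<close>
  only affects the part of \<open>b\<close> near 0.\<close>

lemma half_perturbation:
  assumes a: "a \<in> R" and J: "cideal J" and c: "c > 0" and bJ: "invm J b"
    and small: "c * n b * n (a - b) \<le> 1/4"
  obtains r where "st r = r" "n r \<le> 1" "r - 1 \<in> J" "(n (b * (r - 1)))\<^sup>2 \<le> 4 / c"
    "\<And>K. cideal K \<Longrightarrow> invm K r \<Longrightarrow> invm K b"
proof -
  note Ji = cidealD[OF J]
  define h where "h = st b * b"
  have h: "st h = h" by (simp add: h_def st_mult)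
  obtain \<psi> k where k: "st \<psi> = \<psi>" "st k = k" "\<psi> * k \<asymp> 0"
    and kl: "\<And>K. cideal K \<Longrightarrow> k \<in> K \<Longrightarrow> \<exists>l. n l \<le> c \<and> l * h - 1 \<in> K"
    and \<psi>: "\<And>r. \<psi> * r \<asymp> 0 \<Longrightarrow> n (h * r) \<le> n r / c"
    by (rule cutoff[OF h c]) blast
  have inv_k: "invm K b" if K: "cideal K" "k \<in> K" for K
  proof -
    obtain l where l: "n l \<le> c" "l * h - 1 \<in> K" using kl[OF K] by blast
    have "n (l * st b) \<le> c * n b" using n_mult_le[OF l(1), of "st b" "n b"] by simp
    then have "n (l * st b) * n (a - b) \<le> 1/4" using mult_right_mono[OF _ n_nonneg] small by (meson order_trans)
    moreover have "l * st b * b - 1 \<in> K" using l(2) by (simp add: h_def mult.assoc)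
    ultimately show ?thesis using R_perturb_invm[OF a K(1)] by blast
  qed
  \<comment> \<open>The condition \<open>\<psi> * (r - 1) \<asymp> 0\<close> confines
    \<open>r - 1\<close> to the part of \<open>h\<close> near 0; it is what makes
    \<open>b * (r - 1)\<close> small.\<close>
  define S where "S = {r. st r = r \<and> n r \<le> 1 \<and> r - 1 \<in> J \<and> \<psi> * (r - 1) \<asymp> 0}"
  define T where "T = gauge_ideal S {K. cideal K}"
  have S1: "1 \<in> S" using n_one_le ideal_zero[OF Ji] by (simp add: S_def)
  have S3: "r * s * r \<in> S" if "r \<in> S" "s \<in> S" for r s
  proof -
    have eq: "r * s * r - 1 = (r - 1) * (s * r) + (s - 1) * r + (r - 1)" by (simp add: algebra_simps)
    have "\<psi> * (r * s * r - 1) = \<psi> * (r - 1) * (s * r) + \<psi> * (s - 1) * r + \<psi> * (r - 1)"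
      unfolding eq by (simp add: distrib_left mult.assoc)
    also have "\<dots> \<asymp> 0 * (s * r) + 0 * r + 0"
      using that by (intro eqn_add eqn_multr) (simp_all add: S_def)
    finally have "\<psi> * (r * s * r - 1) \<asymp> 0" by simp
    moreover have "r * s * r - 1 \<in> J" unfolding eq using that Ji by (simp add: S_def ideal_intros)
    moreover have "n (r * s * r) \<le> 1 * 1 * 1" using that by (intro n_mult_le) (simp_all add: S_def)
    ultimately show ?thesis using that by (simp add: S_def st_mult mult.assoc)
  qed
  have T: "cideal T" unfolding T_def
    by (rule cideal_gauge_ideal[OF S1 _ S3]) (auto simp: S_def)
  note Ti = cidealD[OF T]
  have kxk: "k * x * k \<in> T" if x: "x \<in> J" for x
    unfolding T_def gauge_ideal_def
  proof (intro CollectI allI impI)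
    fix e :: real assume e: "e > 0"
    have "k * x * k \<in> J" using x Ji by (simp add: ideal_intros)
    then obtain r where r: "st r = r" "n r \<le> 1" "r - 1 \<in> J"
      "\<And>p. p * st (k * x * k) \<asymp> 0 \<Longrightarrow> p * (r - 1) \<asymp> 0" "\<And>K. cideal K \<Longrightarrow> invm K r \<Longrightarrow> nq K (k * x * k) < e"
      by (rule gauge_exists[OF J _ e]) blast
    \<comment> \<open>The left factor \<open>k\<close> puts the gauge into \<open>S\<close>; the
      right factor is removed afterwards by \<open>cideal_square\<close>.\<close>
    have "\<psi> * st (k * x * k) \<asymp> 0"
      using eqn_multr[OF k(3), of "st x * k"] by (simp add: st_mult k mult.assoc)
    then have "r \<in> S" using r by (simp add: S_def)
    then show "\<exists>r\<in>S. \<forall>K\<in>{K. cideal K}. invm K r \<longrightarrow> nq K (k * x * k) < e" using r(5) by blast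
  qed
  have xk: "x * k \<in> T" if "x \<in> J" for x
  proof (rule cideal_square[OF T])
    have "k * (st x * x) * k \<in> T" by (rule kxk[OF ideal_lmult[OF Ji that]])
    then show "st (x * k) * (x * k) \<in> T" by (simp add: st_mult k mult.assoc)
  qed
  define L where "L = {t. \<forall>x\<in>J. x * t \<in> T}"
  have L: "cideal L" unfolding L_def by (rule cideal_transporter[OF J T])
  have "k \<in> L" using xk by (simp add: L_def)
  then have bL: "invm L b" by (rule inv_k[OF L])
  have JL: "x * y \<in> T" if "x \<in> J" "y \<in> L" for x y using that by (simp add: L_def)
  have "linv T b" using linv_product[OF _ _ JL Ti] bJ bL by (auto simp: invm_def)
  then obtain l where l: "l * b - 1 \<in> T" by (auto simp: linv_def)
  have "rinv T b" using rinv_product[OF _ _ JL Ti] bJ bL by (auto simp: invm_def)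
  then obtain l' where l': "b * l' - 1 \<in> T" by (auto simp: rinv_def)
  obtain r where r: "r \<in> S" "\<And>K. cideal K \<Longrightarrow> invm K r \<Longrightarrow> nq K (l * b - 1) < 1"
    using gauge_idealD[OF l[unfolded T_def], of 1] by auto
  obtain s where s: "s \<in> S" "\<And>K. cideal K \<Longrightarrow> invm K s \<Longrightarrow> nq K (b * l' - 1) < 1"
    using gauge_idealD[OF l'[unfolded T_def], of 1] by auto
  \<comment> \<open>One gauge for the left and the right inverse of \<open>b\<close>
    together.\<close>
  have rs: "r * s * r \<in> S" by (rule S3[OF r(1) s(1)])
  let ?r = "r * s * r"
  show thesis
  proof (rule that[of ?r])
    show "st ?r = ?r" "n ?r \<le> 1" "?r - 1 \<in> J" using rs by (simp_all add: S_def)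
    have n2: "n (?r - 1) \<le> 2" using n_diff_le[OF \<open>n ?r \<le> 1\<close> n_one_le] by simp
    \<comment> \<open>The bound 2 on \<open>n (?r - 1)\<close> enters here and again in
      \<open>cutoff_bound\<close>; together they produce the 4 in \<open>4 / c\<close>.\<close>
    have "n (h * (?r - 1)) \<le> n (?r - 1) / c" using rs by (intro \<psi>) (simp add: S_def)
    also have "\<dots> \<le> 2 / c" using n2 c by (simp add: divide_right_mono)
    finally show "(n (b * (?r - 1)))\<^sup>2 \<le> 4 / c" using cutoff_bound[of b "?r - 1" "2 / c"] n2 by (simp add: h_def)
    fix K assume K: "cideal K" and i: "invm K ?r"
    have "invm K r" "invm K s" using invm_sandwich[OF K _ _ i] r s by (auto simp: S_def)
    then have "invm K (l * b)" "invm K (b * l')" using r(2) s(2) K nq_less_1_invm by blast+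
    then show "invm K b" using linv_factor rinv_factor unfolding invm_def by blast
  qed
qed

proposition R_perturbation:
  assumes a: "a \<in> R" and J: "cideal J" and \<eta>: "\<eta> > 0"
  obtains \<epsilon> where "\<epsilon> > 0"
    "\<And>b. n (a - b) < \<epsilon> \<Longrightarrow> invm J b \<Longrightarrow> \<exists>b'\<in>R. b' - b \<in> J \<and> n (b' - b) < \<eta>"
proof -
  \<comment> \<open>Each of the two one-sided corrections may cost \<open>\<eta> / 3\<close>, and
    \<open>half_perturbation\<close> bounds its square by \<open>4 / c\<close>.\<close>
  define c where "c = (6 / \<eta>)\<^sup>2"
  have c: "c > 0" using \<eta> by (simp add: c_def)
  have c4: "4 / c = (\<eta> / 3)\<^sup>2" using \<eta> by (simp add: c_def field_simps power2_eq_square)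
  \<comment> \<open>The 1 gives \<open>n b \<le> n a + 1\<close>; the other term then yields the
    smallness that \<open>half_perturbation\<close> demands.\<close>
  define \<epsilon> where "\<epsilon> = min 1 (1 / (4 * c * (n a + 1)))"
  have pos: "n a + 1 > 0" using n_nonneg[of a] by linarith
  have \<epsilon>: "\<epsilon> > 0" using c pos by (simp add: \<epsilon>_def)
  show thesis
  proof (rule that[OF \<epsilon>])
    fix b assume ab: "n (a - b) < \<epsilon>" and bJ: "invm J b"
    have nb: "n b \<le> n a + 1" using n_diff_ge[of b a] n_minus_commute[of a b] ab by (simp add: \<epsilon>_def)
    have "c * n b * n (a - b) \<le> c * (n a + 1) * (1 / (4 * c * (n a + 1)))"
      using nb ab c pos by (intro mult_mono) (simp_all add: \<epsilon>_def)
    also have "\<dots> = (c * (n a + 1)) / (c * (n a + 1)) / 4" by simp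
    also have "\<dots> = 1/4" using c pos by (subst divide_self) auto
    finally have small: "c * n b * n (a - b) \<le> 1/4" .
    obtain r where r: "st r = r" "n r \<le> 1" "r - 1 \<in> J" "(n (b * (r - 1)))\<^sup>2 \<le> 4 / c"
      "\<And>K. cideal K \<Longrightarrow> invm K r \<Longrightarrow> invm K b"
      using half_perturbation[OF a J c bJ small] by blast
    have small': "c * n (st b) * n (st a - st b) \<le> 1/4" using small by (simp flip: st_diff)
    \<comment> \<open>The left factor comes from the same lemma for \<open>st b\<close>: the adjoint
      of its correction is \<open>(s - 1) * b\<close>.\<close>
    obtain s where s: "st s = s" "s - 1 \<in> J" "(n (st b * (s - 1)))\<^sup>2 \<le> 4 / c"
      "\<And>K. cideal K \<Longrightarrow> invm K s \<Longrightarrow> invm K b"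
      using half_perturbation[OF R_st[OF a] J c _ small'] bJ by (auto simp: invm_st J)
    have nbr: "n (b * (r - 1)) \<le> \<eta> / 3"
      by (rule power2_le_imp_le) (use r(4) c4 \<eta> in simp_all)
    have nbs: "n (st b * (s - 1)) \<le> \<eta> / 3"
      by (rule power2_le_imp_le) (use s(3) c4 \<eta> in simp_all)
    have "st (st b * (s - 1)) = (s - 1) * b" by (simp add: st_simps s(1))
    then have nsb: "n ((s - 1) * b) \<le> \<eta> / 3" using nbs n_st by metis
    \<comment> \<open>The inner factors of the sandwich are trivial here; \<open>half_lift\<close>
      is where they are needed.\<close>
    have "s * 1 * b * 1 * r \<in> R"
      by (rule sandwich_in_R) (use r s in auto)
    moreover have "s * b * r - b = (s - 1) * b * r + b * (r - 1)" by (simp add: algebra_simps)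
    moreover have "(s - 1) * b * r + b * (r - 1) \<in> J" using cidealD[OF J] r s by (simp add: ideal_intros)
    moreover have "n ((s - 1) * b * r + b * (r - 1)) < \<eta>"
      using n_triangle_le[OF n_mult_le[OF nsb r(2)] nbr] \<eta> by simp
    ultimately show "\<exists>b'\<in>R. b' - b \<in> J \<and> n (b' - b) < \<eta>"
      by (intro bexI[of _ "s * b * r"]) auto
  qed
qed

text \<open>Again \<open>k\<close> is the part of \<open>st a * a\<close> near 0. Now
  \<open>a\<close> is left invertible modulo every closed ideal containing \<open>k\<close>, and
  \<open>aJ\<close> turns this into invertibility modulo the gauge ideal \<open>T\<close>, which
  contains \<open>k\<close> and \<open>J\<close>. If \<open>\<psi>\<close> is invertible modulo
  \<open>K\<close>, then \<open>k\<close> lies in \<open>K\<close>, and the gauge \<open>r\<close>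
  adds the right inverse of \<open>a\<close>.\<close>

lemma half_lift:
  assumes J: "cideal J" and aJ: "\<And>K. cideal K \<Longrightarrow> J \<subseteq> K \<Longrightarrow> linv K a \<Longrightarrow> invm K a"
    and c: "c > 0"
  obtains r \<psi> where "st r = r" "st \<psi> = \<psi>" "r - 1 \<in> J" "n \<psi> \<le> 1" "(n (a * (1 - \<psi>)))\<^sup>2 \<le> 3 / c"
    "\<And>K. cideal K \<Longrightarrow> invm K r \<Longrightarrow> invm K \<psi> \<Longrightarrow> invm K a"
proof -
  note Ji = cidealD[OF J]
  define h where "h = st a * a"
  have h: "st h = h" by (simp add: h_def st_mult)
  obtain \<psi> k where k: "st \<psi> = \<psi>" "n \<psi> \<le> 1" "\<psi> * k \<asymp> 0" "n (h * (1 - \<psi>)) \<le> 3 / (2 * c)"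
    and kl: "\<And>K. cideal K \<Longrightarrow> k \<in> K \<Longrightarrow> \<exists>l. n l \<le> c \<and> l * h - 1 \<in> K"
    by (rule cutoff[OF h c]) blast
  have linv_k: "linv K a" if K: "cideal K" "k \<in> K" for K
  proof -
    obtain l where "l * h - 1 \<in> K" using kl[OF K] by blast
    then have "l * st a * a - 1 \<in> K" by (simp add: h_def mult.assoc)
    then show ?thesis by (auto simp: linv_def)
  qed
  define S where "S = {r. st r = r \<and> r - 1 \<in> J}"
  define T where "T = gauge_ideal S {K. cideal K \<and> k \<in> K}"
  have S1: "1 \<in> S" using ideal_zero[OF Ji] by (simp add: S_def)
  have S3: "r * s * r \<in> S" if "r \<in> S" "s \<in> S" for r s
  proof -
    have eq: "r * s * r - 1 = (r - 1) * (s * r) + (s - 1) * r + (r - 1)" by (simp add: algebra_simps)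
    have "r * s * r - 1 \<in> J" unfolding eq using that Ji by (simp add: S_def ideal_intros)
    then show ?thesis using that by (simp add: S_def st_mult mult.assoc)
  qed
  have T: "cideal T" unfolding T_def
    by (rule cideal_gauge_ideal[OF S1 _ S3]) (auto simp: S_def)
  have kT: "k \<in> T"
    unfolding T_def gauge_ideal_def
  proof (intro CollectI allI impI)
    fix e :: real assume "e > 0"
    then have "\<forall>K\<in>{K. cideal K \<and> k \<in> K}. invm K 1 \<longrightarrow> nq K k < e"
      using nq_eq_0_iff by (metis mem_Collect_eq)
    then show "\<exists>r\<in>S. \<forall>K\<in>{K. cideal K \<and> k \<in> K}. invm K r \<longrightarrow> nq K k < e" using S1 by blast
  qed
  have "J \<subseteq> T"
  proof
    fix x assume x: "x \<in> J"
    show "x \<in> T" unfolding T_def gauge_ideal_def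
    proof (intro CollectI allI impI)
      fix e :: real assume e: "e > 0"
      obtain r where r: "st r = r" "r - 1 \<in> J" "\<And>K. cideal K \<Longrightarrow> invm K r \<Longrightarrow> nq K x < e"
        by (rule gauge_exists[OF J x e]) blast
      then show "\<exists>r\<in>S. \<forall>K\<in>{K. cideal K \<and> k \<in> K}. invm K r \<longrightarrow> nq K x < e"
        by (intro bexI[of _ r]) (auto simp: S_def)
    qed
  qed
  then have "invm T a" using aJ[OF T _ linv_k[OF T kT]] by blast
  then obtain l where l: "a * l - 1 \<in> T" by (auto simp: invm_def rinv_def)
  obtain r where r: "r \<in> S" "\<And>K. K \<in> {K. cideal K \<and> k \<in> K} \<Longrightarrow> invm K r \<Longrightarrow> nq K (a * l - 1) < 1"
    using gauge_idealD[OF l[unfolded T_def], of 1] zero_less_one by metis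
  show thesis
  proof (rule that[of r \<psi>])
    show "st r = r" "r - 1 \<in> J" using r by (simp_all add: S_def)
    have "n (1 - \<psi>) \<le> 2" using n_diff_le[OF n_one_le k(2)] by simp
    then show "(n (a * (1 - \<psi>)))\<^sup>2 \<le> 3 / c" using cutoff_bound[of a "1 - \<psi>" "3 / (2 * c)"] k(4) by (simp add: h_def)
    fix K assume K: "cideal K" and i: "invm K r" "invm K \<psi>"
    have "k \<in> K"
    proof (rule ideal_cancel_left[OF cidealD[OF K]])
      show "\<psi> * k \<in> K" using eqn_mem[OF K k(3)] ideal_zero[OF cidealD[OF K]] by simp
      show "linv K \<psi>" using i by (simp add: invm_def)
    qed
    then have "invm K (a * l)" using r(2)[of K] K i nq_less_1_invm[OF K] by blast
    then show "invm K a" using linv_k[OF K \<open>k \<in> K\<close>] rinv_factor unfolding invm_def by blast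
  qed (use k in auto)
qed

text \<open>\<open>r\<close> and \<open>s\<close> are congruent to 1 modulo \<open>J\<close> without
  being close to 1, so only the quotient distance is controlled; its size comes from
  \<open>\<psi>\<close> and \<open>\<phi>\<close>.\<close>

proposition R_lift_approx:
  assumes J: "cideal J" and aJ: "\<And>K. cideal K \<Longrightarrow> J \<subseteq> K \<Longrightarrow> linv K a \<or> rinv K a \<Longrightarrow> invm K a"
    and \<eta>: "\<eta> > 0"
  obtains a' where "a' \<in> R" "nq J (a - a') < \<eta>"
proof -
  note Ji = cidealD[OF J]
  \<comment> \<open>\<open>half_lift\<close> bounds the square of each error by
    \<open>3 / c\<close>, and each error may be \<open>\<eta> / 3\<close>.\<close>
  define c where "c = 3 * (3 / \<eta>)\<^sup>2"
  have c: "c > 0" using \<eta> by (simp add: c_def)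
  have c3: "3 / c = (\<eta> / 3)\<^sup>2" using \<eta> by (simp add: c_def field_simps power2_eq_square)
  obtain r \<psi> where r: "st r = r" "st \<psi> = \<psi>" "r - 1 \<in> J" "n \<psi> \<le> 1" "(n (a * (1 - \<psi>)))\<^sup>2 \<le> 3 / c"
    "\<And>K. cideal K \<Longrightarrow> invm K r \<Longrightarrow> invm K \<psi> \<Longrightarrow> invm K a"
    using half_lift[OF J _ c, of a] aJ by blast
  have aJ': "invm K (st a)" if "cideal K" "J \<subseteq> K" "linv K (st a)" for K
    using aJ[of K] that by (simp add: linv_st invm_st)
  obtain s \<phi> where s: "st s = s" "st \<phi> = \<phi>" "s - 1 \<in> J" "n \<phi> \<le> 1" "(n (st a * (1 - \<phi>)))\<^sup>2 \<le> 3 / c"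
    "\<And>K. cideal K \<Longrightarrow> invm K s \<Longrightarrow> invm K \<phi> \<Longrightarrow> invm K (st a)"
    using half_lift[OF J aJ' c] by blast
  have n1: "n (a * (1 - \<psi>)) \<le> \<eta> / 3"
    by (rule power2_le_imp_le) (use r(5) c3 \<eta> in simp_all)
  have n2: "n (st a * (1 - \<phi>)) \<le> \<eta> / 3"
    by (rule power2_le_imp_le) (use s(5) c3 \<eta> in simp_all)
  have "st (st a * (1 - \<phi>)) = (1 - \<phi>) * a" by (simp add: st_simps s(2))
  then have n2': "n ((1 - \<phi>) * a) \<le> \<eta> / 3" using n2 n_st by metis
  let ?a = "s * \<phi> * a * \<psi> * r"
  have "?a \<in> R"
    by (rule sandwich_in_R) (use r s in \<open>auto simp: invm_st\<close>)
  moreover have "nq J (a - ?a) < \<eta>"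
  proof -
    have "(a - ?a) - (a - \<phi> * a * \<psi>) = - ((s - 1) * (\<phi> * a * \<psi> * r) + \<phi> * a * \<psi> * (r - 1))"
      by (simp add: algebra_simps)
    also have "\<dots> \<in> J" using r s Ji by (simp only: ideal_intros)
    finally have "nq J (a - ?a) = nq J (a - \<phi> * a * \<psi>)" by (rule nq_cong[OF J])
    also have "\<dots> \<le> n (a - \<phi> * a * \<psi>)" by (rule nq_le_n[OF J])
    also have "a - \<phi> * a * \<psi> = (1 - \<phi>) * a + \<phi> * (a * (1 - \<psi>))" by (simp add: algebra_simps)
    also have "n \<dots> \<le> \<eta> / 3 + 1 * (\<eta> / 3)" by (intro n_triangle_le n_mult_le n1 n2' s)
    finally show ?thesis using \<eta> by simp
  qed
  ultimately show thesis using that by blast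
qed

subsection \<open>The unital case\<close>

definition scal :: "complex \<Rightarrow> 'p" where
  "scal s = Re s *\<^sub>R 1 + Im s *\<^sub>R iu"

lemma scal_0 [simp]: "scal 0 = 0" and scal_1 [simp]: "scal 1 = 1"
  by (simp_all add: scal_def)

lemma scal_add: "scal (s + t) = scal s + scal t"
  by (simp add: scal_def algebra_simps)

lemma scal_uminus: "scal (- s) = - scal s"
  by (simp add: scal_def)

lemma scal_diff: "scal (s - t) = scal s - scal t"
  by (simp add: scal_def algebra_simps)

lemma scal_of_real: "scal (of_real r) = r *\<^sub>R 1"
  by (simp add: scal_def)

lemma scal_mult: "scal (s * t) = scal s * scal t"
  by (simp add: scal_def algebra_simps iu_square)

lemma scal_commute: "scal s * x = x * scal s"
  by (simp add: scal_def algebra_simps iu_commute)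

lemma st_scal: "st (scal s) = scal (cnj s)"
  by (simp add: scal_def st_simps)

lemma n_scal_mult: "n (scal s * x) \<le> cmod s * n x"
proof -
  have "st (scal s * x) * (scal s * x) = st x * (scal (cnj s) * scal s) * x"
    by (simp add: st_mult st_scal mult.assoc)
  also have "scal (cnj s) * scal s = (cmod s)\<^sup>2 *\<^sub>R 1"
    by (simp only: complex_norm_square[of s, symmetric] mult.commute[of "cnj s"] scal_of_real flip: scal_mult)
  finally have "(n (scal s * x))\<^sup>2 \<le> (cmod s)\<^sup>2 * n (st x * x)"
    using n_cstar[of "scal s * x"] by (simp add: n_scaleR)
  also have "\<dots> \<le> (cmod s)\<^sup>2 * (n x * n x)"
    using n_mult[of "st x" x] by (intro mult_left_mono) simp_all
  also have "\<dots> = (cmod s * n x)\<^sup>2" by (simp add: power2_eq_square)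
  finally show ?thesis by (rule power2_le_imp_le) simp
qed

lemma n_scal_le: "n (scal s) \<le> cmod s"
  using n_scal_mult[of s 1] n_one_le mult_left_mono[of "n 1" 1 "cmod s"] by simp

lemma scal_inverse:
  assumes "s \<noteq> 0"
  shows "scal (1/s) * scal s = 1" "scal s * scal (1/s) = 1"
  using assms by (simp_all flip: scal_mult)

lemma invm_scal: "two_sided_ideal K \<Longrightarrow> s \<noteq> 0 \<Longrightarrow> invm K (scal s)"
  by (rule invmI[of "scal (1/s)"]) (simp_all add: scal_inverse ideal_zero)

section \<open>The property IR, its restriction to ideals, and lifting of invertibles\<close>

definition unitization :: "'p set \<Rightarrow> 'p set" where
  "unitization J = {x. \<exists>s. x - scal s \<in> J}"

definition IR :: bool where
  "IR \<longleftrightarrow> (\<forall>b\<in>R. \<forall>e>0. \<exists>v. invm null v \<and> n (b - v) < e)"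

text \<open>Here \<open>R\<close> is that of the whole ring; \<open>sub_R_unitization\<close>
  identifies the intersection with the set formed inside \<open>unitization J\<close>.\<close>

definition ideal_IR :: "'p set \<Rightarrow> bool" where
  "ideal_IR J \<longleftrightarrow> (\<forall>b\<in>R \<inter> unitization J. \<forall>e>0. \<exists>v\<in>unitization J. invm null v \<and> n (b - v) < e)"

definition lifting :: "'p set \<Rightarrow> bool" where
  "lifting J \<longleftrightarrow> (\<forall>u. invm J u \<longrightarrow> (\<exists>v. invm null v \<and> u - v \<in> J))"

text \<open>An approximating invertible has the form \<open>w = x + scal s * (1 - y)\<close> with
  \<open>y\<close> small. Multiplied by the inverse \<open>u\<close> of \<open>1 - y\<close> it
  becomes \<open>x * u + scal s\<close>, which has the required scalar part; dividing by
  \<open>s\<close> is what needs \<open>s \<noteq> 0\<close>.\<close>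

lemma ideal_IR_scalar_part:
  assumes IR: "IR" and J: "cideal J" and d: "d \<in> R" and dJ: "d - scal s \<in> J" and s: "s \<noteq> 0" and e: "e > 0"
  obtains v where "v - scal s \<in> J" "invm null v" "n (d - v) < e"
proof -
  define x where "x = d - scal s"
  define C where "C = cmod (1/s)"
  \<comment> \<open>The bound 1/2 serves the Neumann series, the other one absorbs
    \<open>n (x * (1 - u)) \<le> n x * (2 * \<beta>)\<close>.\<close>
  define \<beta> where "\<beta> = min (1/2) (e / (4 * (n x + 1)))"
  have C: "C > 0" using s by (simp add: C_def)
  have pos: "n x + 1 > 0" using n_nonneg[of x] by linarith
  have \<beta>: "\<beta> > 0" using e pos by (simp add: \<beta>_def)
  obtain w where w: "invm null w" "n (d - w) < \<beta> / C" using IR d C \<beta> unfolding IR_def by (meson divide_pos_pos)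
  define y where "y = scal (1/s) * (d - w)"
  have "n y \<le> C * n (d - w)" unfolding y_def C_def by (rule n_scal_mult)
  also have "\<dots> < \<beta>" using w(2) C by (simp add: field_simps)
  finally have ny: "n y < \<beta>" .
  then have "n y \<le> 1/2" by (simp add: \<beta>_def)
  then obtain u where u: "u * (1 - y) \<asymp> 1" "(1 - y) * u \<asymp> 1" "n u \<le> 2" by (rule neumann_half)
  have "scal s * y = d - w" by (simp add: y_def scal_inverse[OF s] flip: mult.assoc)
  then have w_eq: "w = x + scal s * (1 - y)" by (simp add: x_def algebra_simps)
  have wu: "w * u \<asymp> x * u + scal s"
  proof -
    have "w * u = x * u + scal s * ((1 - y) * u)" by (simp add: w_eq algebra_simps)
    also have "\<dots> \<asymp> x * u + scal s * 1" by (intro eqn_add eqn_multl u) simp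
    finally show ?thesis by simp
  qed
  show thesis
  proof (rule that[of "w * u"])
    have "w * u - scal s \<asymp> x * u" using eqn_diff[OF wu eqn_refl[of "scal s"]] by simp
    then show "w * u - scal s \<in> J" using eqn_mem[OF J] dJ cidealD[OF J] by (simp add: x_def ideal_rmult)
    have "invm null u" using u by (intro invmI[of "1 - y"]) (simp_all add: eqn_def)
    then show "invm null (w * u)" by (rule invm_mult[OF null_ideal w(1)])
    have "1 - u \<asymp> - (u * y)" using eqn_diff[OF eqn_sym[OF u(1)] eqn_refl[of u]] by (simp add: algebra_simps)
    from eqn_n[OF this] have "n (1 - u) \<le> 2 * \<beta>" using n_mult_le[OF u(3) less_imp_le[OF ny]] by simp
    then have "n (x * (1 - u)) \<le> n x * (2 * \<beta>)" by (rule n_mult_le[OF order_refl])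
    also have "\<dots> \<le> n x * (2 * (e / (4 * (n x + 1))))" by (intro mult_left_mono) (simp_all add: \<beta>_def)
    also have "\<dots> < e" using e pos by (simp add: field_simps add_strict_increasing)
    finally have "n (x * (1 - u)) < e" .
    moreover have "d - w * u \<asymp> x * (1 - u)"
      using eqn_diff[OF eqn_refl[of d] wu] by (simp add: x_def algebra_simps)
    ultimately show "n (d - w * u) < e" using eqn_n by simp
  qed
qed

lemma IR_imp_ideal_IR:
  assumes IR: "IR" and J: "cideal J"
  shows "ideal_IR J"
  unfolding ideal_IR_def
proof (intro ballI allI impI)
  fix b :: 'p and e :: real assume b: "b \<in> R \<inter> unitization J" and e: "e > 0"
  note Ji = cidealD[OF J]
  obtain s where s: "b - scal s \<in> J" using b by (auto simp: unitization_def)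
  show "\<exists>v\<in>unitization J. invm null v \<and> n (b - v) < e"
  proof (cases "s = 0")
    case False
    obtain v where "v - scal s \<in> J" "invm null v" "n (b - v) < e"
      using ideal_IR_scalar_part[OF IR J _ s False e] b by blast
    then show ?thesis by (auto simp: unitization_def)
  next
    case True
    have e3: "e/3 > 0" using e by simp
    obtain \<epsilon> where \<epsilon>: "\<epsilon> > 0"
      "\<And>c. n (b - c) < \<epsilon> \<Longrightarrow> invm J c \<Longrightarrow> \<exists>b'\<in>R. b' - c \<in> J \<and> n (b' - c) < e/3"
      using R_perturbation[OF _ J e3, of b] b by blast
    define t where "t = min (\<epsilon>/2) (e/3)"
    have t: "t > 0" "t < \<epsilon>" "t \<le> e/3" using \<epsilon> e by (auto simp: t_def)
    let ?s = "of_real t :: complex"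
    \<comment> \<open>The shift by a small scalar makes \<open>c\<close> invertible modulo
      \<open>J\<close> but may lead out of \<open>R\<close>. The replacement \<open>b'\<close> is
      back in \<open>R\<close> and has the same scalar part as \<open>c\<close>.\<close>
    define c where "c = b + scal ?s"
    have nbc: "n (b - c) \<le> t" using n_scaleR_one_le[of t] t by (simp add: c_def scal_of_real)
    have cJ: "c - scal ?s \<in> J" using s True by (simp add: c_def)
    have "invm J c"
    proof (rule invm_cong[OF Ji ideal_minus_commute[OF Ji cJ]])
      show "invm J (scal ?s)" using t by (intro invm_scal[OF Ji]) simp
    qed
    then obtain b' where b': "b' \<in> R" "b' - c \<in> J" "n (b' - c) < e/3" using \<epsilon>(2)[of c] le_less_trans[OF nbc t(2)] by blast
    have b'J: "b' - scal ?s \<in> J" using ideal_cong_trans[OF Ji b'(2) cJ] .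
    have s0: "?s \<noteq> 0" using t by simp
    obtain v where v: "v - scal ?s \<in> J" "invm null v" "n (b' - v) < e/3"
      using ideal_IR_scalar_part[OF IR J b'(1) b'J s0 e3] by blast
    have "n (b - v) \<le> n (b - c) + (n (c - b') + n (b' - v))"
      using n_diff_triangle[of b v c] n_diff_triangle[of c v b'] by linarith
    also have "\<dots> < e" using nbc t b'(3) v(3) n_minus_commute[of c b'] by linarith
    finally show ?thesis using v by (auto simp: unitization_def)
  qed
qed

lemma nq_R:
  assumes J: "cideal J"
  shows "cstar_seminorm.R (nq J) = {b. \<forall>K. cideal K \<longrightarrow> J \<subseteq> K \<longrightarrow> linv K b \<or> rinv K b \<longrightarrow> invm K b}"
  using cstar_seminorm.R_def[OF nq_cstar_seminorm[OF J]] nq_cideal_iff[OF J] by auto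

lemma IR_quotient_approx:
  assumes IR: "IR" and J: "cideal J" and b: "b \<in> cstar_seminorm.R (nq J)" and e: "e > 0"
  obtains v where "invm null v" "nq J (b - v) < e"
proof -
  have e2: "e/2 > 0" using e by simp
  have "invm K b" if "cideal K" "J \<subseteq> K" "linv K b \<or> rinv K b" for K
    using b that unfolding nq_R[OF J] by blast
  then obtain a where a: "a \<in> R" "nq J (b - a) < e/2" by (rule R_lift_approx[OF J _ e2])
  obtain v where v: "invm null v" "n (a - v) < e/2" using IR a(1) e2 unfolding IR_def by blast
  have "nq J (b - v) \<le> nq J (b - a) + nq J (a - v)" using nq_triangle[OF J, of "b - a" "a - v"] by simp
  also have "\<dots> < e" using a(2) v(2) nq_le_n[OF J, of "a - v"] by linarith
  finally show thesis using that v(1) by blast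
qed

text \<open>An element invertible modulo \<open>J\<close> belongs to \<open>R\<close> of the
  quotient, so some invertible \<open>v\<close> of the ring is close to it modulo \<open>J\<close>.
  Closeness relative to the inverse \<open>w\<close> of \<open>u\<close> means that \<open>v\<close>
  is congruent to \<open>u * (1 - y)\<close> with \<open>n y < 1\<close>, and \<open>v\<close> times
  the inverse of \<open>1 - y\<close> lifts \<open>u\<close> exactly.\<close>

lemma IR_imp_lifting:
  assumes IR: "IR" and J: "cideal J"
  shows "lifting J"
  unfolding lifting_def
proof (intro allI impI)
  fix u assume u: "invm J u"
  note Ji = cidealD[OF J]
  have uR: "u \<in> cstar_seminorm.R (nq J)" unfolding nq_R[OF J] using u invm_mono by blast
  obtain w where w: "w * u - 1 \<in> J" "u * w - 1 \<in> J" by (rule invm_obtain[OF Ji u])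
  have pos: "n w + 1 > 0" using n_nonneg[of w] by linarith
  then have e: "1 / (n w + 1) > 0" by simp
  obtain v where v: "invm null v" "nq J (u - v) < 1 / (n w + 1)"
    by (rule IR_quotient_approx[OF IR J uR e])
  obtain x where x: "x \<in> J" "n (u - v - x) < 1 / (n w + 1)" using v(2) nq_less_iff[OF J] by blast
  define y where "y = w * (u - v - x)"
  have "n y \<le> n w * n (u - v - x)" unfolding y_def by (rule n_mult)
  also have "\<dots> \<le> n w * (1 / (n w + 1))" using x(2) by (intro mult_left_mono) simp_all
  also have "\<dots> < 1" using pos by simp
  finally obtain c where c: "c * (1 - y) \<asymp> 1" "(1 - y) * c \<asymp> 1" by (rule neumann) blast
  have cinv: "invm null c" using c by (intro invmI[of "1 - y"]) (simp_all add: eqn_def)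
  have vu: "v - u * (1 - y) \<in> J"
  proof -
    have "v - u * (1 - y) = (u * w - 1) * (u - v - x) - x" by (simp add: y_def algebra_simps)
    then show ?thesis using Ji w x by (simp add: ideal_diff ideal_rmult)
  qed
  have "u - v * c = u * (1 - (1 - y) * c) - (v - u * (1 - y)) * c" by (simp add: algebra_simps)
  also have "\<dots> \<in> J" using Ji vu eqn_cong_mem[OF J eqn_sym[OF c(2)]] by (simp only: ideal_intros)
  finally show "\<exists>v. invm null v \<and> u - v \<in> J" using invm_mult[OF null_ideal v(1) cinv] by blast
qed

theorem IR_extension:
  assumes J: "cideal J"
  shows "IR \<longleftrightarrow> ideal_IR J \<and> cstar_seminorm.IR (nq J) \<and> lifting J"
proof
  assume IR: "IR"
  have "cstar_seminorm.IR (nq J)"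
    unfolding cstar_seminorm.IR_def[OF nq_cstar_seminorm[OF J]] nq_null[OF J]
  proof (intro ballI allI impI)
    fix b and e :: real assume "b \<in> cstar_seminorm.R (nq J)" "e > 0"
    then obtain v where "invm null v" "nq J (b - v) < e" by (rule IR_quotient_approx[OF IR J])
    then show "\<exists>v. invm J v \<and> nq J (b - v) < e" using invm_mono[OF null_subset[OF J]] by blast
  qed
  then show "ideal_IR J \<and> cstar_seminorm.IR (nq J) \<and> lifting J"
    using IR_imp_ideal_IR IR_imp_lifting IR J by blast
next
  assume h: "ideal_IR J \<and> cstar_seminorm.IR (nq J) \<and> lifting J"
  note Ji = cidealD[OF J]
  show "IR" unfolding IR_def
  proof (intro ballI allI impI)
    fix a and e :: real assume a: "a \<in> R" and e0: "e > 0"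
    then have e: "e/2 > 0" by simp
    have e4: "e/4 > 0" using e0 by simp
    obtain \<delta> where \<delta>: "\<delta> > 0"
      "\<And>b. n (a - b) < \<delta> \<Longrightarrow> invm J b \<Longrightarrow> \<exists>b'\<in>R. b' - b \<in> J \<and> n (b' - b) < e/4"
      using R_perturbation[OF a J e4] by blast
    \<comment> \<open>The errors will be \<open>e/4\<close> for \<open>a - b\<close>,
      \<open>e/4\<close> for \<open>b - b'\<close> and \<open>e/2\<close> for
      \<open>b' - v * z\<close>.\<close>
    define \<epsilon> where "\<epsilon> = min \<delta> (e/4)"
    have \<epsilon>: "\<epsilon> > 0" "\<epsilon> \<le> \<delta>" "\<epsilon> \<le> e/4" using \<delta> e4 by (auto simp: \<epsilon>_def)
    have "a \<in> cstar_seminorm.R (nq J)" using a unfolding nq_R[OF J] R_def by blast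
    then obtain u where u: "invm J u" "nq J (a - u) < \<epsilon>"
      using h \<epsilon>(1) unfolding cstar_seminorm.IR_def[OF nq_cstar_seminorm[OF J]] nq_null[OF J] by blast
    obtain v where v: "invm null v" "u - v \<in> J" using h u(1) unfolding lifting_def by blast
    have "nq J (a - v) = nq J (a - u)" using nq_cong[OF J, of "a - v" "a - u"] v(2) by simp
    then obtain x where x: "x \<in> J" "n (a - v - x) < \<epsilon>" using u(2) nq_less_iff[OF J] by metis
    define b where "b = v + x"
    have vJ: "invm J v" using v(1) invm_mono[OF null_subset[OF J]] by blast
    have "invm J b" by (rule invm_cong[OF Ji _ vJ]) (simp add: b_def ideal_uminus[OF Ji x(1)])
    moreover have nab: "n (a - b) < \<epsilon>" using x(2) by (simp add: b_def algebra_simps)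
    then have "n (a - b) < \<delta>" using \<epsilon> by linarith
    ultimately obtain b' where b': "b' \<in> R" "b' - b \<in> J" "n (b' - b) < e/4" using \<delta>(2) by blast
    obtain w where w: "w * v - 1 \<in> null" "v * w - 1 \<in> null" by (rule invm_obtain[OF null_ideal v(1)])
    have "invm null w" using w by (intro invmI)
    then have wb: "w * b' \<in> R" by (rule R_mult_invm[OF _ b'(1)])
    have "w * b' - scal 1 = w * (b' - b) + w * x + (w * v - 1)" by (simp add: b_def algebra_simps)
    also have "\<dots> \<in> J" using Ji b'(2) x(1) w(1) null_subset[OF J] by (auto intro!: ideal_add ideal_lmult)
    finally have "w * b' \<in> unitization J" unfolding unitization_def by blast
    moreover have pos: "n v + 1 > 0" using n_nonneg[of v] by linarith
    then have "e / 2 / (n v + 1) > 0" using e by simp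
    ultimately obtain z where z: "invm null z" "n (w * b' - z) < e / 2 / (n v + 1)"
      using h wb unfolding ideal_IR_def by blast
    have "b' - v * z \<asymp> v * (w * b' - z)"
    proof -
      have "b' - v * z = v * (w * b' - z) - (v * w - 1) * b'" by (simp add: algebra_simps)
      also have "\<dots> \<asymp> v * (w * b' - z) - 0 * b'"
        using w(2) by (intro eqn_diff eqn_multr) (simp_all add: eqn_def)
      finally show ?thesis by simp
    qed
    then have "n (b' - v * z) \<le> n v * n (w * b' - z)" using eqn_n n_mult by metis
    also have "\<dots> \<le> n v * (e / 2 / (n v + 1))" using z(2) by (intro mult_left_mono) simp_all
    also have "\<dots> \<le> (n v + 1) * (e / 2 / (n v + 1))" using e pos by (intro mult_right_mono) simp_all
    also have "\<dots> = e / 2" using pos by (metis less_irrefl nonzero_mult_div_cancel_left times_divide_eq_right)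
    finally have 1: "n (b' - v * z) \<le> e / 2" .
    have "n (a - v * z) \<le> n (a - b) + (n (b - b') + n (b' - v * z))"
      using n_diff_triangle[of a "v * z" b] n_diff_triangle[of b "v * z" b'] by linarith
    also have "\<dots> < e" using nab \<epsilon>(3) b'(3) 1 n_minus_commute[of b b'] by linarith
    finally show "\<exists>v. invm null v \<and> n (a - v) < e" using invm_mult[OF null_ideal v(1) z(1)] by blast
  qed
qed

subsection \<open>Subalgebras with a unit of their own\<close>

text \<open>Closed ideals of a subalgebra \<open>A\<close>; they may fail to be ideals of the ring.
  Scalars are listed separately because they need not belong to \<open>A\<close>, whose identity can
  differ from 1.\<close>

definition sub_cideal :: "'p set \<Rightarrow> 'p set \<Rightarrow> bool" where
  "sub_cideal A K \<longleftrightarrow> K \<subseteq> A \<and> 0 \<in> K \<and> (\<forall>x\<in>K. \<forall>y\<in>K. x + y \<in> K) \<and>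
     (\<forall>x\<in>K. \<forall>c. scal c * x \<in> K) \<and> (\<forall>x\<in>K. \<forall>a\<in>A. a * x \<in> K \<and> x * a \<in> K) \<and>
     (\<forall>x\<in>A. (\<forall>e>0. \<exists>y\<in>K. n (x - y) < e) \<longrightarrow> x \<in> K)"

definition sub_R :: "'p set \<Rightarrow> 'p \<Rightarrow> 'p set" where
  "sub_R A u = {d\<in>A. \<forall>K. sub_cideal A K \<longrightarrow> (\<exists>c\<in>A. c * d - u \<in> K) \<or> (\<exists>c\<in>A. d * c - u \<in> K) \<longrightarrow>
     (\<exists>c\<in>A. c * d - u \<in> K \<and> d * c - u \<in> K)}"

definition sub_IR :: "'p set \<Rightarrow> 'p \<Rightarrow> bool" where
  "sub_IR A u \<longleftrightarrow> (\<forall>d\<in>sub_R A u. \<forall>e>0. \<exists>v\<in>A. (\<exists>c\<in>A. c * v \<asymp> u \<and> v * c \<asymp> u) \<and> n (d - v) < e)"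

lemma sub_cidealD:
  assumes "sub_cideal A K"
  shows "K \<subseteq> A" "0 \<in> K" "x \<in> K \<Longrightarrow> y \<in> K \<Longrightarrow> x + y \<in> K" "x \<in> K \<Longrightarrow> scal c * x \<in> K"
    "x \<in> K \<Longrightarrow> a \<in> A \<Longrightarrow> a * x \<in> K" "x \<in> K \<Longrightarrow> a \<in> A \<Longrightarrow> x * a \<in> K"
  using assms unfolding sub_cideal_def by blast+

lemma sub_cideal_closed:
  assumes "sub_cideal A K" "x \<in> A" "\<And>e. e > 0 \<Longrightarrow> \<exists>y\<in>K. n (x - y) < e"
  shows "x \<in> K"
  using assms unfolding sub_cideal_def by blast

lemma sub_cideal_eqn:
  assumes "sub_cideal A K" "x \<in> A" "x \<asymp> y" "y \<in> K"
  shows "x \<in> K"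
  using assms by (intro sub_cideal_closed[OF assms(1,2)] bexI[of _ y]) (auto simp: eqn_def null_def)

lemma sub_cideal_uminus: "sub_cideal A K \<Longrightarrow> x \<in> K \<Longrightarrow> - x \<in> K"
  using sub_cidealD(4)[of A K x "-1"] by (simp add: scal_uminus)

lemma sub_cideal_diff: "sub_cideal A K \<Longrightarrow> x \<in> K \<Longrightarrow> y \<in> K \<Longrightarrow> x - y \<in> K"
  using sub_cidealD(3)[of A K x "- y"] sub_cideal_uminus by simp

lemma sub_cideal_restrict:
  assumes K: "cideal K" and A0: "0 \<in> A" and A: "\<And>x y. x \<in> A \<Longrightarrow> y \<in> A \<Longrightarrow> x + y \<in> A"
    "\<And>x y. x \<in> A \<Longrightarrow> y \<in> A \<Longrightarrow> x * y \<in> A" "\<And>x c. x \<in> A \<Longrightarrow> scal c * x \<in> A"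
  shows "sub_cideal A (K \<inter> A)"
  unfolding sub_cideal_def
proof (intro conjI ballI allI impI)
  note Ki = cidealD[OF K]
  show "0 \<in> K \<inter> A" using A0 ideal_zero[OF Ki] by simp
  fix x assume "x \<in> A" "\<forall>e>0. \<exists>y\<in>K \<inter> A. n (x - y) < e"
  moreover from this have "x \<in> K" by (intro cideal_closed[OF K]) blast
  ultimately show "x \<in> K \<inter> A" by simp
qed (use A cidealD[OF K] in \<open>auto simp: ideal_add ideal_lmult ideal_rmult\<close>)

section \<open>The algebra generated by an ideal and the scalars\<close>

context
  fixes J assumes J: "cideal J"
begin

lemma Ji: "two_sided_ideal J" by (rule cidealD[OF J])

lemma unitizationI: "x - scal s \<in> J \<Longrightarrow> x \<in> unitization J"
  by (auto simp: unitization_def)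

lemma ideal_subset_unitization: "J \<subseteq> unitization J"
  using unitizationI[of _ 0] by auto

lemma scal_in_unitization: "scal s \<in> unitization J"
  using unitizationI[of "scal s" s] ideal_zero[OF Ji] by simp

lemma one_in_unitization: "1 \<in> unitization J"
  using scal_in_unitization[of 1] by simp

lemma unitization_add: "x \<in> unitization J \<Longrightarrow> y \<in> unitization J \<Longrightarrow> x + y \<in> unitization J"
proof -
  assume "x \<in> unitization J" "y \<in> unitization J"
  then obtain s t where "x - scal s \<in> J" "y - scal t \<in> J" by (auto simp: unitization_def)
  from ideal_add[OF Ji this] show ?thesis by (intro unitizationI[of _ "s + t"]) (simp add: scal_add algebra_simps)
qed

lemma unitization_mult: "x \<in> unitization J \<Longrightarrow> y \<in> unitization J \<Longrightarrow> x * y \<in> unitization J"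
proof -
  assume "x \<in> unitization J" "y \<in> unitization J"
  then obtain s t where st: "x - scal s \<in> J" "y - scal t \<in> J" by (auto simp: unitization_def)
  from ideal_cong_mult[OF Ji this] show ?thesis by (intro unitizationI[of _ "s * t"]) (simp add: scal_mult)
qed

lemma unitization_diff: "x \<in> unitization J \<Longrightarrow> y \<in> unitization J \<Longrightarrow> x - y \<in> unitization J"
  using unitization_add[of x "scal (-1) * y"] unitization_mult[OF scal_in_unitization, of y "-1"]
  by (simp add: scal_uminus)

text \<open>With \<open>d = x + scal s\<close> and \<open>s \<noteq> 0\<close>, the congruence
  \<open>c * d = 1\<close> can be solved for \<open>c\<close>: it becomes
  \<open>scal (1/s) * (1 - c * x)\<close>. If \<open>s = 0\<close>, then \<open>d\<close> lies in
  \<open>J\<close>, and \<open>c * c * d\<close> is another left inverse, now in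
  \<open>J\<close>.\<close>

lemma linv_in_unitization:
  assumes d: "d \<in> unitization J" and K: "two_sided_ideal K" and "linv K d"
  obtains c where "c \<in> unitization J" "c * d - 1 \<in> K"
proof -
  obtain c where c: "c * d - 1 \<in> K" using assms by (auto simp: linv_def)
  obtain s where s: "d - scal s \<in> J" using d by (auto simp: unitization_def)
  show thesis
  proof (cases "s = 0")
    case True
    have "c * c * d * d - 1 = c * (c * d - 1) * d + (c * d - 1)" by (simp add: algebra_simps)
    also have "\<dots> \<in> K" using K c by (simp only: ideal_intros)
    finally show thesis using that[of "c * c * d"] s True ideal_subset_unitization ideal_lmult[OF Ji, of d] by auto
  next
    case False
    let ?c = "scal (1/s) * (1 - c * (d - scal s))"
    have "c * scal s = scal s * c" by (rule scal_commute[symmetric])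
    then have "?c = scal (1/s) * (scal s * c) - scal (1/s) * (c * d - 1)"
      by (simp add: algebra_simps)
    also have "scal (1/s) * (scal s * c) = c" by (simp add: scal_inverse[OF False] flip: mult.assoc)
    finally have "?c * d - 1 = (c * d - 1) - scal (1/s) * (c * d - 1) * d" by (simp add: algebra_simps)
    also have "\<dots> \<in> K" using K c by (simp only: ideal_intros)
    finally have "?c * d - 1 \<in> K" .
    moreover have "?c \<in> unitization J"
      using ideal_lmult[OF Ji s, of c]
      by (intro unitization_mult[OF scal_in_unitization unitization_diff[OF one_in_unitization]]
          subsetD[OF ideal_subset_unitization])
    ultimately show thesis by (intro that)
  qed
qed

lemma rinv_in_unitization:
  assumes d: "d \<in> unitization J" and K: "two_sided_ideal K" and "rinv K d"
  obtains c where "c \<in> unitization J" "d * c - 1 \<in> K"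
proof -
  obtain c where c: "d * c - 1 \<in> K" using assms by (auto simp: rinv_def)
  obtain s where s: "d - scal s \<in> J" using d by (auto simp: unitization_def)
  show thesis
  proof (cases "s = 0")
    case True
    have "d * (d * c * c) - 1 = d * (d * c - 1) * c + (d * c - 1)" by (simp add: algebra_simps)
    also have "\<dots> \<in> K" using K c by (simp only: ideal_intros)
    finally have "d * (d * c * c) - 1 \<in> K" .
    moreover have "d \<in> J" using s True by simp
    then have "d * c * c \<in> J" by (intro ideal_rmult[OF Ji])
    then have "d * c * c \<in> unitization J" using ideal_subset_unitization by blast
    ultimately show thesis by (intro that)
  next
    case False
    let ?c = "(1 - (d - scal s) * c) * scal (1/s)"
    have "scal s * c * scal (1/s) = scal (1/s) * (scal s * c)" by (rule scal_commute[symmetric])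
    then have "?c = scal (1/s) * (scal s * c) - (d * c - 1) * scal (1/s)"
      by (simp add: algebra_simps)
    also have "scal (1/s) * (scal s * c) = c" by (simp add: scal_inverse[OF False] flip: mult.assoc)
    finally have "d * ?c - 1 = (d * c - 1) - d * (d * c - 1) * scal (1/s)" by (simp add: algebra_simps)
    also have "\<dots> \<in> K" using K c by (simp only: ideal_intros)
    finally have "d * ?c - 1 \<in> K" .
    moreover have "?c \<in> unitization J"
      using ideal_rmult[OF Ji s, of c]
      by (intro unitization_mult[OF unitization_diff[OF one_in_unitization] scal_in_unitization]
          subsetD[OF ideal_subset_unitization])
    ultimately show thesis by (intro that)
  qed
qed

lemma invm_in_unitization:
  assumes d: "d \<in> unitization J" and K: "two_sided_ideal K" and i: "invm K d"
  obtains c where "c \<in> unitization J" "c * d - 1 \<in> K" "d * c - 1 \<in> K"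
proof -
  obtain c where c: "c \<in> unitization J" "c * d - 1 \<in> K"
    by (rule linv_in_unitization[OF d K invm_linv[OF i]])
  show thesis by (rule that[OF c invm_left_is_right[OF K c(2) invm_rinv[OF i]]])
qed

text \<open>An ideal of an ideal is an ideal of the ring: \<open>a * x\<close> is a limit of
  \<open>(a * (1 - q)) * x\<close> with \<open>1 - q\<close> in \<open>J\<close>, and
  \<open>a * (1 - q)\<close> belongs to \<open>J\<close>. The approximate unit is formed from
  \<open>st x\<close> for left and from \<open>x\<close> for right multiples.\<close>

lemma cideal_sub_cideal_inter:
  assumes K: "sub_cideal (unitization J) K"
  shows "cideal (K \<inter> J)"
proof -
  note KD = sub_cidealD[OF K]
  have closed: "x \<in> K \<inter> J" if x: "\<And>e. e > 0 \<Longrightarrow> \<exists>y\<in>K \<inter> J. n (x - y) < e" for x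
  proof -
    have xJ: "x \<in> J" using x by (intro cideal_closed[OF J]) blast
    moreover have "x \<in> K" using x xJ ideal_subset_unitization by (intro sub_cideal_closed[OF K]) blast+
    ultimately show ?thesis by simp
  qed
  have mult: "a * x \<in> K \<inter> J" "x * a \<in> K \<inter> J" if x: "x \<in> K \<inter> J" for a x
  proof -
    have approx: "\<exists>q. st q = q \<and> 1 - q \<in> J \<and> n a * n (y * q) < e" if y: "y \<in> J" and e: "e > 0" for y e
    proof -
      have pos: "n a + 1 > 0" using n_nonneg[of a] by linarith
      define e' where "e' = e / 2 / (n a + 1)"
      have e': "e' > 0" using e pos by (simp add: e'_def)
      have sa: "st (st y * y) = st y * y" by (simp add: st_mult)
      have e'2: "e'\<^sup>2 > 0" using e' by simp
      obtain q u where q: "st q = q" "n q \<le> 1" "n (st y * y * q) \<le> e'\<^sup>2" "1 - q \<asymp> st y * y * u"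
        using approximate_unit[OF sa e'2] by metis
      have "(n (y * q))\<^sup>2 \<le> e'\<^sup>2" using n_mult_square_le[OF q(1,2), of y] q(3) by simp
      then have "n (y * q) \<le> e'" by (rule power2_le_imp_le) (use e' in simp)
      then have "n a * n (y * q) \<le> n a * e'" by (rule mult_left_mono) simp
      also have "\<dots> \<le> (n a + 1) * e'" using e' by (intro mult_right_mono) simp_all
      also have "\<dots> = e / 2" unfolding e'_def by (rule mult_divide_cancel_pos(1)[OF pos])
      finally have "n a * n (y * q) < e" using e by simp
      moreover have "st y * y * u \<in> J" using y Ji by (simp only: ideal_intros)
      ultimately show ?thesis using q(1,4) eqn_mem[OF J] by blast
    qed
    show "a * x \<in> K \<inter> J"
    proof (rule closed)
      fix e :: real assume e: "e > 0"
      have "st x \<in> J" using x cideal_st[OF J] by blast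
      then obtain q where q: "st q = q" "1 - q \<in> J" "n a * n (st x * q) < e" using approx e by blast
      have "st (st x * q) = q * x" by (simp add: st_mult q(1))
      then have nqx: "n a * n (q * x) < e" using q(3) n_st[of "st x * q"] by simp
      have "a * x - (a * (1 - q)) * x = a * (q * x)" by (simp add: algebra_simps)
      then have "n (a * x - (a * (1 - q)) * x) < e" using n_mult[of a "q * x"] nqx by simp
      moreover have "a * (1 - q) \<in> J" by (rule ideal_lmult[OF Ji q(2)])
      then have "(a * (1 - q)) * x \<in> K \<inter> J"
        using x KD(5) ideal_subset_unitization ideal_lmult[OF Ji] by blast
      ultimately show "\<exists>y\<in>K \<inter> J. n (a * x - y) < e" by blast
    qed
    show "x * a \<in> K \<inter> J"
    proof (rule closed)
      fix e :: real assume e: "e > 0"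
      obtain q where q: "1 - q \<in> J" "n a * n (x * q) < e" using approx[of x e] x e by blast
      have "x * a - x * ((1 - q) * a) = (x * q) * a" by (simp add: algebra_simps)
      then have "n (x * a - x * ((1 - q) * a)) < e" using n_mult[of "x * q" a] q(2) by (simp add: mult.commute)
      moreover have "(1 - q) * a \<in> J" by (rule ideal_rmult[OF Ji q(1)])
      then have "x * ((1 - q) * a) \<in> K \<inter> J"
        using x KD(6) ideal_subset_unitization ideal_rmult[OF Ji] by blast
      ultimately show "\<exists>y\<in>K \<inter> J. n (x * a - y) < e" by blast
    qed
  qed
  show ?thesis unfolding cideal_def two_sided_ideal_def
  proof (intro conjI ballI allI impI)
    show "0 \<in> K \<inter> J" using KD(2) ideal_zero[OF Ji] by simp
    show "x + y \<in> K \<inter> J" if "x \<in> K \<inter> J" "y \<in> K \<inter> J" for x y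
      using that KD(3) ideal_add[OF Ji] by simp
    show "x \<in> K \<inter> J" if "\<forall>e>0. \<exists>y\<in>K \<inter> J. n (x - y) < e" for x
      using that by (intro closed) simp
  qed (rule mult, assumption)+
qed

text \<open>In the harder inclusion an ideal \<open>K\<close> of \<open>unitization J\<close> has to
  be replaced by ideals of the ring: by \<open>K1 = K \<inter> J\<close> and by the transporter
  \<open>L\<close> of \<open>J\<close> into \<open>K1\<close>, which contains \<open>K\<close>. So
  \<open>d\<close> is invertible modulo \<open>L\<close>. If its scalar part is nonzero, it is
  invertible modulo \<open>J\<close> too, hence modulo \<open>K1\<close>. Otherwise \<open>d\<close>
  lies in \<open>J\<close>, and a one-sided inverse modulo \<open>K\<close> provides an element of
  \<open>J\<close> that is congruent to 1 modulo \<open>K\<close>.\<close>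

lemma sub_R_unitization: "sub_R (unitization J) 1 = R \<inter> unitization J"
proof (intro equalityI subsetI)
  fix d assume d: "d \<in> sub_R (unitization J) 1"
  then have dA: "d \<in> unitization J" by (simp add: sub_R_def)
  have "invm K d" if K: "cideal K" and lr: "linv K d \<or> rinv K d" for K
  proof -
    let ?A = "unitization J"
    have sK: "sub_cideal ?A (K \<inter> ?A)"
      using ideal_subset_unitization ideal_zero[OF Ji]
      by (intro sub_cideal_restrict[OF K] unitization_add unitization_mult scal_in_unitization) auto
    have inA: "c * d - 1 \<in> ?A" "d * c - 1 \<in> ?A" if "c \<in> ?A" for c
      using that dA by (auto intro!: unitization_diff unitization_mult one_in_unitization)
    have "(\<exists>c\<in>?A. c * d - 1 \<in> K \<inter> ?A) \<or> (\<exists>c\<in>?A. d * c - 1 \<in> K \<inter> ?A)"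
      using lr
    proof
      assume "linv K d"
      then obtain c where "c \<in> ?A" "c * d - 1 \<in> K" by (rule linv_in_unitization[OF dA cidealD[OF K]])
      then show ?thesis using inA by blast
    next
      assume "rinv K d"
      then obtain c where "c \<in> ?A" "d * c - 1 \<in> K" by (rule rinv_in_unitization[OF dA cidealD[OF K]])
      then show ?thesis using inA by blast
    qed
    then have "\<exists>c\<in>?A. c * d - 1 \<in> K \<inter> ?A \<and> d * c - 1 \<in> K \<inter> ?A"
      using d sK unfolding sub_R_def by blast
    then show "invm K d" by (auto intro: invmI)
  qed
  then show "d \<in> R \<inter> unitization J" using dA by (auto simp: R_def)
next
  fix d assume d: "d \<in> R \<inter> unitization J"
  let ?A = "unitization J"
  have dA: "d \<in> ?A" using d by simp
  have "\<exists>c\<in>?A. c * d - 1 \<in> K \<and> d * c - 1 \<in> K"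
    if K: "sub_cideal ?A K" and lr: "(\<exists>c\<in>?A. c * d - 1 \<in> K) \<or> (\<exists>c\<in>?A. d * c - 1 \<in> K)" for K
  proof -
    note KD = sub_cidealD[OF K]
    define K1 where "K1 = K \<inter> J"
    define L where "L = {t. \<forall>x\<in>J. x * t \<in> K1}"
    have K1: "cideal K1" unfolding K1_def by (rule cideal_sub_cideal_inter[OF K])
    note K1i = cidealD[OF K1]
    have L: "cideal L" unfolding L_def by (rule cideal_transporter[OF J K1])
    have JL: "x * y \<in> K1" if "x \<in> J" "y \<in> L" for x y using that by (simp add: L_def)
    have KL: "K \<subseteq> L" using KD(5) ideal_subset_unitization ideal_rmult[OF Ji] by (auto simp: L_def K1_def)
    have KJ: "x * y \<in> K1" if "x \<in> K" "y \<in> J" for x y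
      using that KD(6) ideal_subset_unitization ideal_lmult[OF Ji] by (auto simp: K1_def)
    have "linv L d \<or> rinv L d" using lr KL by (auto simp: linv_def rinv_def)
    then have dL: "invm L d" using d R_D[OF _ L] by blast
    obtain s where s: "d - scal s \<in> J" using dA by (auto simp: unitization_def)
    show ?thesis
    proof (cases "s = 0")
      case False
      have dJ: "invm J d"
        by (rule invm_cong[OF Ji ideal_minus_commute[OF Ji s] invm_scal[OF Ji False]])
      have "linv K1 d" using linv_product[OF _ _ JL K1i] dJ dL by (auto simp: invm_def)
      moreover have "rinv K1 d" using rinv_product[OF _ _ JL K1i] dJ dL by (auto simp: invm_def)
      ultimately have "invm K1 d" by (simp add: invm_def)
      then obtain c where "c \<in> ?A" "c * d - 1 \<in> K1" "d * c - 1 \<in> K1" by (rule invm_in_unitization[OF dA K1i])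
      then show ?thesis by (auto simp: K1_def)
    next
      case True
      then have dJ: "d \<in> J" using s by simp
      obtain c' where c': "c' * d - 1 \<in> L" "d * c' - 1 \<in> L" by (rule invm_obtain[OF cidealD[OF L] dL])
      \<comment> \<open>The usual agreement of left and right inverses, arranged so that every
        factor stays in \<open>?A\<close>; \<open>K\<close> is an ideal only there.\<close>
      have both: "\<exists>c\<in>?A. c * d - 1 \<in> K \<and> d * c - 1 \<in> K"
        if "a \<in> ?A" "b \<in> ?A" "a * d - 1 \<in> K" "d * b - 1 \<in> K" for a b
      proof -
        have "d * a - 1 = d * (a * d - 1) * b - (d * a - 1) * (d * b - 1)"
          by (simp add: algebra_simps)
        moreover have "(d * a - 1) * (d * b - 1) \<in> K"
          using that dA by (intro KD(5) unitization_diff unitization_mult one_in_unitization)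
        moreover have "d * (a * d - 1) * b \<in> K" using that dA by (intro KD(5,6))
        ultimately have "d * a - 1 \<in> K"
          using sub_cideal_diff[OF K] by (metis (no_types))
        then show ?thesis using that by blast
      qed
      from lr show ?thesis
      proof
        assume "\<exists>c\<in>?A. c * d - 1 \<in> K"
        then obtain c where c: "c \<in> ?A" "c * d - 1 \<in> K" by blast
        \<comment> \<open>\<open>e0\<close> lies in \<open>J\<close> and is 1 modulo
          \<open>K\<close>. Multiplication by it moves \<open>c'\<close> into \<open>?A\<close>, and
          turns the congruence for \<open>c'\<close>, which holds only modulo \<open>L\<close>, into
          one modulo \<open>K1\<close>.\<close>
        define e0 where "e0 = c * d"
        have e0: "e0 \<in> J" "e0 - 1 \<in> K" using c dJ ideal_lmult[OF Ji] by (simp_all add: e0_def)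
        have dc: "d * c' \<in> J" using dJ ideal_rmult[OF Ji] by simp
        have "d * c' - e0 = e0 * (d * c' - 1) - (e0 - 1) * (d * c')" by (simp add: algebra_simps)
        also have "\<dots> \<in> K1" using JL[OF e0(1) c'(2)] KJ[OF e0(2) dc] K1i by (simp only: ideal_intros)
        finally have "d * c' - e0 \<in> K1" .
        then have "(d * c' - e0) * e0 \<in> K" using ideal_rmult[OF K1i] by (auto simp: K1_def)
        moreover have "(e0 - 1) * e0 \<in> K" using e0 ideal_subset_unitization by (intro KD(6)) auto
        moreover have "d * (c' * e0) - 1 = (d * c' - e0) * e0 + ((e0 - 1) * e0 + (e0 - 1))"
          by (simp add: algebra_simps)
        ultimately have "d * (c' * e0) - 1 \<in> K" using e0(2) by (simp only: KD(3))
        moreover have "c' * e0 \<in> ?A" using e0(1) ideal_lmult[OF Ji] ideal_subset_unitization by blast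
        ultimately show ?thesis using both c by blast
      next
        assume "\<exists>c\<in>?A. d * c - 1 \<in> K"
        then obtain c where c: "c \<in> ?A" "d * c - 1 \<in> K" by blast
        define e0 where "e0 = d * c"
        have e0: "e0 \<in> J" "e0 - 1 \<in> K" using c dJ ideal_rmult[OF Ji] by (simp_all add: e0_def)
        have "(e0 * c') * d - 1 = e0 * (c' * d - 1) + (e0 - 1)" by (simp add: algebra_simps)
        also have "\<dots> \<in> K" using JL[OF e0(1) c'(1)] e0(2) KD(3) by (auto simp: K1_def)
        finally have "(e0 * c') * d - 1 \<in> K" .
        moreover have "e0 * c' \<in> ?A" using e0(1) ideal_rmult[OF Ji] ideal_subset_unitization by blast
        ultimately show ?thesis using both c by blast
      qed
    qed
  qed
  then show "d \<in> sub_R ?A 1" using dA by (simp add: sub_R_def)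
qed

proposition sub_IR_unitization: "sub_IR (unitization J) 1 \<longleftrightarrow> ideal_IR J"
proof -
  have "(\<exists>c\<in>unitization J. c * v \<asymp> 1 \<and> v * c \<asymp> 1) \<longleftrightarrow> invm null v" if v: "v \<in> unitization J" for v
  proof
    assume "invm null v"
    then obtain c where "c \<in> unitization J" "c * v - 1 \<in> null" "v * c - 1 \<in> null"
      by (rule invm_in_unitization[OF v null_ideal])
    then show "\<exists>c\<in>unitization J. c * v \<asymp> 1 \<and> v * c \<asymp> 1" by (auto simp: eqn_def)
  qed (auto simp: eqn_def intro: invmI)
  then show ?thesis unfolding sub_IR_def ideal_IR_def sub_R_unitization by blast
qed

section \<open>Ideals with an identity of their own\<close>

context
  fixes u assumes uJ: "u \<in> J" and ul: "\<And>x. x \<in> J \<Longrightarrow> u * x \<asymp> x" and ur: "\<And>x. x \<in> J \<Longrightarrow> x * u \<asymp> x"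
begin

text \<open>Both sides lie in \<open>J\<close>, where \<open>u\<close> acts as an identity; so
  \<open>u\<close> is central in the whole ring.\<close>

lemma unit_commute: "x * u \<asymp> u * x"
proof -
  have "x * u \<asymp> u * (x * u)" by (rule eqn_sym[OF ul[OF ideal_lmult[OF Ji uJ]]])
  also have "\<dots> = (u * x) * u" by (simp add: mult.assoc)
  also have "\<dots> \<asymp> u * x" by (rule ur[OF ideal_rmult[OF Ji uJ]])
  finally show ?thesis .
qed

lemma mult_unit_mult: "a * u * (b * u) \<asymp> a * b * u"
proof -
  have "a * u * (b * u) = a * (u * (b * u))" by (simp add: mult.assoc)
  also have "\<dots> \<asymp> a * (b * u)" by (rule eqn_multl[OF ul[OF ideal_lmult[OF Ji uJ]]])
  finally show ?thesis by (simp add: mult.assoc)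
qed

lemma sub_R_subset_R: "sub_R J u \<subseteq> R"
proof
  fix d assume d: "d \<in> sub_R J u"
  then have dJ: "d \<in> J" by (simp add: sub_R_def)
  have "invm K d" if K: "cideal K" and lr: "linv K d \<or> rinv K d" for K
  proof -
    note Kid = cidealD[OF K]
    have sK: "sub_cideal J (K \<inter> J)" using Ji
      by (intro sub_cideal_restrict[OF K]) (auto intro: ideal_intros)
    \<comment> \<open>\<open>1 - u\<close> annihilates \<open>d\<close> on both sides up to
      \<open>\<asymp>\<close>, and \<open>d\<close> is one-sided invertible modulo \<open>K\<close>.
      Thus 1 and \<open>u\<close> may be interchanged in the congruences.\<close>
    have u1: "1 - u \<in> K"
      using lr
    proof
      assume "linv K d"
      then obtain c where c: "c * d - 1 \<in> K" by (auto simp: linv_def)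
      have "1 - u = - ((c * d - 1) * (1 - u)) - c * (d * u - d)" by (simp add: algebra_simps)
      also have "\<dots> \<in> K" using Kid c eqn_cong_mem[OF K ur[OF dJ]] by (simp only: ideal_intros)
      finally show ?thesis .
    next
      assume "rinv K d"
      then obtain c where c: "d * c - 1 \<in> K" by (auto simp: rinv_def)
      have "1 - u = - ((1 - u) * (d * c - 1)) - (u * d - d) * c" by (simp add: algebra_simps)
      also have "\<dots> \<in> K" using Kid c eqn_cong_mem[OF K ul[OF dJ]] by (simp only: ideal_intros)
      finally show ?thesis .
    qed
    have "(\<exists>c\<in>J. c * d - u \<in> K \<inter> J) \<or> (\<exists>c\<in>J. d * c - u \<in> K \<inter> J)"
      using lr
    proof
      assume "linv K d"
      then obtain c where c: "c * d - 1 \<in> K" by (auto simp: linv_def)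
      have "u * c \<in> J" using uJ ideal_rmult[OF Ji] by blast
      moreover have "u * c * d - u = u * (c * d - 1)" by (simp add: algebra_simps)
      moreover have "u * (c * d - 1) \<in> K \<inter> J" using uJ c Ji Kid by (simp add: ideal_intros)
      ultimately show ?thesis by metis
    next
      assume "rinv K d"
      then obtain c where c: "d * c - 1 \<in> K" by (auto simp: rinv_def)
      have "c * u \<in> J" using uJ ideal_lmult[OF Ji] by blast
      moreover have "d * (c * u) - u = (d * c - 1) * u" by (simp add: algebra_simps)
      moreover have "(d * c - 1) * u \<in> K \<inter> J" using uJ c Ji Kid by (simp add: ideal_intros)
      ultimately show ?thesis by metis
    qed
    then obtain c where c: "c * d - u \<in> K" "d * c - u \<in> K"
      using d sK unfolding sub_R_def by blast
    show "invm K d"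
      using ideal_diff[OF Kid c(1) u1] ideal_diff[OF Kid c(2) u1] by (intro invmI[of c]) simp_all
  qed
  then show "d \<in> R" by (simp add: R_def)
qed

text \<open>Since \<open>u\<close> is central, multiplication by \<open>u\<close> is multiplicative
  up to \<open>\<asymp>\<close>, and a closed ideal \<open>K\<close> of \<open>J\<close> pulls back
  along it to the closed ideal \<open>L\<close> of the ring, where \<open>d \<in> R\<close> can be
  used.\<close>

lemma mult_unit_in_sub_R:
  assumes d: "d \<in> R"
  shows "d * u \<in> sub_R J u"
proof -
  have duJ: "d * u \<in> J" using uJ ideal_lmult[OF Ji] by blast
  have "\<exists>c\<in>J. c * (d * u) - u \<in> K \<and> d * u * c - u \<in> K"
    if K: "sub_cideal J K" and lr: "(\<exists>c\<in>J. c * (d * u) - u \<in> K) \<or> (\<exists>c\<in>J. d * u * c - u \<in> K)" for K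
  proof -
    note KD = sub_cidealD[OF K]
    have Keqn: "x \<in> K \<Longrightarrow> x \<asymp> y \<Longrightarrow> y \<in> J \<Longrightarrow> y \<in> K" for x y
      using sub_cideal_eqn[OF K _ eqn_sym] by blast
    have muJ: "a * u \<in> J" for a using uJ ideal_lmult[OF Ji] by blast
    define L where "L = {t. t * u \<in> K}"
    have L: "cideal L" unfolding cideal_def two_sided_ideal_def
    proof (intro conjI ballI allI impI)
      show "0 \<in> L" using KD(2) by (simp add: L_def)
      show "x + y \<in> L" if "x \<in> L" "y \<in> L" for x y using that KD(3) by (simp add: L_def distrib_right)
      show "a * x \<in> L" if "x \<in> L" for a x
        using that Keqn[OF KD(5)[OF _ muJ] mult_unit_mult muJ] by (simp add: L_def)
      show "x * a \<in> L" if "x \<in> L" for a x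
        using that Keqn[OF KD(6)[OF _ muJ] mult_unit_mult muJ] by (simp add: L_def)
      fix t assume t: "\<forall>e>0. \<exists>y\<in>L. n (t - y) < e"
      have "t * u \<in> K"
      proof (rule sub_cideal_closed[OF K muJ])
        fix e :: real assume "e > 0"
        have pos: "n u + 1 > 0" using n_nonneg[of u] by linarith
        then have "e / (n u + 1) > 0" using \<open>e > 0\<close> by simp
        then obtain y where y: "y \<in> L" "n (t - y) < e / (n u + 1)" using t by blast
        have "n (t * u - y * u) \<le> n (t - y) * n u" using n_mult[of "t - y" u] by (simp add: left_diff_distrib)
        also have "\<dots> \<le> n (t - y) * (n u + 1)" by (simp add: distrib_left)
        also have "\<dots> < e / (n u + 1) * (n u + 1)" using y(2) pos by (rule mult_strict_right_mono)
        finally show "\<exists>z\<in>K. n (t * u - z) < e" using y(1) pos by (auto simp: L_def)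
      qed
      then show "t \<in> L" by (simp add: L_def)
    qed
    have "linv L d \<or> rinv L d"
      using lr
    proof
      assume "\<exists>c\<in>J. c * (d * u) - u \<in> K"
      then obtain c where "c * (d * u) - u \<in> K" by blast
      then have "c * d - 1 \<in> L" by (simp add: L_def algebra_simps)
      then show ?thesis by (auto simp: linv_def)
    next
      assume "\<exists>c\<in>J. d * u * c - u \<in> K"
      then obtain c where c: "c \<in> J" "d * u * c - u \<in> K" by blast
      have "d * u * c = d * (u * c)" by (simp add: mult.assoc)
      also have "\<dots> \<asymp> d * (c * u)" by (intro eqn_multl eqn_sym[OF unit_commute])
      finally have "d * u * c - u \<asymp> d * (c * u) - u" by (intro eqn_diff) simp_all
      also have "d * (c * u) - u = (d * c - 1) * u" by (simp add: algebra_simps)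
      finally have "(d * c - 1) * u \<in> K" using Keqn[OF c(2) _ muJ] by blast
      then show ?thesis unfolding rinv_def L_def by blast
    qed
    then have dL: "invm L d" by (rule R_D[OF d L])
    obtain c where c: "c * d - 1 \<in> L" "d * c - 1 \<in> L" by (rule invm_obtain[OF cidealD[OF L] dL])
    have inJ: "a * u - u \<in> J" for a using muJ[of "a - 1"] by (simp add: algebra_simps)
    have cK: "c * d * u - u \<in> K" "d * c * u - u \<in> K"
      using c by (simp_all add: L_def left_diff_distrib)
    have eq1: "c * u * (d * u) - u \<asymp> c * d * u - u" by (intro eqn_diff mult_unit_mult) simp
    have in1: "c * u * (d * u) - u \<in> J" using inJ[of "c * u * d"] by (simp only: mult.assoc)
    have 1: "c * u * (d * u) - u \<in> K" by (rule sub_cideal_eqn[OF K in1 eq1 cK(1)])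
    have eq2: "d * u * (c * u) - u \<asymp> d * c * u - u" by (intro eqn_diff mult_unit_mult) simp
    have in2: "d * u * (c * u) - u \<in> J" using inJ[of "d * u * c"] by (simp only: mult.assoc)
    have 2: "d * u * (c * u) - u \<in> K" by (rule sub_cideal_eqn[OF K in2 eq2 cK(2)])
    show ?thesis using 1 2 muJ by blast
  qed
  then show ?thesis using duJ by (simp add: sub_R_def)
qed

text \<open>Up to \<open>\<asymp>\<close>, \<open>unitization J\<close> splits into \<open>J\<close>
  and the multiples of \<open>1 - u\<close>. Multiplication by \<open>u\<close> projects to the
  first summand; the second is a scalar, which is invertible after an arbitrarily small
  change.\<close>

proposition sub_IR_unital_ideal: "sub_IR J u \<longleftrightarrow> ideal_IR J"
proof
  assume E: "ideal_IR J"
  show "sub_IR J u" unfolding sub_IR_def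
  proof (intro ballI allI impI)
    fix d and e :: real assume d: "d \<in> sub_R J u" and e: "e > 0"
    have dJ: "d \<in> J" using d by (simp add: sub_R_def)
    have pos: "n u + 1 > 0" using n_nonneg[of u] by linarith
    then have "e / (n u + 1) > 0" using e by simp
    then obtain v where v: "invm null v" "n (d - v) < e / (n u + 1)"
      using E d dJ sub_R_subset_R ideal_subset_unitization unfolding ideal_IR_def by blast
    obtain w where w: "w * v \<asymp> 1" "v * w \<asymp> 1"
      using invm_obtain[OF null_ideal v(1)] by (auto simp: eqn_def)
    have "w * u * (v * u) \<asymp> u" "v * u * (w * u) \<asymp> u"
      using eqn_trans[OF mult_unit_mult eqn_multr[OF w(1), of u]]
        eqn_trans[OF mult_unit_mult eqn_multr[OF w(2), of u]] by simp_all
    moreover have "n (d - v * u) < e"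
    proof -
      have "d - v * u \<asymp> d * u - v * u" by (intro eqn_diff eqn_sym[OF ur[OF dJ]]) simp
      then have "n (d - v * u) \<le> n (d - v) * n u" using eqn_n n_mult[of "d - v" u] by (simp add: left_diff_distrib)
      also have "\<dots> \<le> n (d - v) * (n u + 1)" by (simp add: distrib_left)
      also have "\<dots> < e / (n u + 1) * (n u + 1)" using v(2) pos by (rule mult_strict_right_mono)
      finally show ?thesis using pos by simp
    qed
    ultimately show "\<exists>v\<in>J. (\<exists>c\<in>J. c * v \<asymp> u \<and> v * c \<asymp> u) \<and> n (d - v) < e"
      using uJ ideal_lmult[OF Ji] by blast
  qed
next
  assume S: "sub_IR J u"
  show "ideal_IR J" unfolding ideal_IR_def
  proof (intro ballI allI impI)
    fix d and e :: real assume d: "d \<in> R \<inter> unitization J" and e: "e > 0"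
    obtain s where s: "d - scal s \<in> J" using d by (auto simp: unitization_def)
    have e2: "e / 2 > 0" using e by simp
    obtain v w where v: "v \<in> J" "w \<in> J" "w * v \<asymp> u" "v * w \<asymp> u" "n (d * u - v) < e / 2"
      using S mult_unit_in_sub_R[of d] d e2 unfolding sub_IR_def by blast
    have pos: "n (1 - u) + 1 > 0" using n_nonneg[of "1 - u"] by linarith
    define r where "r = e / 2 / (n (1 - u) + 1)"
    have r: "r > 0" using e pos by (simp add: r_def)
    \<comment> \<open>A vanishing second component is replaced by \<open>r\<close>, chosen so small
      that \<open>r * n (1 - u)\<close> stays below half of \<open>e\<close>.\<close>
    define t where "t = (if s = 0 then of_real r else s)"
    have t0: "t \<noteq> 0" using r by (simp add: t_def)
    have st: "cmod (s - t) * n (1 - u) < e / 2"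
    proof (cases "s = 0")
      case True
      have "cmod (s - t) = r" using True r by (simp add: t_def)
      then have "cmod (s - t) * n (1 - u) = r * n (1 - u)" by simp
      also have "\<dots> < r * (n (1 - u) + 1)" using r by (intro mult_strict_left_mono) simp_all
      also have "\<dots> = e / 2" unfolding r_def by (rule mult_divide_cancel_pos(2)[OF pos])
      finally show ?thesis .
    qed (use e in \<open>simp add: t_def\<close>)
    have uu: "u * u \<asymp> u" by (rule ul[OF uJ])
    have inverse: "(a + scal p * (1 - u)) * (b + scal q * (1 - u)) \<asymp> 1"
      if "a \<in> J" "b \<in> J" "a * b \<asymp> u" "scal p * scal q = 1" for a b p q
    proof -
      have "(a + scal p * (1 - u)) * (b + scal q * (1 - u))
          = a * b + a * scal q * (1 - u) + scal p * (b - u * b) + scal p * ((1 - u) * scal q) * (1 - u)"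
        by (simp add: algebra_simps)
      also have "a * scal q = scal q * a" by (rule scal_commute[symmetric])
      also have "(1 - u) * scal q = scal q * (1 - u)" by (rule scal_commute[symmetric])
      also have "a * b + scal q * a * (1 - u) + scal p * (b - u * b) + scal p * (scal q * (1 - u)) * (1 - u)
          = a * b + scal q * (a - a * u) + scal p * (b - u * b) + (scal p * scal q) * (1 - u - (u - u * u))"
        by (simp add: algebra_simps)
      also have "\<dots> \<asymp> u + scal q * (a - a) + scal p * (b - b) + (scal p * scal q) * (1 - u - (u - u))"
        using that by (intro eqn_add eqn_multl eqn_diff ul ur uu) simp_all
      finally show ?thesis using that(4) by simp
    qed
    let ?v = "v + scal t * (1 - u)" and ?w = "w + scal (1/t) * (1 - u)"
    have "invm null ?v"
      using inverse[of w v "1/t" t] inverse[of v w t "1/t"] v scal_inverse[OF t0]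
      by (intro invmI[of ?w]) (simp_all add: eqn_def)
    moreover have "?v - scal t = v - scal t * u" by (simp add: algebra_simps)
    then have "?v - scal t \<in> J" using v(1) uJ Ji by (simp only: ideal_intros)
    then have "?v \<in> unitization J" by (rule unitizationI)
    moreover have "n (d - ?v) < e"
    proof -
      have "d - ?v = (d * u - v) + scal (s - t) * (1 - u) + ((d - scal s) - (d - scal s) * u)"
        by (simp add: scal_diff algebra_simps)
      also have "\<dots> \<asymp> (d * u - v) + scal (s - t) * (1 - u) + ((d - scal s) - (d - scal s))"
        using ur[OF s] by (intro eqn_add eqn_diff) simp_all
      finally have "d - ?v \<asymp> (d * u - v) + scal (s - t) * (1 - u)" by (simp only: diff_self add_0_right)
      then have "n (d - ?v) = n ((d * u - v) + scal (s - t) * (1 - u))" by (rule eqn_n)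
      also have "\<dots> \<le> n (d * u - v) + cmod (s - t) * n (1 - u)"
        by (rule n_triangle_le[OF order_refl n_scal_mult])
      finally show ?thesis using v(5) st by linarith
    qed
    ultimately show "\<exists>v\<in>unitization J. invm null v \<and> n (d - v) < e" by blast
  qed
qed

end
end
end

section \<open>Quotients of nonunital rings\<close>

locale nonunital_ring = abelian_group U for U :: "'u star_alg" (structure) +
  assumes ring_mult_closed: "\<lbrakk>x \<in> carrier U; y \<in> carrier U\<rbrakk> \<Longrightarrow> x \<otimes> y \<in> carrier U"
    and ring_distrib_right: "\<lbrakk>x \<in> carrier U; y \<in> carrier U; z \<in> carrier U\<rbrakk>
      \<Longrightarrow> (x \<oplus> y) \<otimes> z = (x \<otimes> z) \<oplus> (y \<otimes> z)"
    and ring_distrib_left: "\<lbrakk>x \<in> carrier U; y \<in> carrier U; z \<in> carrier U\<rbrakk>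
      \<Longrightarrow> z \<otimes> (x \<oplus> y) = (z \<otimes> x) \<oplus> (z \<otimes> y)"
begin

lemma GL_iff:
  assumes e: "is_identity U e"
  shows "b \<in> GL U \<longleftrightarrow> b \<in> carrier U \<and> (\<exists>c\<in>carrier U. c \<otimes> b = e \<and> b \<otimes> c = e)"
proof -
  have "is_identity U x \<longleftrightarrow> x = e" for x
    using e unfolding is_identity_def by metis
  then show ?thesis by (simp add: GL_def)
qed

definition alg_ideal :: "'u set \<Rightarrow> bool" where
  "alg_ideal K \<longleftrightarrow> additive_subgroup K U \<and> (\<forall>a\<in>carrier U. \<forall>x\<in>K. a \<otimes> x \<in> K \<and> x \<otimes> a \<in> K)"

lemma closed_ideal_alg_ideal: "closed_ideal U K \<Longrightarrow> alg_ideal K"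
  by (simp add: closed_ideal_def alg_ideal_def)

context
  fixes K assumes K: "alg_ideal K"
begin

lemma K_subgroup: "abelian_subgroup K U"
  using K by (intro abelian_subgroupI3) (auto simp: alg_ideal_def intro: abelian_group_axioms)

interpretation KS: abelian_subgroup K U by (rule K_subgroup)

lemma K_carrier: "x \<in> K \<Longrightarrow> x \<in> carrier U" by (rule KS.a_Hcarr)

lemma coset_eq_iff:
  assumes "x \<in> carrier U" "y \<in> carrier U"
  shows "K +> x = K +> y \<longleftrightarrow> x \<ominus> y \<in> K"
proof
  assume "K +> x = K +> y"
  then show "x \<ominus> y \<in> K"
    using KS.a_rcos_self[OF assms(1)] KS.a_rcos_module_imp[OF assms(2)] by (simp add: a_minus_def)
next
  assume "x \<ominus> y \<in> K"
  then have "x \<in> K +> y" using assms by (simp add: KS.a_rcos_module a_minus_def)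
  then show "K +> x = K +> y" using assms a_repr_independence[OF _ _ KS.a_subgroup] by metis
qed

lemma coset_absorb: "k \<in> K \<Longrightarrow> x \<in> carrier U \<Longrightarrow> K +> (k \<oplus> x) = K +> x"
  using a_coset_add_assoc[of K k x] KS.a_rcos_const KS.a_subset K_carrier by simp

text \<open>\<open>rcoset_mult\<close> is a union over all representatives; every coset in this
  union is the same.\<close>

lemma coset_mult:
  assumes "x \<in> carrier U" "y \<in> carrier U"
  shows "rcoset_mult U K (K +> x) (K +> y) = K +> (x \<otimes> y)"
proof -
  have "K +> (a \<otimes> b) = K +> (x \<otimes> y)" if ab: "a \<in> K +> x" "b \<in> K +> y" for a b
  proof -
    obtain k l where k: "k \<in> K" "a = k \<oplus> x" and l: "l \<in> K" "b = l \<oplus> y"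
      using ab by (auto simp: a_r_coset_def')
    have kc: "k \<in> carrier U" "l \<in> carrier U" using k l K_carrier by auto
    have bc: "b \<in> carrier U" using assms kc l by simp
    have "a \<otimes> b = k \<otimes> b \<oplus> x \<otimes> b" unfolding k(2) using assms kc bc by (simp add: ring_distrib_right)
    also have "x \<otimes> b = x \<otimes> l \<oplus> x \<otimes> y" unfolding l(2) using assms kc by (simp add: ring_distrib_left)
    also have "k \<otimes> b \<oplus> (x \<otimes> l \<oplus> x \<otimes> y) = (k \<otimes> b \<oplus> x \<otimes> l) \<oplus> x \<otimes> y"
      using assms kc bc by (simp add: ring_mult_closed a_assoc)
    finally have eq: "a \<otimes> b = (k \<otimes> b \<oplus> x \<otimes> l) \<oplus> x \<otimes> y" .
    have "k \<otimes> b \<oplus> x \<otimes> l \<in> K"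
      using K k l kc assms unfolding alg_ideal_def by (intro KS.a_closed) auto
    then show ?thesis unfolding eq using assms by (intro coset_absorb) (simp_all add: ring_mult_closed)
  qed
  moreover have "x \<in> K +> x" "y \<in> K +> y" using assms KS.a_rcos_self by auto
  ultimately show ?thesis unfolding rcoset_mult_def by blast
qed

lemma quotient_carrier: "carrier (quotient_alg U K) = (\<lambda>x. K +> x) ` carrier U"
  by (auto simp: quotient_alg_def A_RCOSETS_def')

lemma quotient_mult:
  "x \<in> carrier U \<Longrightarrow> y \<in> carrier U \<Longrightarrow> (K +> x) \<otimes>\<^bsub>quotient_alg U K\<^esub> (K +> y) = K +> (x \<otimes> y)"
  by (simp add: quotient_alg_def coset_mult)

context
  fixes e assumes e: "is_identity U e"
begin

lemma e_carrier: "e \<in> carrier U" using e by (simp add: is_identity_def)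

lemma quotient_identity_iff: "is_identity (quotient_alg U K) E \<longleftrightarrow> E = K +> e"
proof
  assume E: "is_identity (quotient_alg U K) E"
  then obtain x where x: "x \<in> carrier U" "E = K +> x" by (auto simp: is_identity_def quotient_carrier)
  have "K +> e \<in> carrier (quotient_alg U K)" using e_carrier by (simp add: quotient_carrier)
  then have "K +> e = E \<otimes>\<^bsub>quotient_alg U K\<^esub> (K +> e)"
    using E by (simp add: is_identity_def)
  also have "\<dots> = K +> (x \<otimes> e)" using x e_carrier by (simp add: quotient_mult)
  also have "x \<otimes> e = x" using e x by (simp add: is_identity_def)
  finally show "E = K +> e" using x by simp
next
  assume "E = K +> e"
  then show "is_identity (quotient_alg U K) E"
    using e by (auto simp: is_identity_def quotient_carrier quotient_mult)
qed

lemma quotient_left_invertible: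
  assumes "b \<in> carrier U"
  shows "left_invertible (quotient_alg U K) (K +> b) \<longleftrightarrow> (\<exists>c\<in>carrier U. c \<otimes> b \<ominus> e \<in> K)"
proof -
  have "K +> (c \<otimes> b) = K +> e \<longleftrightarrow> c \<otimes> b \<ominus> e \<in> K" if "c \<in> carrier U" for c
    using that assms e_carrier by (intro coset_eq_iff) (simp_all add: ring_mult_closed)
  then show ?thesis
    unfolding left_invertible_def quotient_identity_iff quotient_carrier
    using assms by (simp add: quotient_mult)
qed

lemma quotient_right_invertible:
  assumes "b \<in> carrier U"
  shows "right_invertible (quotient_alg U K) (K +> b) \<longleftrightarrow> (\<exists>c\<in>carrier U. b \<otimes> c \<ominus> e \<in> K)"
proof -
  have "K +> (b \<otimes> c) = K +> e \<longleftrightarrow> b \<otimes> c \<ominus> e \<in> K" if "c \<in> carrier U" for c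
    using that assms e_carrier by (intro coset_eq_iff) (simp_all add: ring_mult_closed)
  then show ?thesis
    unfolding right_invertible_def quotient_identity_iff quotient_carrier
    using assms by (simp add: quotient_mult)
qed

lemma quotient_GL:
  assumes "b \<in> carrier U"
  shows "K +> b \<in> GL (quotient_alg U K) \<longleftrightarrow> (\<exists>c\<in>carrier U. c \<otimes> b \<ominus> e \<in> K \<and> b \<otimes> c \<ominus> e \<in> K)"
proof -
  have 1: "K +> (b \<otimes> c) = K +> e \<longleftrightarrow> b \<otimes> c \<ominus> e \<in> K" if "c \<in> carrier U" for c
    using that assms e_carrier by (intro coset_eq_iff) (simp_all add: ring_mult_closed)
  have 2: "K +> (c \<otimes> b) = K +> e \<longleftrightarrow> c \<otimes> b \<ominus> e \<in> K" if "c \<in> carrier U" for c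
    using that assms e_carrier by (intro coset_eq_iff) (simp_all add: ring_mult_closed)
  show ?thesis
    unfolding GL_def quotient_identity_iff quotient_carrier
    using assms by (simp add: quotient_mult 1 2)
qed

lemma invertibles_lift_iff:
  "invertibles_lift U K \<longleftrightarrow> (\<forall>b\<in>carrier U. (\<exists>c\<in>carrier U. c \<otimes> b \<ominus> e \<in> K \<and> b \<otimes> c \<ominus> e \<in> K) \<longrightarrow>
     (\<exists>v\<in>GL U. b \<ominus> v \<in> K))"
proof -
  have coset: "K +> b = K +> v \<longleftrightarrow> b \<ominus> v \<in> K" if "b \<in> carrier U" "v \<in> GL U" for b v
    using that by (intro coset_eq_iff) (simp_all add: GL_def)
  show ?thesis unfolding invertibles_lift_def
  proof (intro iffI ballI impI)
    fix b assume lift: "\<forall>u\<in>GL (quotient_alg U K). \<exists>v\<in>GL U. u = K +> v" and b: "b \<in> carrier U"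
      and "\<exists>c\<in>carrier U. c \<otimes> b \<ominus> e \<in> K \<and> b \<otimes> c \<ominus> e \<in> K"
    then obtain v where "v \<in> GL U" "K +> b = K +> v" using quotient_GL[OF b] by auto
    then show "\<exists>v\<in>GL U. b \<ominus> v \<in> K" using coset[OF b] by blast
  next
    fix u assume lift: "\<forall>b\<in>carrier U. (\<exists>c\<in>carrier U. c \<otimes> b \<ominus> e \<in> K \<and> b \<otimes> c \<ominus> e \<in> K) \<longrightarrow>
     (\<exists>v\<in>GL U. b \<ominus> v \<in> K)" and u: "u \<in> GL (quotient_alg U K)"
    then have "u \<in> carrier (quotient_alg U K)" by (simp add: GL_def)
    then obtain b where b: "b \<in> carrier U" "u = K +> b" using quotient_carrier by auto
    then have "\<exists>c\<in>carrier U. c \<otimes> b \<ominus> e \<in> K \<and> b \<otimes> c \<ominus> e \<in> K" using u quotient_GL[OF b(1)] by simp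
    then obtain v where "v \<in> GL U" "b \<ominus> v \<in> K" using lift b(1) by auto
    then show "\<exists>v\<in>GL U. u = K +> v" using coset[OF b(1)] b(2) by blast
  qed
qed

end
end
end

section \<open>Algebras represented in the ambient algebra\<close>

text \<open>The norm \<open>\<nu>\<close> of \<open>U\<close> only has to be equivalent to
  \<open>n\<close>, since IR depends on the norm through the topology alone. This matters for
  \<open>adjoin_identity\<close>, whose operator norm is compared with \<open>n\<close> but not
  identified with it.\<close>

locale star_alg_embedding = cstar_seminorm st iu n
  for st :: "'p::real_algebra_1 \<Rightarrow> 'p" and iu n +
  fixes U :: "'u star_alg" (structure) and \<phi> :: "'u \<Rightarrow> 'p" and \<nu> :: "'p \<Rightarrow> real" and C :: real
  assumes zero_closed': "\<zero> \<in> carrier U"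
    and add_closed': "\<lbrakk>x \<in> carrier U; y \<in> carrier U\<rbrakk> \<Longrightarrow> x \<oplus> y \<in> carrier U"
    and mult_closed': "\<lbrakk>x \<in> carrier U; y \<in> carrier U\<rbrakk> \<Longrightarrow> x \<otimes> y \<in> carrier U"
    and smult_closed': "x \<in> carrier U \<Longrightarrow> c \<odot> x \<in> carrier U"
    and \<phi>_zero: "\<phi> \<zero> \<asymp> 0"
    and \<phi>_add: "\<lbrakk>x \<in> carrier U; y \<in> carrier U\<rbrakk> \<Longrightarrow> \<phi> (x \<oplus> y) \<asymp> \<phi> x + \<phi> y"
    and \<phi>_mult: "\<lbrakk>x \<in> carrier U; y \<in> carrier U\<rbrakk> \<Longrightarrow> \<phi> (x \<otimes> y) \<asymp> \<phi> x * \<phi> y"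
    and \<phi>_smult: "x \<in> carrier U \<Longrightarrow> \<phi> (c \<odot> x) \<asymp> scal c * \<phi> x"
    and \<phi>_inj: "\<lbrakk>x \<in> carrier U; y \<in> carrier U; \<phi> x \<asymp> \<phi> y\<rbrakk> \<Longrightarrow> x = y"
    and nrm_eq: "x \<in> carrier U \<Longrightarrow> nrm U x = \<nu> (\<phi> x)"
    and \<nu>_triangle: "\<nu> (p + q) \<le> \<nu> p + \<nu> q"
    and \<nu>_uminus: "\<nu> (- p) = \<nu> p"
    and \<nu>_le: "\<nu> p \<le> n p"
    and \<nu>_ge: "x \<in> carrier U \<Longrightarrow> n (\<phi> x) \<le> C * \<nu> (\<phi> x)"
    and C_pos: "C > 0"
begin

lemmas U_closed = zero_closed' add_closed' mult_closed' smult_closed'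

lemma \<nu>_nonneg: "0 \<le> \<nu> p"
proof -
  have "\<nu> 0 \<le> 0" using \<nu>_le[of 0] by simp
  moreover have "\<nu> 0 \<le> \<nu> 0 + \<nu> 0" using \<nu>_triangle[of 0 0] by simp
  moreover have "\<nu> 0 \<le> \<nu> p + \<nu> p" using \<nu>_triangle[of p "- p"] by (simp add: \<nu>_uminus)
  ultimately show ?thesis by simp
qed

lemma \<nu>_cong: "p \<asymp> q \<Longrightarrow> \<nu> p = \<nu> q"
proof -
  have "\<nu> p \<le> \<nu> q" if "p \<asymp> q" for p q
    using \<nu>_triangle[of "p - q" q] \<nu>_le[of "p - q"] that by (simp add: eqn_def null_def)
  then show "p \<asymp> q \<Longrightarrow> \<nu> p = \<nu> q" using eqn_sym by (meson antisym)
qed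

text \<open>The laws hold in the ring, and \<open>\<phi>\<close> is injective up to
  \<open>\<asymp>\<close>. Quotients and unitizations obtain them in this way, without a separate
  proof that they are C*-algebras.\<close>

sublocale nonunital_ring U
proof -
  have "abelian_group U"
  proof (rule abelian_groupI)
    show "(x \<oplus> y) \<oplus> z = x \<oplus> (y \<oplus> z)" if "x \<in> carrier U" "y \<in> carrier U" "z \<in> carrier U" for x y z
    proof (rule \<phi>_inj)
      have "\<phi> (x \<oplus> y \<oplus> z) \<asymp> (\<phi> x + \<phi> y) + \<phi> z"
        using that U_closed by (intro eqn_trans[OF \<phi>_add] eqn_add \<phi>_add) auto
      also have "\<dots> = \<phi> x + (\<phi> y + \<phi> z)" by (rule add.assoc)
      also have "\<dots> \<asymp> \<phi> (x \<oplus> (y \<oplus> z))"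
        using that U_closed by (intro eqn_sym[OF eqn_trans[OF \<phi>_add]] eqn_add \<phi>_add) auto
      finally show "\<phi> (x \<oplus> y \<oplus> z) \<asymp> \<phi> (x \<oplus> (y \<oplus> z))" .
    qed (use that U_closed in auto)
    show "x \<oplus> y = y \<oplus> x" if "x \<in> carrier U" "y \<in> carrier U" for x y
    proof (rule \<phi>_inj)
      have "\<phi> (x \<oplus> y) \<asymp> \<phi> y + \<phi> x" using \<phi>_add[OF that] by (simp add: add.commute)
      also have "\<dots> \<asymp> \<phi> (y \<oplus> x)" by (rule eqn_sym[OF \<phi>_add[OF that(2,1)]])
      finally show "\<phi> (x \<oplus> y) \<asymp> \<phi> (y \<oplus> x)" .
    qed (use that U_closed in auto)
    show "\<zero> \<oplus> x = x" if "x \<in> carrier U" for x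
    proof (rule \<phi>_inj)
      have "\<phi> (\<zero> \<oplus> x) \<asymp> 0 + \<phi> x"
        using that U_closed by (intro eqn_trans[OF \<phi>_add] eqn_add \<phi>_zero) auto
      then show "\<phi> (\<zero> \<oplus> x) \<asymp> \<phi> x" by simp
    qed (use that U_closed in auto)
    show "\<exists>y\<in>carrier U. y \<oplus> x = \<zero>" if "x \<in> carrier U" for x
    proof
      show "((-1) \<odot> x) \<oplus> x = \<zero>"
      proof (rule \<phi>_inj)
        have "\<phi> (((-1) \<odot> x) \<oplus> x) \<asymp> scal (-1) * \<phi> x + \<phi> x"
          using that U_closed by (intro eqn_trans[OF \<phi>_add] eqn_add \<phi>_smult) auto
        also have "\<dots> = 0" by (simp add: scal_uminus)
        also have "0 \<asymp> \<phi> \<zero>" by (rule eqn_sym[OF \<phi>_zero])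
        finally show "\<phi> (((-1) \<odot> x) \<oplus> x) \<asymp> \<phi> \<zero>" .
      qed (use that U_closed in auto)
    qed (use that U_closed in auto)
  qed (use U_closed in auto)
  then interpret abelian_group U .
  show "nonunital_ring U"
  proof (unfold_locales)
    fix x y z assume c: "x \<in> carrier U" "y \<in> carrier U" "z \<in> carrier U"
    show "(x \<oplus> y) \<otimes> z = (x \<otimes> z) \<oplus> (y \<otimes> z)"
    proof (rule \<phi>_inj)
      have "\<phi> ((x \<oplus> y) \<otimes> z) \<asymp> (\<phi> x + \<phi> y) * \<phi> z"
        using c U_closed by (intro eqn_trans[OF \<phi>_mult] eqn_multr \<phi>_add) auto
      also have "\<dots> = \<phi> x * \<phi> z + \<phi> y * \<phi> z" by (rule distrib_right)
      also have "\<dots> \<asymp> \<phi> ((x \<otimes> z) \<oplus> (y \<otimes> z))"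
        using c U_closed by (intro eqn_sym[OF eqn_trans[OF \<phi>_add]] eqn_add \<phi>_mult) auto
      finally show "\<phi> ((x \<oplus> y) \<otimes> z) \<asymp> \<phi> ((x \<otimes> z) \<oplus> (y \<otimes> z))" .
    qed (use c U_closed in auto)
    show "z \<otimes> (x \<oplus> y) = (z \<otimes> x) \<oplus> (z \<otimes> y)"
    proof (rule \<phi>_inj)
      have "\<phi> (z \<otimes> (x \<oplus> y)) \<asymp> \<phi> z * (\<phi> x + \<phi> y)"
        using c U_closed by (intro eqn_trans[OF \<phi>_mult] eqn_multl \<phi>_add) auto
      also have "\<dots> = \<phi> z * \<phi> x + \<phi> z * \<phi> y" by (rule distrib_left)
      also have "\<dots> \<asymp> \<phi> ((z \<otimes> x) \<oplus> (z \<otimes> y))"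
        using c U_closed by (intro eqn_sym[OF eqn_trans[OF \<phi>_add]] eqn_add \<phi>_mult) auto
      finally show "\<phi> (z \<otimes> (x \<oplus> y)) \<asymp> \<phi> ((z \<otimes> x) \<oplus> (z \<otimes> y))" .
    qed (use c U_closed in auto)
  qed (use U_closed in auto)
qed

lemma \<phi>_uminus: "x \<in> carrier U \<Longrightarrow> \<phi> (\<ominus> x) \<asymp> - \<phi> x"
proof -
  assume x: "x \<in> carrier U"
  have "\<phi> x + \<phi> (\<ominus> x) \<asymp> \<phi> (x \<oplus> \<ominus> x)" using x by (intro eqn_sym[OF \<phi>_add]) auto
  also have "\<dots> \<asymp> 0" using x \<phi>_zero by (simp add: r_neg)
  finally have "(\<phi> x + \<phi> (\<ominus> x)) - \<phi> x \<asymp> 0 - \<phi> x" by (intro eqn_diff) simp_all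
  then show ?thesis by simp
qed

lemma \<phi>_minus: "x \<in> carrier U \<Longrightarrow> y \<in> carrier U \<Longrightarrow> \<phi> (x \<ominus> y) \<asymp> \<phi> x - \<phi> y"
  using eqn_trans[OF \<phi>_add[of x "\<ominus> y"] eqn_add[OF eqn_refl \<phi>_uminus[of y]]] by (simp add: a_minus_def)

section \<open>Topology and closed ideals, carried over along the embedding\<close>

lemma norm_dist_eq: "x \<in> carrier U \<Longrightarrow> y \<in> carrier U \<Longrightarrow> norm_dist U x y = \<nu> (\<phi> x - \<phi> y)"
  using \<nu>_cong[OF \<phi>_minus] by (simp add: norm_dist_def nrm_eq minus_closed)

lemma metric: "Metric_space (carrier U) (norm_dist U)"
proof
  show "0 \<le> norm_dist U x y" for x y
    using \<nu>_nonneg by (auto simp: norm_dist_def nrm_eq minus_closed)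
  show "norm_dist U x y = norm_dist U y x" for x y
    using \<nu>_uminus[of "\<phi> x - \<phi> y"] norm_dist_eq[of x y] norm_dist_eq[of y x]
    by (cases "x \<in> carrier U \<and> y \<in> carrier U") (auto simp: norm_dist_def)
  show "norm_dist U x y = 0 \<longleftrightarrow> x = y" if c: "x \<in> carrier U" "y \<in> carrier U" for x y
  proof
    assume "norm_dist U x y = 0"
    then have "\<nu> (\<phi> (x \<ominus> y)) = 0" using c by (simp add: norm_dist_def nrm_eq minus_closed)
    then have "n (\<phi> (x \<ominus> y)) \<le> 0" using \<nu>_ge[of "x \<ominus> y"] c by (simp add: minus_closed)
    then have "n (\<phi> x - \<phi> y) = 0" using eqn_n[OF \<phi>_minus[OF c]] n_nonneg[of "\<phi> x - \<phi> y"] by (simp del: n_nonneg)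
    then show "x = y" using \<phi>_inj[OF c] by (simp add: eqn_def null_def)
  next
    assume "x = y"
    then show "norm_dist U x y = 0" using c \<nu>_nonneg[of 0] \<nu>_le[of 0] by (simp add: norm_dist_eq)
  qed
  show "norm_dist U x z \<le> norm_dist U x y + norm_dist U y z"
    if "x \<in> carrier U" "y \<in> carrier U" "z \<in> carrier U" for x y z
    using \<nu>_triangle[of "\<phi> x - \<phi> y" "\<phi> y - \<phi> z"] that by (simp add: norm_dist_eq)
qed

lemma closure_iff:
  assumes S: "S \<subseteq> carrier U"
  shows "x \<in> norm_topology U closure_of S \<longleftrightarrow> x \<in> carrier U \<and> (\<forall>e>0. \<exists>y\<in>S. n (\<phi> x - \<phi> y) < e)"
proof -
  interpret Metric_space "carrier U" "norm_dist U" by (rule metric)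
  have "(\<forall>r>0. \<exists>y\<in>S. y \<in> mball x r) \<longleftrightarrow> (\<forall>e>0. \<exists>y\<in>S. n (\<phi> x - \<phi> y) < e)" if x: "x \<in> carrier U"
  proof (intro iffI allI impI)
    fix e :: real assume "\<forall>r>0. \<exists>y\<in>S. y \<in> mball x r" "e > 0"
    moreover from this have "e / C > 0" using C_pos by simp
    ultimately obtain y where "y \<in> S" "y \<in> mball x (e / C)" by blast
    then have y: "y \<in> S" "norm_dist U x y < e / C" by auto
    then have yc: "y \<in> carrier U" using S by blast
    have "n (\<phi> x - \<phi> y) \<le> C * \<nu> (\<phi> x - \<phi> y)"
      using \<nu>_ge[OF minus_closed[OF x yc]] \<nu>_cong[OF \<phi>_minus[OF x yc]] eqn_n[OF \<phi>_minus[OF x yc]] by simp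
    also have "\<dots> < C * (e / C)" using y(2) C_pos norm_dist_eq[OF x yc] by (intro mult_strict_left_mono) simp_all
    finally show "\<exists>y\<in>S. n (\<phi> x - \<phi> y) < e" using y(1) C_pos by auto
  next
    fix e :: real assume "\<forall>e>0. \<exists>y\<in>S. n (\<phi> x - \<phi> y) < e" "e > 0"
    then obtain y where y: "y \<in> S" "n (\<phi> x - \<phi> y) < e" by blast
    then have yc: "y \<in> carrier U" using S by blast
    have "norm_dist U x y < e" using \<nu>_le[of "\<phi> x - \<phi> y"] y(2) norm_dist_eq[OF x yc] by simp
    then show "\<exists>y\<in>S. y \<in> mball x e" using y(1) x yc by auto
  qed
  then show ?thesis by (auto simp: norm_topology_def metric_closure_of)
qed

lemma closedin_iff:
  "closedin (norm_topology U) S \<longleftrightarrow>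
     S \<subseteq> carrier U \<and> (\<forall>x\<in>carrier U. (\<forall>e>0. \<exists>y\<in>S. n (\<phi> x - \<phi> y) < e) \<longrightarrow> x \<in> S)"
proof -
  interpret Metric_space "carrier U" "norm_dist U" by (rule metric)
  have "topspace (norm_topology U) = carrier U" by (simp add: norm_topology_def)
  then show ?thesis unfolding closure_of_subset_eq[symmetric] using closure_iff[of S] by auto
qed

text \<open>Saturated under \<open>\<asymp>\<close>, because closed ideals of the ring contain
  \<open>null\<close> and the image of \<open>\<phi>\<close> in general does not.\<close>

definition range_hull :: "'u set \<Rightarrow> 'p set" where
  "range_hull K = {t. \<exists>x\<in>K. t \<asymp> \<phi> x}"

abbreviation "\<A> \<equiv> range_hull (carrier U)"

lemma \<phi>_in_range_hull: "x \<in> K \<Longrightarrow> \<phi> x \<in> range_hull K"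
  unfolding range_hull_def using eqn_refl by blast

lemma \<phi>_in_range_hull_iff:
  assumes "K \<subseteq> carrier U" "x \<in> carrier U"
  shows "\<phi> x \<in> range_hull K \<longleftrightarrow> x \<in> K"
proof
  assume "\<phi> x \<in> range_hull K"
  then obtain y where "y \<in> K" "\<phi> x \<asymp> \<phi> y" by (auto simp: range_hull_def)
  then show "x \<in> K" using \<phi>_inj[of x y] assms by auto
qed (rule \<phi>_in_range_hull)

lemma range_hull_eqn: "x \<asymp> y \<Longrightarrow> y \<in> range_hull K \<Longrightarrow> x \<in> range_hull K"
  unfolding range_hull_def using eqn_trans by blast

lemma closed_idealD:
  assumes "closed_ideal U K"
  shows "K \<subseteq> carrier U" "\<zero> \<in> K" "x \<in> K \<Longrightarrow> y \<in> K \<Longrightarrow> x \<oplus> y \<in> K" "x \<in> K \<Longrightarrow> c \<odot> x \<in> K"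
    "x \<in> K \<Longrightarrow> a \<in> carrier U \<Longrightarrow> a \<otimes> x \<in> K" "x \<in> K \<Longrightarrow> a \<in> carrier U \<Longrightarrow> x \<otimes> a \<in> K"
    "x \<in> carrier U \<Longrightarrow> (\<And>e. e > 0 \<Longrightarrow> \<exists>y\<in>K. n (\<phi> x - \<phi> y) < e) \<Longrightarrow> x \<in> K"
proof -
  interpret additive_subgroup K U using assms by (simp add: closed_ideal_def)
  show "K \<subseteq> carrier U" "\<zero> \<in> K" "x \<in> K \<Longrightarrow> y \<in> K \<Longrightarrow> x \<oplus> y \<in> K"
    using a_subset zero_closed a_closed by auto
  show "c \<odot> x \<in> K" if "x \<in> K" using assms that by (simp add: closed_ideal_def)
  show "a \<otimes> x \<in> K" "x \<otimes> a \<in> K" if "x \<in> K" "a \<in> carrier U"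
    using assms that by (simp_all add: closed_ideal_def)
  have "closedin (norm_topology U) K" using assms by (simp add: closed_ideal_def)
  then show "x \<in> K" if "x \<in> carrier U" "\<And>e. e > 0 \<Longrightarrow> \<exists>y\<in>K. n (\<phi> x - \<phi> y) < e"
    using that unfolding closedin_iff by simp
qed

lemma sub_cideal_range_hull:
  assumes K: "closed_ideal U K"
  shows "sub_cideal \<A> (range_hull K)"
proof -
  note KD = closed_idealD[OF K]
  have intro: "t \<asymp> \<phi> x \<Longrightarrow> x \<in> K \<Longrightarrow> t \<in> range_hull K" for t x by (auto simp: range_hull_def)
  show ?thesis unfolding sub_cideal_def
  proof (intro conjI ballI allI impI)
    show "range_hull K \<subseteq> \<A>" using KD(1) by (auto simp: range_hull_def)
    show "0 \<in> range_hull K" by (rule intro[OF eqn_sym[OF \<phi>_zero] KD(2)])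
  next
    fix x y assume "x \<in> range_hull K" "y \<in> range_hull K"
    then obtain a b where ab: "a \<in> K" "x \<asymp> \<phi> a" "b \<in> K" "y \<asymp> \<phi> b" by (auto simp: range_hull_def)
    then have "x + y \<asymp> \<phi> (a \<oplus> b)"
      using KD(1) by (intro eqn_trans[OF eqn_add[OF ab(2,4)] eqn_sym[OF \<phi>_add]]) auto
    then show "x + y \<in> range_hull K" by (rule intro[OF _ KD(3)[OF ab(1,3)]])
  next
    fix x c assume "x \<in> range_hull K"
    then obtain a where ab: "a \<in> K" "x \<asymp> \<phi> a" by (auto simp: range_hull_def)
    then have "scal c * x \<asymp> \<phi> (c \<odot> a)"
      using KD(1) by (intro eqn_trans[OF eqn_multl[OF ab(2)] eqn_sym[OF \<phi>_smult]]) auto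
    then show "scal c * x \<in> range_hull K" by (rule intro[OF _ KD(4)[OF ab(1)]])
  next
    fix x a assume "x \<in> range_hull K" "a \<in> \<A>"
    then obtain k b where ab: "k \<in> K" "x \<asymp> \<phi> k" "b \<in> carrier U" "a \<asymp> \<phi> b" by (auto simp: range_hull_def)
    then have kc: "k \<in> carrier U" using KD(1) by blast
    have "a * x \<asymp> \<phi> (b \<otimes> k)" "x * a \<asymp> \<phi> (k \<otimes> b)"
      by (rule eqn_trans[OF eqn_mult[OF ab(4,2)] eqn_sym[OF \<phi>_mult[OF ab(3) kc]]])
        (rule eqn_trans[OF eqn_mult[OF ab(2,4)] eqn_sym[OF \<phi>_mult[OF kc ab(3)]]])
    then show "a * x \<in> range_hull K" "x * a \<in> range_hull K"
      using intro KD(5,6)[OF ab(1,3)] by blast+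
  next
    fix x assume "x \<in> \<A>" and lim: "\<forall>e>0. \<exists>y\<in>range_hull K. n (x - y) < e"
    then obtain a where a: "a \<in> carrier U" "x \<asymp> \<phi> a" by (auto simp: range_hull_def)
    have "a \<in> K"
    proof (rule KD(7)[OF a(1)])
      fix e :: real assume "e > 0"
      then obtain y k where "n (x - y) < e" "k \<in> K" "y \<asymp> \<phi> k" using lim by (auto simp: range_hull_def)
      then show "\<exists>y\<in>K. n (\<phi> a - \<phi> y) < e" using eqn_n[OF eqn_diff[OF a(2), of y "\<phi> k"]] by auto
    qed
    then show "x \<in> range_hull K" using a(2) intro by blast
  qed
qed

lemma closed_ideal_preimage:
  assumes L: "sub_cideal \<A> L"
  shows "closed_ideal U {x \<in> carrier U. \<phi> x \<in> L}" (is "closed_ideal U ?K")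
proof -
  note LD = sub_cidealD[OF L]
  have eq: "\<phi> x \<in> L" if "\<phi> x \<asymp> y" "y \<in> L" "x \<in> carrier U" for x y
    using sub_cideal_eqn[OF L _ that(1,2)] \<phi>_in_range_hull[OF that(3)] by blast
  have "additive_subgroup ?K U"
  proof (rule additive_subgroupI, rule add.subgroupI)
    show "?K \<noteq> {}" using eq[OF \<phi>_zero LD(2)] zero_closed' by blast
    show "\<ominus> a \<in> ?K" if "a \<in> ?K" for a
      using that eq[OF \<phi>_uminus sub_cideal_uminus[OF L]] by auto
    show "a \<oplus> b \<in> ?K" if "a \<in> ?K" "b \<in> ?K" for a b
      using that eq[OF \<phi>_add LD(3)] add_closed' by auto
  qed auto
  moreover have "\<forall>c. \<forall>x\<in>?K. c \<odot> x \<in> ?K"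
    using eq[OF \<phi>_smult LD(4)] smult_closed' by auto
  moreover have "\<forall>a\<in>carrier U. \<forall>x\<in>?K. a \<otimes> x \<in> ?K \<and> x \<otimes> a \<in> ?K"
    using eq[OF \<phi>_mult LD(5)] eq[OF \<phi>_mult LD(6)] mult_closed' \<phi>_in_range_hull by auto
  moreover have "closedin (norm_topology U) ?K"
    unfolding closedin_iff using sub_cideal_closed[OF L \<phi>_in_range_hull] by blast
  ultimately show ?thesis unfolding closed_ideal_def by blast
qed

lemma range_hull_preimage:
  assumes L: "sub_cideal \<A> L"
  shows "range_hull {x \<in> carrier U. \<phi> x \<in> L} = L"
proof (intro equalityI subsetI)
  fix t assume "t \<in> range_hull {x \<in> carrier U. \<phi> x \<in> L}"
  then obtain x where "x \<in> carrier U" "\<phi> x \<in> L" "t \<asymp> \<phi> x" by (auto simp: range_hull_def)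
  then show "t \<in> L" using sub_cideal_eqn[OF L] by (auto simp: range_hull_def)
next
  fix t assume t: "t \<in> L"
  then have "t \<in> \<A>" using sub_cidealD(1)[OF L] by blast
  then obtain x where x: "x \<in> carrier U" "t \<asymp> \<phi> x" by (auto simp: range_hull_def)
  have "\<phi> x \<in> L" by (rule sub_cideal_eqn[OF L \<phi>_in_range_hull[OF x(1)] eqn_sym[OF x(2)] t])
  then show "t \<in> range_hull {x \<in> carrier U. \<phi> x \<in> L}" using x by (auto simp: range_hull_def)
qed

context
  fixes e assumes e: "is_identity U e"
begin

lemma e_in: "e \<in> carrier U" using e by (simp add: is_identity_def)

lemma mult_in_range_hull_iff:
  assumes K: "closed_ideal U K" and c: "c \<in> carrier U" "x \<asymp> \<phi> c" and b: "b \<in> carrier U" "y \<asymp> \<phi> b"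
  shows "x * y - \<phi> e \<in> range_hull K \<longleftrightarrow> c \<otimes> b \<ominus> e \<in> K"
proof -
  have "x * y - \<phi> e \<asymp> \<phi> c * \<phi> b - \<phi> e" using c b by (intro eqn_diff eqn_mult) simp_all
  also have "\<dots> \<asymp> \<phi> (c \<otimes> b) - \<phi> e" using c b by (intro eqn_diff eqn_sym[OF \<phi>_mult]) simp_all
  also have "\<dots> \<asymp> \<phi> (c \<otimes> b \<ominus> e)" using c b e_in by (intro eqn_sym[OF \<phi>_minus]) (simp_all add: mult_closed')
  finally have eq: "x * y - \<phi> e \<asymp> \<phi> (c \<otimes> b \<ominus> e)" .
  have "x * y - \<phi> e \<in> range_hull K \<longleftrightarrow> \<phi> (c \<otimes> b \<ominus> e) \<in> range_hull K"
    using range_hull_eqn[OF eq] range_hull_eqn[OF eqn_sym[OF eq]] by blast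
  also have "\<dots> \<longleftrightarrow> c \<otimes> b \<ominus> e \<in> K"
    using closed_idealD(1)[OF K] c b e_in by (intro \<phi>_in_range_hull_iff minus_closed mult_closed')
  finally show ?thesis .
qed

lemma sub_R_iff:
  assumes b: "b \<in> carrier U" and d: "d \<asymp> \<phi> b"
  shows "d \<in> sub_R \<A> (\<phi> e) \<longleftrightarrow> b \<in> R_set U"
proof -
  have d\<A>: "d \<in> \<A>" using b d by (auto simp: range_hull_def)
  have left: "(\<exists>c\<in>\<A>. c * d - \<phi> e \<in> range_hull K) \<longleftrightarrow> (\<exists>c\<in>carrier U. c \<otimes> b \<ominus> e \<in> K)"
    and right: "(\<exists>c\<in>\<A>. d * c - \<phi> e \<in> range_hull K) \<longleftrightarrow> (\<exists>c\<in>carrier U. b \<otimes> c \<ominus> e \<in> K)"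
    and both: "(\<exists>c\<in>\<A>. c * d - \<phi> e \<in> range_hull K \<and> d * c - \<phi> e \<in> range_hull K) \<longleftrightarrow>
      (\<exists>c\<in>carrier U. c \<otimes> b \<ominus> e \<in> K \<and> b \<otimes> c \<ominus> e \<in> K)"
    if K: "closed_ideal U K" for K
  proof -
    have 1: "x * d - \<phi> e \<in> range_hull K \<longleftrightarrow> c \<otimes> b \<ominus> e \<in> K" if "c \<in> carrier U" "x \<asymp> \<phi> c" for x c
      by (rule mult_in_range_hull_iff[OF K that b d])
    have 2: "d * x - \<phi> e \<in> range_hull K \<longleftrightarrow> b \<otimes> c \<ominus> e \<in> K" if "c \<in> carrier U" "x \<asymp> \<phi> c" for x c
      by (rule mult_in_range_hull_iff[OF K b d that])
    have ex: "(\<exists>c\<in>\<A>. P c) \<longleftrightarrow> (\<exists>c\<in>carrier U. Q c)"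
      if "\<And>c x. c \<in> carrier U \<Longrightarrow> x \<asymp> \<phi> c \<Longrightarrow> P x \<longleftrightarrow> Q c" for P Q
      using that eqn_refl unfolding range_hull_def by blast
    show "(\<exists>c\<in>\<A>. c * d - \<phi> e \<in> range_hull K) \<longleftrightarrow> (\<exists>c\<in>carrier U. c \<otimes> b \<ominus> e \<in> K)"
      by (rule ex) (rule 1)
    show "(\<exists>c\<in>\<A>. d * c - \<phi> e \<in> range_hull K) \<longleftrightarrow> (\<exists>c\<in>carrier U. b \<otimes> c \<ominus> e \<in> K)"
      by (rule ex) (rule 2)
    show "(\<exists>c\<in>\<A>. c * d - \<phi> e \<in> range_hull K \<and> d * c - \<phi> e \<in> range_hull K) \<longleftrightarrow>
      (\<exists>c\<in>carrier U. c \<otimes> b \<ominus> e \<in> K \<and> b \<otimes> c \<ominus> e \<in> K)"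
      by (rule ex) (simp add: 1 2)
  qed
  have R: "b \<in> R_set U \<longleftrightarrow> (\<forall>K. closed_ideal U K \<longrightarrow>
      (\<exists>c\<in>carrier U. c \<otimes> b \<ominus> e \<in> K) \<or> (\<exists>c\<in>carrier U. b \<otimes> c \<ominus> e \<in> K) \<longrightarrow>
      (\<exists>c\<in>carrier U. c \<otimes> b \<ominus> e \<in> K \<and> b \<otimes> c \<ominus> e \<in> K))"
  proof -
    have mem: "b \<in> {b \<in> carrier U. P b} \<longleftrightarrow> P b" for P using b by simp
    have "((left_invertible (quotient_alg U K) (K +> b) \<or> right_invertible (quotient_alg U K) (K +> b)) \<and>
        K +> b \<notin> GL (quotient_alg U K)) \<longleftrightarrow>
      \<not> ((\<exists>c\<in>carrier U. c \<otimes> b \<ominus> e \<in> K) \<or> (\<exists>c\<in>carrier U. b \<otimes> c \<ominus> e \<in> K) \<longrightarrow>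
      (\<exists>c\<in>carrier U. c \<otimes> b \<ominus> e \<in> K \<and> b \<otimes> c \<ominus> e \<in> K))" if "closed_ideal U K" for K
      using quotient_left_invertible[OF closed_ideal_alg_ideal[OF that] e b]
        quotient_right_invertible[OF closed_ideal_alg_ideal[OF that] e b]
        quotient_GL[OF closed_ideal_alg_ideal[OF that] e b] by (simp only:) blast
    then show ?thesis unfolding R_set_def mem by metis
  qed
  \<comment> \<open>\<open>range_hull\<close> and preimage are a correspondence between the closed
    ideals of \<open>U\<close> and those of its image.\<close>
  have "(\<forall>L. sub_cideal \<A> L \<longrightarrow> P L) \<longleftrightarrow> (\<forall>K. closed_ideal U K \<longrightarrow> P (range_hull K))" for P
    using sub_cideal_range_hull closed_ideal_preimage range_hull_preimage by metis
  from this[of "\<lambda>L. (\<exists>c\<in>\<A>. c * d - \<phi> e \<in> L) \<or> (\<exists>c\<in>\<A>. d * c - \<phi> e \<in> L) \<longrightarrow>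
      (\<exists>c\<in>\<A>. c * d - \<phi> e \<in> L \<and> d * c - \<phi> e \<in> L)"]
  show ?thesis unfolding R sub_R_def using d\<A> left right both by auto
qed

lemma GL_range_iff:
  assumes w: "w \<in> carrier U" "v \<asymp> \<phi> w"
  shows "(\<exists>c\<in>\<A>. c * v \<asymp> \<phi> e \<and> v * c \<asymp> \<phi> e) \<longleftrightarrow> w \<in> GL U"
proof -
  have iff: "x * y \<asymp> \<phi> e \<longleftrightarrow> a \<otimes> b = e"
    if a: "a \<in> carrier U" "x \<asymp> \<phi> a" and b: "b \<in> carrier U" "y \<asymp> \<phi> b" for x y a b
  proof
    have eq: "x * y \<asymp> \<phi> (a \<otimes> b)" using a b by (intro eqn_trans[OF eqn_mult eqn_sym[OF \<phi>_mult]])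
    show "a \<otimes> b = e" if "x * y \<asymp> \<phi> e"
      using eqn_trans[OF eqn_sym[OF eq] that] a b e_in by (intro \<phi>_inj) (simp_all add: mult_closed')
    show "x * y \<asymp> \<phi> e" if "a \<otimes> b = e" using eq that by simp
  qed
  have GLw: "w \<in> GL U \<longleftrightarrow> (\<exists>c\<in>carrier U. c \<otimes> w = e \<and> w \<otimes> c = e)" using GL_iff[OF e] w by simp
  show ?thesis unfolding GLw
  proof
    assume "\<exists>c\<in>\<A>. c * v \<asymp> \<phi> e \<and> v * c \<asymp> \<phi> e"
    then obtain c x where c: "c \<in> carrier U" "x \<asymp> \<phi> c" "x * v \<asymp> \<phi> e" "v * x \<asymp> \<phi> e"
      by (auto simp: range_hull_def)
    then show "\<exists>c\<in>carrier U. c \<otimes> w = e \<and> w \<otimes> c = e" using iff[OF c(1,2) w] iff[OF w c(1,2)] by blast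
  next
    assume "\<exists>c\<in>carrier U. c \<otimes> w = e \<and> w \<otimes> c = e"
    then obtain c where c: "c \<in> carrier U" "c \<otimes> w = e" "w \<otimes> c = e" by blast
    then show "\<exists>c\<in>\<A>. c * v \<asymp> \<phi> e \<and> v * c \<asymp> \<phi> e"
      using iff[OF c(1) eqn_refl w] iff[OF w c(1) eqn_refl] \<phi>_in_range_hull[OF c(1)] by blast
  qed
qed

proposition unital_IR_iff: "unital_IR U \<longleftrightarrow> sub_IR \<A> (\<phi> e)"
proof -
  have Rc: "R_set U \<subseteq> carrier U" by (auto simp: R_set_def)
  have GLc: "GL U \<subseteq> carrier U" by (auto simp: GL_def)
  have U: "unital_IR U \<longleftrightarrow> (\<forall>b\<in>R_set U. \<forall>r>0. \<exists>w\<in>GL U. n (\<phi> b - \<phi> w) < r)"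
    unfolding unital_IR_def using closure_iff[OF GLc] Rc by auto
  show ?thesis unfolding U sub_IR_def
  proof (intro iffI ballI allI impI)
    fix d and r :: real
    assume h: "\<forall>b\<in>R_set U. \<forall>r>0. \<exists>w\<in>GL U. n (\<phi> b - \<phi> w) < r" and d: "d \<in> sub_R \<A> (\<phi> e)" and r: "r > 0"
    have "d \<in> \<A>" using d by (simp add: sub_R_def)
    then obtain b where b: "b \<in> carrier U" "d \<asymp> \<phi> b" by (auto simp: range_hull_def)
    then have "b \<in> R_set U" using d sub_R_iff by blast
    then obtain w where w: "w \<in> GL U" "n (\<phi> b - \<phi> w) < r" using h r by blast
    have wc: "w \<in> carrier U" using w GLc by blast
    have "n (d - \<phi> w) < r" using eqn_n[OF eqn_diff[OF b(2) eqn_refl[of "\<phi> w"]]] w(2) by simp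
    then show "\<exists>v\<in>\<A>. (\<exists>c\<in>\<A>. c * v \<asymp> \<phi> e \<and> v * c \<asymp> \<phi> e) \<and> n (d - v) < r"
      using GL_range_iff[OF wc eqn_refl] w(1) \<phi>_in_range_hull[OF wc] by blast
  next
    fix b and r :: real
    assume h: "\<forall>d\<in>sub_R \<A> (\<phi> e). \<forall>r>0. \<exists>v\<in>\<A>. (\<exists>c\<in>\<A>. c * v \<asymp> \<phi> e \<and> v * c \<asymp> \<phi> e) \<and> n (d - v) < r"
      and b: "b \<in> R_set U" and r: "r > 0"
    have bc: "b \<in> carrier U" using b Rc by blast
    have "\<phi> b \<in> sub_R \<A> (\<phi> e)" using sub_R_iff[OF bc eqn_refl] b by blast
    then obtain v where v: "v \<in> \<A>" "\<exists>c\<in>\<A>. c * v \<asymp> \<phi> e \<and> v * c \<asymp> \<phi> e" "n (\<phi> b - v) < r"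
      using h r by blast
    obtain w where w: "w \<in> carrier U" "v \<asymp> \<phi> w" using v(1) by (auto simp: range_hull_def)
    have "w \<in> GL U" using GL_range_iff[OF w] v(2) by blast
    moreover have "n (\<phi> b - \<phi> w) < r"
      using eqn_n[OF eqn_diff[OF eqn_refl[of "\<phi> b"] w(2)]] v(3) by simp
    ultimately show "\<exists>w\<in>GL U. n (\<phi> b - \<phi> w) < r" by blast
  qed
qed

end
end

text \<open>Serves the given algebra, its ideal and its quotient alike: each is realized as a closed
  ideal of the ambient ring, for a suitable seminorm.\<close>

locale ideal_embedding = star_alg_embedding st iu n M \<phi> n 1
  for st :: "'p::real_algebra_1 \<Rightarrow> 'p" and iu n and M :: "'m star_alg" (structure) and \<phi> +
  assumes cideal_image: "cideal \<A>"
begin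

abbreviation "J \<equiv> \<A>"

lemmas Jid = cidealD[OF cideal_image]

lemma unital_case:
  assumes e: "is_identity M e"
  shows "unital_IR M \<longleftrightarrow> ideal_IR J"
proof -
  have ec: "e \<in> carrier M" using e by (simp add: is_identity_def)
  have unit: "\<phi> e * x \<asymp> x \<and> x * \<phi> e \<asymp> x" if x: "x \<in> J" for x
  proof -
    obtain a where a: "a \<in> carrier M" "x \<asymp> \<phi> a" using x by (auto simp: range_hull_def)
    have ea: "e \<otimes> a = a" "a \<otimes> e = a" using e a by (simp_all add: is_identity_def)
    have "\<phi> e * x \<asymp> \<phi> e * \<phi> a" by (rule eqn_multl[OF a(2)])
    also have "\<dots> \<asymp> \<phi> a" using eqn_sym[OF \<phi>_mult[OF ec a(1)]] ea by simp
    also have "\<dots> \<asymp> x" by (rule eqn_sym[OF a(2)])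
    finally have 1: "\<phi> e * x \<asymp> x" .
    have "x * \<phi> e \<asymp> \<phi> a * \<phi> e" by (rule eqn_multr[OF a(2)])
    also have "\<dots> \<asymp> \<phi> a" using eqn_sym[OF \<phi>_mult[OF a(1) ec]] ea by simp
    also have "\<dots> \<asymp> x" by (rule eqn_sym[OF a(2)])
    finally show ?thesis using 1 by simp
  qed
  have "sub_IR J (\<phi> e) \<longleftrightarrow> ideal_IR J"
    using unit by (intro sub_IR_unital_ideal[OF cideal_image \<phi>_in_range_hull[OF ec]]) auto
  then show ?thesis using unital_IR_iff[OF e] by simp
qed

section \<open>The operator norm of left multiplication, and the adjoined identity\<close>

definition unit_ball :: "'m set" where
  "unit_ball = {b \<in> carrier M. nrm M b \<le> 1}"

definition opn :: "'p \<Rightarrow> real" where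
  "opn x = (SUP b\<in>unit_ball. n (x * \<phi> b))"

lemma zero_unit_ball: "\<zero> \<in> unit_ball"
  using zero_closed' eqn_n[OF \<phi>_zero] by (simp add: unit_ball_def nrm_eq)

lemma unit_ball_n: "b \<in> unit_ball \<Longrightarrow> n (\<phi> b) \<le> 1"
  by (auto simp: unit_ball_def nrm_eq)

lemma opn_bdd: "bdd_above ((\<lambda>b. n (x * \<phi> b)) ` unit_ball)"
  by (rule bdd_aboveI2[of _ _ "n x"]) (rule n_mult_le_right[OF unit_ball_n])

lemma opn_upper: "b \<in> unit_ball \<Longrightarrow> n (x * \<phi> b) \<le> opn x"
  unfolding opn_def by (rule cSUP_upper[OF _ opn_bdd])

lemma opn_least: "(\<And>b. b \<in> unit_ball \<Longrightarrow> n (x * \<phi> b) \<le> t) \<Longrightarrow> opn x \<le> t"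
  unfolding opn_def using zero_unit_ball by (intro cSUP_least) auto

lemma opn_le_n: "opn x \<le> n x"
  by (rule opn_least) (rule n_mult_le_right[OF unit_ball_n])

lemma opn_nonneg: "0 \<le> opn x"
  using opn_upper[OF zero_unit_ball, of x] n_nonneg order_trans by blast

lemma opn_triangle: "opn (x + y) \<le> opn x + opn y"
  by (rule opn_least) (simp add: distrib_right n_triangle_le opn_upper)

lemma opn_uminus: "opn (- x) = opn x"
  by (simp add: opn_def)

lemma opn_scal: "opn (scal s * x) \<le> cmod s * opn x"
proof (rule opn_least)
  fix b assume "b \<in> unit_ball"
  then have "cmod s * n (x * \<phi> b) \<le> cmod s * opn x" by (intro mult_left_mono opn_upper) simp_all
  then show "n (scal s * x * \<phi> b) \<le> cmod s * opn x"
    using n_scal_mult[of s "x * \<phi> b"] by (simp add: mult.assoc)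
qed

lemma opn_mult_le:
  assumes y: "y \<in> J"
  shows "n (x * y) \<le> opn x * n y"
proof (cases "n y = 0")
  case True
  then show ?thesis using n_mult[of x y] by simp
next
  case False
  then have pos: "n y > 0" using n_nonneg[of y] by (simp add: less_le del: n_nonneg)
  have "(1 / n y) *\<^sub>R y \<in> J" by (rule ideal_scaleR[OF Jid y])
  then obtain b where b: "b \<in> carrier M" "(1 / n y) *\<^sub>R y \<asymp> \<phi> b" by (auto simp: range_hull_def)
  have "n (\<phi> b) = 1" using eqn_n[OF b(2)] pos by (simp add: n_scaleR)
  then have "b \<in> unit_ball" using b(1) by (simp add: unit_ball_def nrm_eq)
  then have "n (x * \<phi> b) \<le> opn x" by (rule opn_upper)
  moreover have "n (x * \<phi> b) = n (x * y) / n y"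
    using eqn_n[OF eqn_multl[OF b(2), of x]] pos by (simp add: n_scaleR)
  ultimately show ?thesis using pos by (simp add: divide_le_eq)
qed

text \<open>Test the operator norm on \<open>st x\<close>.\<close>

lemma n_le_opn:
  assumes x: "x \<in> J"
  shows "n x \<le> opn x"
proof (cases "n x = 0")
  case False
  then have pos: "n x > 0" using n_nonneg[of x] by (simp add: less_le del: n_nonneg)
  have "n x * n x \<le> n (x * st x)" using n_cstar[of "st x"] by (simp add: power2_eq_square)
  also have "\<dots> \<le> opn x * n x" using opn_mult_le[OF cideal_st[OF cideal_image x], of x] by simp
  finally show ?thesis using pos by simp
qed (simp add: opn_nonneg)

text \<open>The adjoint of a left unit is a right unit, and the two coincide up to
  \<open>\<asymp>\<close>.\<close>

lemma left_unit_unital: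
  assumes u: "u \<in> J" and ul: "\<And>x. x \<in> J \<Longrightarrow> u * x \<asymp> x"
  shows "unital M"
proof -
  have ur: "x * st u \<asymp> x" if x: "x \<in> J" for x
    using eqn_st[OF ul[OF cideal_st[OF cideal_image x]]] by (simp add: st_mult)
  have "u \<asymp> u * st u" by (rule eqn_sym[OF ur[OF u]])
  also have "\<dots> \<asymp> st u" by (rule ul[OF cideal_st[OF cideal_image u]])
  finally have usa: "u \<asymp> st u" .
  obtain e where e: "e \<in> carrier M" "u \<asymp> \<phi> e" using u by (auto simp: range_hull_def)
  have "is_identity M e" unfolding is_identity_def
  proof (intro conjI ballI e)
    fix x assume x: "x \<in> carrier M"
    have xJ: "\<phi> x \<in> J" by (rule \<phi>_in_range_hull[OF x])
    show "e \<otimes> x = x"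
    proof (rule \<phi>_inj)
      have "\<phi> (e \<otimes> x) \<asymp> \<phi> e * \<phi> x" by (rule \<phi>_mult[OF e(1) x])
      also have "\<dots> \<asymp> u * \<phi> x" by (rule eqn_multr[OF eqn_sym[OF e(2)]])
      also have "\<dots> \<asymp> \<phi> x" by (rule ul[OF xJ])
      finally show "\<phi> (e \<otimes> x) \<asymp> \<phi> x" .
    qed (use e x mult_closed' in auto)
    show "x \<otimes> e = x"
    proof (rule \<phi>_inj)
      have "\<phi> (x \<otimes> e) \<asymp> \<phi> x * \<phi> e" by (rule \<phi>_mult[OF x e(1)])
      also have "\<dots> \<asymp> \<phi> x * u" by (rule eqn_multl[OF eqn_sym[OF e(2)]])
      also have "\<dots> \<asymp> \<phi> x * st u" by (rule eqn_multl[OF usa])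
      also have "\<dots> \<asymp> \<phi> x" by (rule ur[OF xJ])
      finally show "\<phi> (x \<otimes> e) \<asymp> \<phi> x" .
    qed (use e x mult_closed' in auto)
  qed
  then show ?thesis by (auto simp: unital_def)
qed

text \<open>If the operator norm of \<open>x + 1\<close> could be made arbitrarily small, a limit of such \<open>-x\<close> would be
  an identity.\<close>

lemma opn_bounded_below:
  assumes nu: "\<not> unital M"
  shows "\<exists>\<delta>>0. \<forall>x\<in>J. \<delta> \<le> opn (x + 1)"
proof (rule ccontr)
  assume "\<not> ?thesis"
  then have "\<exists>x\<in>J. opn (x + 1) < \<delta>" if "\<delta> > 0" for \<delta> using that by (meson not_le)
  then have "\<exists>x\<in>J. opn (x + 1) < 1 / real (Suc k)" for k by simp
  then obtain f where f: "f k \<in> J" "opn (f k + 1) < 1 / real (Suc k)" for k by metis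
  \<comment> \<open>\<open>f i - f j\<close> is the difference of \<open>f i + 1\<close> and
    \<open>f j + 1\<close>, and it lies in \<open>J\<close>, where \<open>n\<close> is bounded by
    \<open>opn\<close>.\<close>
  have diff: "n (f i - f j) \<le> 1 / real (Suc i) + 1 / real (Suc j)" for i j
  proof -
    have "f i - f j \<in> J" by (rule ideal_diff[OF Jid f(1) f(1)])
    then have "n (f i - f j) \<le> opn ((f i + 1) + - (f j + 1))" using n_le_opn by simp
    also have "\<dots> \<le> opn (f i + 1) + opn (f j + 1)"
      using opn_triangle[of "f i + 1" "- (f j + 1)"] by (simp only: opn_uminus)
    finally show ?thesis using f(2)[of i] f(2)[of j] by linarith
  qed
  have "\<forall>e>0. \<exists>N. \<forall>i\<ge>N. \<forall>j\<ge>N. n (f i - f j) < e"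
  proof (intro allI impI)
    fix e :: real assume "e > 0"
    then obtain N where N: "1 / real (Suc N) < e / 2" using reals_Archimedean[of "e/2"] by (auto simp: inverse_eq_divide)
    have "n (f i - f j) < e" if "i \<ge> N" "j \<ge> N" for i j
    proof -
      have "1 / real (Suc i) \<le> 1 / real (Suc N)" "1 / real (Suc j) \<le> 1 / real (Suc N)"
        using that by (simp_all add: frac_le)
      then show ?thesis using diff[of i j] N by linarith
    qed
    then show "\<exists>N. \<forall>i\<ge>N. \<forall>j\<ge>N. n (f i - f j) < e" by blast
  qed
  then obtain l where l: "\<forall>e>0. \<exists>N. \<forall>i\<ge>N. n (f i - l) < e" using n_complete by blast
  have lJ: "l \<in> J"
  proof (rule cideal_closed[OF cideal_image])
    fix e :: real assume "e > 0"
    then obtain N where "\<forall>i\<ge>N. n (f i - l) < e" using l by blast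
    then show "\<exists>y\<in>J. n (l - y) < e" using f(1) n_minus_commute by (metis order_refl)
  qed
  have "opn (l + 1) \<le> 0 + e" if "e > 0" for e
  proof -
    have e2: "e / 2 > 0" using that by simp
    obtain N where N: "\<forall>i\<ge>N. n (f i - l) < e / 2" using l e2 by blast
    obtain N' where N': "1 / real (Suc N') < e / 2" using reals_Archimedean[OF e2] by (auto simp: inverse_eq_divide)
    define i where "i = max N N'"
    have "1 / real (Suc i) \<le> 1 / real (Suc N')" by (simp add: i_def frac_le)
    then have "opn (f i + 1) < e / 2" using f(2)[of i] N' by linarith
    moreover have "n (f i - l) < e / 2" using N by (simp add: i_def)
    then have "opn (l - f i) < e / 2"
      using opn_le_n[of "l - f i"] n_minus_commute[of l "f i"] by linarith
    moreover have "opn (l + 1) \<le> opn (l - f i) + opn (f i + 1)" using opn_triangle[of "l - f i" "f i + 1"] by simp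
    ultimately show ?thesis by simp
  qed
  then have "opn (l + 1) \<le> 0" by (rule field_le_epsilon)
  then have z: "(l + 1) * x \<asymp> 0" if "x \<in> J" for x
    using opn_mult_le[OF that, of "l + 1"] opn_nonneg[of "l + 1"] n_nonneg[of "(l + 1) * x"]
    by (simp add: eqn_0_iff del: n_nonneg)
  have "unital M"
  proof (rule left_unit_unital)
    show "- l \<in> J" by (rule ideal_uminus[OF Jid lJ])
    show "- l * x \<asymp> x" if "x \<in> J" for x
      using eqn_diff[OF eqn_refl[of x] z[OF that]] by (simp add: algebra_simps)
  qed
  then show False using nu by simp
qed

text \<open>Division by \<open>s\<close> turns \<open>opn_bounded_below\<close> into
  \<open>cmod s * \<delta> \<le> opn (x + scal s)\<close>. This bounds the scalar part and, through
  \<open>n_le_opn\<close>, also \<open>x\<close>; the scalar part is used twice, whence the 2 in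
  \<open>C\<close>.\<close>

lemma opn_ge:
  assumes nu: "\<not> unital M"
  obtains C where "C > 0" "\<And>x s. x \<in> J \<Longrightarrow> n (x + scal s) \<le> C * opn (x + scal s)"
proof -
  obtain \<delta> where \<delta>: "\<delta> > 0" "\<And>x. x \<in> J \<Longrightarrow> \<delta> \<le> opn (x + 1)" using opn_bounded_below[OF nu] by blast
  define C where "C = 1 + 2 / \<delta>"
  have "C > 0" using \<delta> by (simp add: C_def add_pos_pos)
  moreover have "n (x + scal s) \<le> C * opn (x + scal s)" if x: "x \<in> J" for x s
  proof -
    let ?o = "opn (x + scal s)"
    have s: "cmod s * \<delta> \<le> ?o"
    proof (cases "s = 0")
      case False
      have "\<delta> \<le> opn (scal (1/s) * x + 1)" by (rule \<delta>(2)[OF ideal_lmult[OF Jid x]])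
      also have "scal (1/s) * x + 1 = scal (1/s) * (x + scal s)" by (simp add: distrib_left scal_inverse[OF False])
      also have "opn \<dots> \<le> cmod (1/s) * ?o" by (rule opn_scal)
      finally show ?thesis using False by (simp add: norm_divide field_simps)
    qed (simp add: opn_nonneg)
    then have s': "cmod s \<le> ?o / \<delta>" using \<delta>(1) by (simp add: field_simps)
    have "n x \<le> opn ((x + scal s) + - scal s)" using n_le_opn[OF x] by simp
    also have "\<dots> \<le> ?o + opn (- scal s)" by (rule opn_triangle)
    also have "opn (- scal s) \<le> cmod s" using opn_le_n[of "- scal s"] n_scal_le[of s] by simp
    finally have "n x \<le> ?o + cmod s" by simp
    then have "n (x + scal s) \<le> (?o + cmod s) + cmod s" by (rule n_triangle_le[OF _ n_scal_le])
    also have "\<dots> \<le> ?o + 2 * (?o / \<delta>)" using s' by simp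
    also have "\<dots> = C * ?o" by (simp add: C_def algebra_simps)
    finally show ?thesis .
  qed
  ultimately show thesis by (rule that)
qed

text \<open>\<open>\<phi> \<zero>\<close> vanishes only up to \<open>\<asymp>\<close>. The
  exceptional value sends the identity exactly to 1, the unit that appears in
  \<open>sub_IR_unitization\<close>.\<close>

definition \<Phi> :: "'m \<times> complex \<Rightarrow> 'p" where
  "\<Phi> p = (if p = (\<zero>, 1) then 1 else \<phi> (fst p) + scal (snd p))"

lemma \<Phi>_eq: "\<Phi> p \<asymp> \<phi> (fst p) + scal (snd p)"
  using eqn_sym[OF eqn_add[OF \<phi>_zero eqn_refl[of 1]]] by (simp add: \<Phi>_def)

lemma adjoin_simps:
  "carrier (adjoin_identity M) = carrier M \<times> UNIV"
  "\<zero>\<^bsub>adjoin_identity M\<^esub> = (\<zero>, 0)"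
  "p \<oplus>\<^bsub>adjoin_identity M\<^esub> q = (fst p \<oplus> fst q, snd p + snd q)"
  "p \<otimes>\<^bsub>adjoin_identity M\<^esub> q = ((fst p \<otimes> fst q) \<oplus> (snd p \<odot> fst q) \<oplus> (snd q \<odot> fst p), snd p * snd q)"
  "c \<odot>\<^bsub>adjoin_identity M\<^esub> p = (c \<odot> fst p, c * snd p)"
  by (simp_all add: adjoin_identity_def case_prod_beta)

lemma \<Phi>_eqn_trans: "\<phi> (fst p) + scal (snd p) \<asymp> x \<Longrightarrow> \<Phi> p \<asymp> x"
  using eqn_trans[OF \<Phi>_eq] by blast

lemma adjoin_embedding:
  assumes nu: "\<not> unital M"
  obtains C where "star_alg_embedding st iu n (adjoin_identity M) \<Phi> opn C"
proof -
  obtain C where C: "C > 0" "\<And>x s. x \<in> J \<Longrightarrow> n (x + scal s) \<le> C * opn (x + scal s)" using opn_ge[OF nu] by blast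
  let ?D = "adjoin_identity M"
  have opn_cong: "opn x = opn y" if "x \<asymp> y" for x y
    unfolding opn_def using eqn_n[OF eqn_multr[OF that]] by simp
  have ge: "n (\<Phi> p) \<le> C * opn (\<Phi> p)" if "p \<in> carrier ?D" for p
    using that C(2)[of "\<phi> (fst p)" "snd p"] \<phi>_in_range_hull[of "fst p" "carrier M"]
      eqn_n[OF \<Phi>_eq[of p]] opn_cong[OF \<Phi>_eq[of p]]
    by (auto simp: adjoin_simps)
  have inj: "p = q" if p: "p \<in> carrier ?D" and q: "q \<in> carrier ?D" and eq: "\<Phi> p \<asymp> \<Phi> q" for p q
  proof -
    obtain a s b t where ab: "p = (a, s)" "q = (b, t)" "a \<in> carrier M" "b \<in> carrier M"
      using p q by (cases p, cases q) (auto simp: adjoin_simps)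
    have "\<phi> a + scal s \<asymp> \<phi> b + scal t"
      using eqn_trans[OF eqn_sym[OF \<Phi>_eq[of p]] eqn_trans[OF eq \<Phi>_eq[of q]]] ab by simp
    then have 0: "n ((\<phi> a - \<phi> b) + scal (s - t)) = 0"
      by (simp add: eqn_def null_def scal_diff algebra_simps)
    have J1: "\<phi> a - \<phi> b \<in> J" using ab \<phi>_in_range_hull by (intro ideal_diff[OF Jid]) auto
    have "s = t"
    proof (rule ccontr)
      assume st: "s \<noteq> t"
      \<comment> \<open>If the scalar parts differed, \<open>?x\<close> would be a left unit of
        \<open>J\<close>, because \<open>1 - ?x\<close> is a scalar multiple of an element of
        seminorm 0.\<close>
      let ?c = "1 / (s - t)"
      let ?x = "- (scal ?c * (\<phi> a - \<phi> b))"
      have xJ: "?x \<in> J" using J1 Jid by (intro ideal_uminus[OF Jid] ideal_lmult[OF Jid])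
      have "scal ?c * ((\<phi> a - \<phi> b) + scal (s - t)) \<asymp> scal ?c * 0"
        using 0 by (intro eqn_multl) (simp add: eqn_0_iff)
      moreover have "scal ?c * ((\<phi> a - \<phi> b) + scal (s - t)) = 1 - ?x"
        using scal_inverse(1)[of "s - t"] st by (simp add: distrib_left)
      ultimately have x1: "1 - ?x \<asymp> 0" by simp
      have "?x * y \<asymp> y" if "y \<in> J" for y
        using eqn_diff[OF eqn_refl[of y] eqn_multr[OF x1, of y]] by (simp add: algebra_simps)
      then show False using left_unit_unital[OF xJ] nu by blast
    qed
    then have "\<phi> a \<asymp> \<phi> b" using 0 by (simp add: eqn_def null_def)
    then show ?thesis using \<phi>_inj ab \<open>s = t\<close> by simp
  qed
  have nrm: "nrm ?D p = opn (\<Phi> p)" if pD: "p \<in> carrier ?D" for p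
  proof -
    obtain a s where p: "p = (a, s)" "a \<in> carrier M" using pD by (cases p) (auto simp: adjoin_simps)
    have "nrm M (a \<otimes> b \<oplus> s \<odot> b) = n (\<Phi> p * \<phi> b)" if b: "b \<in> carrier M" for b
    proof -
      have "\<phi> (a \<otimes> b \<oplus> s \<odot> b) \<asymp> \<phi> (a \<otimes> b) + \<phi> (s \<odot> b)"
        using p b by (intro \<phi>_add mult_closed' smult_closed')
      also have "\<dots> \<asymp> \<phi> a * \<phi> b + scal s * \<phi> b" using p b by (intro eqn_add \<phi>_mult \<phi>_smult)
      also have "\<dots> = (\<phi> a + scal s) * \<phi> b" by (simp add: distrib_right)
      also have "\<dots> \<asymp> \<Phi> p * \<phi> b" using eqn_sym[OF \<Phi>_eq[of p]] p by (intro eqn_multr) simp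
      finally show ?thesis using p b by (simp add: nrm_eq eqn_n add_closed' mult_closed' smult_closed')
    qed
    then show ?thesis unfolding opn_def unit_ball_def adjoin_identity_def p(1) by simp
  qed
  have "star_alg_embedding st iu n ?D \<Phi> opn C"
  proof
    show "\<Phi> \<zero>\<^bsub>?D\<^esub> \<asymp> 0" by (rule \<Phi>_eqn_trans) (simp add: adjoin_simps \<phi>_zero)
    show "\<Phi> (p \<oplus>\<^bsub>?D\<^esub> q) \<asymp> \<Phi> p + \<Phi> q" if "p \<in> carrier ?D" "q \<in> carrier ?D" for p q
    proof (rule \<Phi>_eqn_trans)
      have "\<phi> (fst p \<oplus> fst q) + scal (snd p + snd q) \<asymp> (\<phi> (fst p) + \<phi> (fst q)) + scal (snd p + snd q)"
        using that by (intro eqn_add \<phi>_add) (auto simp: adjoin_simps)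
      also have "\<dots> = (\<phi> (fst p) + scal (snd p)) + (\<phi> (fst q) + scal (snd q))" by (simp add: scal_add algebra_simps)
      also have "\<dots> \<asymp> \<Phi> p + \<Phi> q" by (intro eqn_add eqn_sym[OF \<Phi>_eq])
      finally show "\<phi> (fst (p \<oplus>\<^bsub>?D\<^esub> q)) + scal (snd (p \<oplus>\<^bsub>?D\<^esub> q)) \<asymp> \<Phi> p + \<Phi> q" by (simp add: adjoin_simps)
    qed
    show "\<Phi> (p \<otimes>\<^bsub>?D\<^esub> q) \<asymp> \<Phi> p * \<Phi> q" if pq: "p \<in> carrier ?D" "q \<in> carrier ?D" for p q
    proof (rule \<Phi>_eqn_trans)
      have c: "fst p \<in> carrier M" "fst q \<in> carrier M" using pq by (auto simp: adjoin_simps)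
      let ?m = "(fst p \<otimes> fst q) \<oplus> (snd p \<odot> fst q) \<oplus> (snd q \<odot> fst p)"
      have "\<phi> ?m \<asymp> (\<phi> (fst p) * \<phi> (fst q) + scal (snd p) * \<phi> (fst q)) + scal (snd q) * \<phi> (fst p)"
        using c by (intro eqn_trans[OF \<phi>_add] eqn_add \<phi>_mult \<phi>_smult add_closed' mult_closed' smult_closed')
      then have "\<phi> ?m + scal (snd p * snd q) \<asymp>
        (\<phi> (fst p) * \<phi> (fst q) + scal (snd p) * \<phi> (fst q)) + scal (snd q) * \<phi> (fst p) + scal (snd p * snd q)"
        by (intro eqn_add) simp_all
      also have "scal (snd q) * \<phi> (fst p) = \<phi> (fst p) * scal (snd q)" by (rule scal_commute)
      also have "(\<phi> (fst p) * \<phi> (fst q) + scal (snd p) * \<phi> (fst q)) + \<phi> (fst p) * scal (snd q) + scal (snd p * snd q)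
          = (\<phi> (fst p) + scal (snd p)) * (\<phi> (fst q) + scal (snd q))" by (simp add: scal_mult algebra_simps)
      also have "\<dots> \<asymp> \<Phi> p * \<Phi> q" by (intro eqn_mult eqn_sym[OF \<Phi>_eq])
      finally show "\<phi> (fst (p \<otimes>\<^bsub>?D\<^esub> q)) + scal (snd (p \<otimes>\<^bsub>?D\<^esub> q)) \<asymp> \<Phi> p * \<Phi> q" by (simp add: adjoin_simps)
    qed
    show "\<Phi> (c \<odot>\<^bsub>?D\<^esub> p) \<asymp> scal c * \<Phi> p" if p: "p \<in> carrier ?D" for c p
    proof (rule \<Phi>_eqn_trans)
      have "\<phi> (c \<odot> fst p) + scal (c * snd p) \<asymp> scal c * \<phi> (fst p) + scal (c * snd p)"
        using p by (intro eqn_add \<phi>_smult) (auto simp: adjoin_simps)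
      also have "\<dots> = scal c * (\<phi> (fst p) + scal (snd p))" by (simp add: scal_mult algebra_simps)
      also have "\<dots> \<asymp> scal c * \<Phi> p" by (intro eqn_multl eqn_sym[OF \<Phi>_eq])
      finally show "\<phi> (fst (c \<odot>\<^bsub>?D\<^esub> p)) + scal (snd (c \<odot>\<^bsub>?D\<^esub> p)) \<asymp> scal c * \<Phi> p" by (simp add: adjoin_simps)
    qed
  qed (auto simp: inj nrm ge C opn_triangle opn_uminus opn_le_n adjoin_simps add_closed' mult_closed' smult_closed' zero_closed')
  then show thesis by (rule that)
qed

lemma adjoin_is_identity:
  assumes nu: "\<not> unital M"
  shows "is_identity (adjoin_identity M) (\<zero>, 1)"
proof -
  let ?D = "adjoin_identity M"
  obtain C where "star_alg_embedding st iu n ?D \<Phi> opn C" by (rule adjoin_embedding[OF nu])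
  then interpret D: star_alg_embedding st iu n ?D \<Phi> opn C .
  show "is_identity ?D (\<zero>, 1)" unfolding is_identity_def
  proof (intro conjI ballI)
    show ec: "(\<zero>, 1) \<in> carrier ?D" using zero_closed' by (simp add: adjoin_simps)
    fix p assume p: "p \<in> carrier ?D"
    have "\<Phi> ((\<zero>, 1) \<otimes>\<^bsub>?D\<^esub> p) \<asymp> \<Phi> p" using D.\<phi>_mult[OF ec p] by (simp add: \<Phi>_def[of "(\<zero>, 1)"])
    then show "(\<zero>, 1) \<otimes>\<^bsub>?D\<^esub> p = p" by (intro D.\<phi>_inj D.mult_closed' ec p)
    have "\<Phi> (p \<otimes>\<^bsub>?D\<^esub> (\<zero>, 1)) \<asymp> \<Phi> p" using D.\<phi>_mult[OF p ec] by (simp add: \<Phi>_def[of "(\<zero>, 1)"])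
    then show "p \<otimes>\<^bsub>?D\<^esub> (\<zero>, 1) = p" by (intro D.\<phi>_inj D.mult_closed' ec p)
  qed
qed

lemma adjoin_range: "{t. \<exists>p\<in>carrier (adjoin_identity M). t \<asymp> \<Phi> p} = unitization J"
proof (intro equalityI subsetI)
  fix x assume "x \<in> {t. \<exists>p\<in>carrier (adjoin_identity M). t \<asymp> \<Phi> p}"
  then obtain a s where a: "a \<in> carrier M" "x \<asymp> \<Phi> (a, s)" by (auto simp: adjoin_simps)
  have "x - scal s \<asymp> \<phi> a"
    using eqn_diff[OF eqn_trans[OF a(2) \<Phi>_eq] eqn_refl[of "scal s"]] by simp
  then have "x - scal s \<in> J" using a(1) by (auto simp: range_hull_def)
  then show "x \<in> unitization J" by (auto simp: unitization_def)
next
  fix x assume "x \<in> unitization J"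
  then obtain s a where a: "a \<in> carrier M" "x - scal s \<asymp> \<phi> a" by (auto simp: unitization_def range_hull_def)
  have "x \<asymp> \<phi> a + scal s" using eqn_add[OF a(2) eqn_refl[of "scal s"]] by simp
  then have "x \<asymp> \<Phi> (a, s)" using eqn_trans[OF _ eqn_sym[OF \<Phi>_eq[of "(a, s)"]]] by simp
  then show "x \<in> {t. \<exists>p\<in>carrier (adjoin_identity M). t \<asymp> \<Phi> p}" using a(1) by (auto simp: adjoin_simps)
qed

lemma nonunital_case:
  assumes nu: "\<not> unital M"
  shows "unital_IR (adjoin_identity M) \<longleftrightarrow> ideal_IR J"
proof -
  let ?D = "adjoin_identity M"
  obtain C where "star_alg_embedding st iu n ?D \<Phi> opn C" by (rule adjoin_embedding[OF nu])
  then interpret D: star_alg_embedding st iu n ?D \<Phi> opn C .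
  have "D.range_hull (carrier ?D) = unitization J"
    using adjoin_range by (simp add: D.range_hull_def)
  then have "unital_IR ?D \<longleftrightarrow> sub_IR (unitization J) 1"
    using D.unital_IR_iff[OF adjoin_is_identity[OF nu]] by (simp add: \<Phi>_def)
  then show ?thesis using sub_IR_unitization[OF cideal_image] by simp
qed

theorem has_IR_iff: "has_IR M \<longleftrightarrow> ideal_IR J"
  using unital_case nonunital_case by (auto simp: has_IR_def unital_def)

end

section \<open>Elementary facts on C*-algebras\<close>

context cstar_algebra
begin

lemma scale_zero: "c \<odot> \<zero> = \<zero>"
proof -
  have "c \<odot> \<zero> \<oplus> c \<odot> \<zero> = c \<odot> \<zero>" using scale_add_right[of \<zero> \<zero> c] by simp
  then show ?thesis by (metis add.l_cancel_one' scale_closed zero_closed)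
qed

lemma zero_scale: "x \<in> carrier A \<Longrightarrow> 0 \<odot> x = \<zero>"
proof -
  assume x: "x \<in> carrier A"
  have "0 \<odot> x \<oplus> 0 \<odot> x = 0 \<odot> x" using scale_add_left[OF x, of 0 0] by simp
  then show ?thesis using x by (metis add.l_cancel_one' scale_closed)
qed

lemma mult_zero_right: "x \<in> carrier A \<Longrightarrow> x \<otimes> \<zero> = \<zero>"
proof -
  assume x: "x \<in> carrier A"
  have "x \<otimes> \<zero> \<oplus> x \<otimes> \<zero> = x \<otimes> \<zero>" using distrib_left[OF zero_closed zero_closed x] by simp
  then show ?thesis using x by (metis add.l_cancel_one' mult_closed zero_closed)
qed

lemma mult_zero_left: "x \<in> carrier A \<Longrightarrow> \<zero> \<otimes> x = \<zero>"
proof -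
  assume x: "x \<in> carrier A"
  have "\<zero> \<otimes> x \<oplus> \<zero> \<otimes> x = \<zero> \<otimes> x" using distrib_right[OF zero_closed zero_closed x] by simp
  then show ?thesis using x by (metis add.l_cancel_one' mult_closed zero_closed)
qed

lemma minus_eq_scale: "x \<in> carrier A \<Longrightarrow> \<ominus> x = (-1) \<odot> x"
proof -
  assume x: "x \<in> carrier A"
  have "x \<oplus> (-1) \<odot> x = (1 + -1) \<odot> x" using x by (simp only: scale_add_left scale_one)
  then have "x \<oplus> (-1) \<odot> x = \<zero>" using x by (simp add: zero_scale)
  then show ?thesis using x by (metis a_comm minus_equality scale_closed)
qed

lemma nrm_zero: "nrm A \<zero> = 0" using nrm_eq_0_iff[of \<zero>] by simp

lemma nrm_star_le: "x \<in> carrier A \<Longrightarrow> nrm A x \<le> nrm A (star A x)"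
proof (cases "nrm A x = 0")
  case False
  assume x: "x \<in> carrier A"
  have "nrm A x * nrm A x \<le> nrm A (star A x) * nrm A x"
    using cstar_identity[OF x] nrm_mult[OF star_closed[OF x] x] by (simp add: power2_eq_square)
  moreover have "nrm A x > 0" using False nrm_nonneg[OF x] by simp
  ultimately show ?thesis by simp
qed (simp add: nrm_nonneg star_closed)

lemma nrm_star: "x \<in> carrier A \<Longrightarrow> nrm A (star A x) = nrm A x"
  using nrm_star_le[of x] nrm_star_le[of "star A x"] by (simp add: star_closed star_star)

text \<open>The element \<open>a + s1\<close> of the unitization is kept as two separate arguments
  from here on, whether or not the algebra has an identity; \<open>umult\<close> is the first
  component of a product of two such elements.\<close>

definition act :: "'a \<Rightarrow> complex \<Rightarrow> 'a \<Rightarrow> 'a" where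
  "act a s b = (a \<otimes> b) \<oplus> (s \<odot> b)"

definition opnorm :: "'a \<Rightarrow> complex \<Rightarrow> real" where
  "opnorm a s = (SUP b\<in>{b \<in> carrier A. nrm A b \<le> 1}. nrm A (act a s b))"

lemmas alg_closed = mult_closed scale_closed star_closed

lemma act_closed: "a \<in> carrier A \<Longrightarrow> b \<in> carrier A \<Longrightarrow> act a s b \<in> carrier A"
  by (simp add: act_def alg_closed)

lemma nrm_act_le: 
  assumes "a \<in> carrier A" "b \<in> carrier A"
  shows "nrm A (act a s b) \<le> (nrm A a + cmod s) * nrm A b"
proof -
  have "nrm A (act a s b) \<le> nrm A (a \<otimes> b) + nrm A (s \<odot> b)"
    unfolding act_def using assms by (intro nrm_triangle alg_closed)
  also have "\<dots> \<le> nrm A a * nrm A b + cmod s * nrm A b" using assms by (simp add: nrm_mult nrm_scale)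
  finally show ?thesis by (simp add: semiring_class.distrib_right)
qed

lemma opnorm_bdd:
  assumes a: "a \<in> carrier A"
  shows "bdd_above ((\<lambda>b. nrm A (act a s b)) ` {b \<in> carrier A. nrm A b \<le> 1})"
proof (rule bdd_aboveI2)
  fix b assume b: "b \<in> {b \<in> carrier A. nrm A b \<le> 1}"
  have "(nrm A a + cmod s) * nrm A b \<le> (nrm A a + cmod s) * 1"
    using b nrm_nonneg[OF a] by (intro mult_left_mono) auto
  then show "nrm A (act a s b) \<le> nrm A a + cmod s" using nrm_act_le[OF a, of b s] b by simp
qed

lemma opnorm_least:
  assumes "\<And>b. b \<in> carrier A \<Longrightarrow> nrm A b \<le> 1 \<Longrightarrow> nrm A (act a s b) \<le> t"
  shows "opnorm a s \<le> t"
  unfolding opnorm_def using assms nrm_zero by (intro cSUP_least) (auto intro!: exI[of _ \<zero>])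

lemma opnorm_upper: "a \<in> carrier A \<Longrightarrow> b \<in> carrier A \<Longrightarrow> nrm A b \<le> 1 \<Longrightarrow> nrm A (act a s b) \<le> opnorm a s"
  unfolding opnorm_def by (rule cSUP_upper[OF _ opnorm_bdd]) auto

lemma opnorm_nonneg: "a \<in> carrier A \<Longrightarrow> 0 \<le> opnorm a s"
  using opnorm_upper[of a \<zero> s] nrm_nonneg[OF act_closed[of a \<zero> s]] by (simp add: nrm_zero)

lemma act_scale: "a \<in> carrier A \<Longrightarrow> b \<in> carrier A \<Longrightarrow> act a s (c \<odot> b) = c \<odot> act a s b"
  by (simp add: act_def scale_add_right scale_mult_right scale_scale alg_closed mult.commute)

lemma nrm_act_opnorm:
  assumes a: "a \<in> carrier A" and b: "b \<in> carrier A"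
  shows "nrm A (act a s b) \<le> opnorm a s * nrm A b"
proof (cases "nrm A b = 0")
  case True
  then show ?thesis using nrm_act_le[OF a b, of s] by simp
next
  case False
  then have pos: "nrm A b > 0" using nrm_nonneg[OF b] by simp
  let ?c = "of_real (1 / nrm A b) :: complex"
  have "nrm A (act a s (?c \<odot> b)) \<le> opnorm a s"
    using pos a b by (intro opnorm_upper) (simp_all add: nrm_scale alg_closed norm_divide)
  then have "nrm A (act a s b) / nrm A b \<le> opnorm a s"
    using pos a b by (simp add: act_scale nrm_scale act_closed norm_divide)
  then show ?thesis using pos by (simp add: divide_le_eq)
qed

lemma opnorm_le: "a \<in> carrier A \<Longrightarrow> opnorm a s \<le> nrm A a + cmod s"
proof (rule opnorm_least)
  fix b assume a: "a \<in> carrier A" and b: "b \<in> carrier A" "nrm A b \<le> 1"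
  have "(nrm A a + cmod s) * nrm A b \<le> (nrm A a + cmod s) * 1"
    using b nrm_nonneg[OF a] by (intro mult_left_mono) auto
  then show "nrm A (act a s b) \<le> nrm A a + cmod s" using nrm_act_le[OF a b(1), of s] by simp
qed

lemma act_zero_scalar: "a \<in> carrier A \<Longrightarrow> b \<in> carrier A \<Longrightarrow> act a 0 b = a \<otimes> b"
  by (simp add: act_def zero_scale alg_closed)

lemma opnorm_zero_scalar:
  assumes a: "a \<in> carrier A"
  shows "opnorm a 0 = nrm A a"
proof (rule antisym)
  show "opnorm a 0 \<le> nrm A a" using opnorm_le[OF a, of 0] by simp
  show "nrm A a \<le> opnorm a 0"
  proof (cases "nrm A a = 0")
    case False
    then have pos: "nrm A a > 0" using nrm_nonneg[OF a] by simp
    have "nrm A a * nrm A a = nrm A (a \<otimes> star A a)"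
      using cstar_identity[OF star_closed[OF a]] by (simp add: star_star a nrm_star power2_eq_square)
    also have "\<dots> \<le> opnorm a 0 * nrm A a"
      using nrm_act_opnorm[OF a star_closed[OF a], of 0] by (simp add: act_zero_scalar a star_closed nrm_star)
    finally show ?thesis using pos by simp
  qed (simp add: opnorm_nonneg a)
qed

lemma act_add:
  assumes "a \<in> carrier A" "b \<in> carrier A" "c \<in> carrier A"
  shows "act (a \<oplus> b) (s + t) c = act a s c \<oplus> act b t c"
  using assms by (simp add: act_def distrib_right scale_add_left alg_closed a_ac)

lemma opnorm_triangle:
  assumes "a \<in> carrier A" "b \<in> carrier A"
  shows "opnorm (a \<oplus> b) (s + t) \<le> opnorm a s + opnorm b t"
proof (rule opnorm_least)
  fix c assume c: "c \<in> carrier A" "nrm A c \<le> 1"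
  have "nrm A (act (a \<oplus> b) (s + t) c) \<le> nrm A (act a s c) + nrm A (act b t c)"
    using assms c by (simp add: act_add nrm_triangle act_closed)
  also have "\<dots> \<le> opnorm a s + opnorm b t" using assms c by (intro add_mono opnorm_upper)
  finally show "nrm A (act (a \<oplus> b) (s + t) c) \<le> opnorm a s + opnorm b t" .
qed

definition umult :: "'a \<Rightarrow> complex \<Rightarrow> 'a \<Rightarrow> complex \<Rightarrow> 'a" where
  "umult a s b t = (a \<otimes> b) \<oplus> (s \<odot> b) \<oplus> (t \<odot> a)"

lemma umult_closed: "a \<in> carrier A \<Longrightarrow> b \<in> carrier A \<Longrightarrow> umult a s b t \<in> carrier A"
  by (simp add: umult_def alg_closed)

lemmas expand = distrib_left distrib_right scale_add_left scale_add_right scale_scale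
  scale_mult_left scale_mult_right mult_assoc alg_closed a_ac

lemma act_umult:
  assumes "a \<in> carrier A" "b \<in> carrier A" "c \<in> carrier A"
  shows "act (umult a s b t) (s * t) c = act a s (act b t c)"
  using assms by (simp add: act_def umult_def expand mult.commute)

lemma umult_assoc:
  assumes "a \<in> carrier A" "b \<in> carrier A" "c \<in> carrier A"
  shows "umult (umult a s b t) (s * t) c u = umult a s (umult b t c u) (t * u)"
  using assms by (simp add: umult_def expand mult_ac)

lemma umult_add_left:
  assumes "a \<in> carrier A" "b \<in> carrier A" "c \<in> carrier A"
  shows "umult (a \<oplus> b) (s + t) c u = umult a s c u \<oplus> umult b t c u"
  using assms by (simp add: umult_def expand)

lemma umult_add_right:
  assumes "a \<in> carrier A" "b \<in> carrier A" "c \<in> carrier A"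
  shows "umult c u (a \<oplus> b) (s + t) = umult c u a s \<oplus> umult c u b t"
  using assms by (simp add: umult_def expand)

lemma umult_one:
  assumes "a \<in> carrier A"
  shows "umult \<zero> c a s = c \<odot> a" "umult a s \<zero> c = c \<odot> a"
  using assms by (simp_all add: umult_def mult_zero_left mult_zero_right scale_zero alg_closed)

lemma umult_scale:
  assumes "a \<in> carrier A" "b \<in> carrier A"
  shows "umult (c \<odot> a) (c * s) b t = c \<odot> umult a s b t" "umult a s (c \<odot> b) (c * t) = c \<odot> umult a s b t"
  using assms by (simp_all add: umult_def expand mult_ac)

lemma umult_star:
  assumes "a \<in> carrier A" "b \<in> carrier A"
  shows "star A (umult a s b t) = umult (star A b) (cnj t) (star A a) (cnj s)"
  using assms by (simp add: umult_def star_add star_mult star_scale alg_closed a_ac)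

lemma opnorm_umult:
  assumes "a \<in> carrier A" "b \<in> carrier A"
  shows "opnorm (umult a s b t) (s * t) \<le> opnorm a s * opnorm b t"
proof (rule opnorm_least)
  fix c assume c: "c \<in> carrier A" "nrm A c \<le> 1"
  have "nrm A (act (umult a s b t) (s * t) c) \<le> opnorm a s * nrm A (act b t c)"
    using assms c by (simp add: act_umult nrm_act_opnorm act_closed)
  also have "\<dots> \<le> opnorm a s * opnorm b t"
    using assms c by (intro mult_left_mono opnorm_upper opnorm_nonneg)
  finally show "nrm A (act (umult a s b t) (s * t) c) \<le> opnorm a s * opnorm b t" .
qed

lemma star_act_mult:
  assumes "a \<in> carrier A" "b \<in> carrier A" "c \<in> carrier A"
  shows "star A (act a s b) \<otimes> c = star A b \<otimes> act (star A a) (cnj s) c"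
  using assms by (simp add: act_def star_add star_mult star_scale expand)

text \<open>By \<open>cstar_identity\<close> the square of \<open>nrm A (act a s b)\<close> is the
  norm of a product: \<open>star A b\<close> times the result of letting the adjoint of
  \<open>a + s1\<close>, multiplied by \<open>a + s1\<close>, act on \<open>b\<close>.\<close>

lemma opnorm_cstar:
  assumes a: "a \<in> carrier A"
  shows "(opnorm a s)\<^sup>2 \<le> opnorm (umult (star A a) (cnj s) a s) (cnj s * s)"
proof -
  let ?m = "opnorm (umult (star A a) (cnj s) a s) (cnj s * s)"
  have mc: "umult (star A a) (cnj s) a s \<in> carrier A" using a by (intro umult_closed alg_closed)
  have "opnorm a s \<le> sqrt ?m"
  proof (rule opnorm_least)
    fix b assume b: "b \<in> carrier A" "nrm A b \<le> 1"
    have "(nrm A (act a s b))\<^sup>2 = nrm A (star A (act a s b) \<otimes> act a s b)"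
      using a b by (simp add: cstar_identity act_closed)
    also have "\<dots> = nrm A (star A b \<otimes> act (umult (star A a) (cnj s) a s) (cnj s * s) b)"
      using a b by (simp add: star_act_mult act_umult act_closed alg_closed)
    also have "\<dots> \<le> nrm A b * nrm A (act (umult (star A a) (cnj s) a s) (cnj s * s) b)"
      using nrm_mult[OF star_closed[OF b(1)] act_closed[OF mc b(1)]] by (simp add: nrm_star b)
    also have "\<dots> \<le> 1 * ?m"
      using b mc by (intro mult_mono opnorm_upper nrm_nonneg act_closed) simp_all
    finally show "nrm A (act a s b) \<le> sqrt ?m" by (simp add: real_le_rsqrt)
  qed
  then have "(opnorm a s)\<^sup>2 \<le> (sqrt ?m)\<^sup>2" using opnorm_nonneg[OF a] by (intro power_mono)
  then show ?thesis using opnorm_nonneg[OF mc] by simp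
qed

lemma opnorm_scale:
  assumes a: "a \<in> carrier A"
  shows "opnorm (c \<odot> a) (c * s) = cmod c * opnorm a s"
proof -
  have le: "opnorm (c \<odot> a) (c * s) \<le> cmod c * opnorm a s" if a: "a \<in> carrier A" for a c s
  proof (rule opnorm_least)
    fix b assume b: "b \<in> carrier A" "nrm A b \<le> 1"
    have "act (c \<odot> a) (c * s) b = c \<odot> act a s b" using a b by (simp add: act_def expand)
    then have "nrm A (act (c \<odot> a) (c * s) b) = cmod c * nrm A (act a s b)"
      using a b by (simp add: nrm_scale act_closed)
    then show "nrm A (act (c \<odot> a) (c * s) b) \<le> cmod c * opnorm a s"
      using a b by (simp add: opnorm_upper mult_left_mono)
  qed
  show ?thesis
  proof (cases "c = 0")
    case True
    then show ?thesis using le[OF a, of 0 s] opnorm_nonneg[OF scale_closed[OF a], of 0 0] by simp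
  next
    case False
    have "opnorm a s \<le> cmod (1 / c) * opnorm (c \<odot> a) (c * s)"
      using le[OF scale_closed[OF a, of c], of "1 / c" "c * s"] False a by (simp add: scale_scale scale_one)
    then have "cmod c * opnorm a s \<le> opnorm (c \<odot> a) (c * s)" using False by (simp add: norm_divide field_simps)
    then show ?thesis using le[OF a, of c s] by simp
  qed
qed

end

section \<open>The ambient algebra\<close>

text \<open>The unitization of the product of all C*-algebras over a given type.  The norm of each factor
  becomes a C*-seminorm on this ring, which is an instance of a type class although the C*-algebra
  under consideration has its carrier and operations as parameters.\<close>

typedef 'a ambient =
  "{x :: ('a star_alg \<Rightarrow> 'a) \<times> complex. \<forall>A. if cstar_algebra A then fst x A \<in> carrier A else fst x A = undefined}"
  by (rule exI[of _ "(\<lambda>A. if cstar_algebra A then \<zero>\<^bsub>A\<^esub> else undefined, 0)"])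
    (auto simp: cstar_algebra_def intro!: abelian_monoid.zero_closed abelian_group.axioms(1))

definition coord :: "'a ambient \<Rightarrow> 'a star_alg \<Rightarrow> 'a" where
  "coord x A = fst (Rep_ambient x) A"

definition scalar :: "'a ambient \<Rightarrow> complex" where
  "scalar x = snd (Rep_ambient x)"

definition mk :: "('a star_alg \<Rightarrow> 'a) \<Rightarrow> complex \<Rightarrow> 'a ambient" where
  "mk F s = Abs_ambient (\<lambda>A. if cstar_algebra A then F A else undefined, s)"

lemma coord_closed [simp]: "cstar_algebra A \<Longrightarrow> coord x A \<in> carrier A"
  using Rep_ambient[of x] by (auto simp: coord_def)

lemma ambient_eqI:
  assumes "scalar x = scalar y" "\<And>A. cstar_algebra A \<Longrightarrow> coord x A = coord y A"
  shows "x = y"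
proof -
  have "fst (Rep_ambient x) A = fst (Rep_ambient y) A" for A
    using Rep_ambient[of x] Rep_ambient[of y] assms(2)[of A] by (cases "cstar_algebra A") (auto simp: coord_def)
  then have "Rep_ambient x = Rep_ambient y" using assms(1) by (intro prod_eqI ext) (simp_all add: scalar_def)
  then show ?thesis by (simp add: Rep_ambient_inject)
qed

lemma Rep_mk:
  assumes "\<And>A. cstar_algebra A \<Longrightarrow> F A \<in> carrier A"
  shows "Rep_ambient (mk F s) = (\<lambda>A. if cstar_algebra A then F A else undefined, s)"
  unfolding mk_def using assms by (intro Abs_ambient_inverse) simp

lemma coord_mk: "(\<And>A. cstar_algebra A \<Longrightarrow> F A \<in> carrier A) \<Longrightarrow> cstar_algebra A \<Longrightarrow> coord (mk F s) A = F A"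
  and scalar_mk: "(\<And>A. cstar_algebra A \<Longrightarrow> F A \<in> carrier A) \<Longrightarrow> scalar (mk F s) = s"
  by (simp_all add: coord_def scalar_def Rep_mk)

lemma cstar_abelian_group: "cstar_algebra A \<Longrightarrow> abelian_group A"
  by (simp add: cstar_algebra_def)

lemma cstar_zero_closed: "cstar_algebra A \<Longrightarrow> \<zero>\<^bsub>A\<^esub> \<in> carrier A"
  and cstar_add_closed: "cstar_algebra A \<Longrightarrow> x \<in> carrier A \<Longrightarrow> y \<in> carrier A \<Longrightarrow> x \<oplus>\<^bsub>A\<^esub> y \<in> carrier A"
  by (simp_all add: cstar_abelian_group abelian_group.axioms(1) abelian_monoid.zero_closed abelian_monoid.a_closed)

instantiation ambient :: (type) real_algebra_1
begin

definition "0 = mk (\<lambda>A. \<zero>\<^bsub>A\<^esub>) 0"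
definition "1 = mk (\<lambda>A. \<zero>\<^bsub>A\<^esub>) 1"
definition "x + y = mk (\<lambda>A. coord x A \<oplus>\<^bsub>A\<^esub> coord y A) (scalar x + scalar y)"
definition "- x = mk (\<lambda>A. (-1) \<odot>\<^bsub>A\<^esub> coord x A) (- scalar x)"
definition "x - y = x + - (y :: 'a ambient)"
definition "x * y = mk (\<lambda>A. cstar_algebra.umult A (coord x A) (scalar x) (coord y A) (scalar y)) (scalar x * scalar y)"
definition "scaleR r x = mk (\<lambda>A. of_real r \<odot>\<^bsub>A\<^esub> coord x A) (of_real r * scalar x)"

lemma ambient_simps [simp]:
  "scalar 0 = 0" "scalar 1 = 1" "scalar (x + y) = scalar x + scalar y" "scalar (- x) = - scalar x"
  "scalar (x * y) = scalar x * scalar y" "scalar (scaleR r x) = of_real r * scalar x"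
  "cstar_algebra A \<Longrightarrow> coord 0 A = \<zero>\<^bsub>A\<^esub>" "cstar_algebra A \<Longrightarrow> coord 1 A = \<zero>\<^bsub>A\<^esub>"
  "cstar_algebra A \<Longrightarrow> coord (x + y) A = coord x A \<oplus>\<^bsub>A\<^esub> coord y A"
  "cstar_algebra A \<Longrightarrow> coord (- x) A = (-1) \<odot>\<^bsub>A\<^esub> coord x A"
  "cstar_algebra A \<Longrightarrow> coord (x * y) A = cstar_algebra.umult A (coord x A) (scalar x) (coord y A) (scalar y)"
  "cstar_algebra A \<Longrightarrow> coord (scaleR r x) A = of_real r \<odot>\<^bsub>A\<^esub> coord x A"
  unfolding zero_ambient_def one_ambient_def plus_ambient_def uminus_ambient_def times_ambient_def scaleR_ambient_def
  by (simp_all add: coord_mk scalar_mk cstar_zero_closed cstar_add_closed cstar_algebra.scale_closed cstar_algebra.umult_closed)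

instance
proof
  fix x y z :: "'a ambient" and r s :: real
  note c = cstar_algebra.umult_assoc cstar_algebra.umult_add_left cstar_algebra.umult_add_right
    cstar_algebra.umult_one cstar_algebra.scale_one cstar_algebra.scale_scale cstar_algebra.scale_add_left
    cstar_algebra.scale_add_right
  show "x + y + z = x + (y + z)"
    by (rule ambient_eqI)
      (simp_all add: abelian_monoid.a_assoc abelian_group.axioms(1) cstar_abelian_group)
  show "x + y = y + x"
    by (rule ambient_eqI)
      (simp_all add: abelian_monoid.a_comm abelian_group.axioms(1) cstar_abelian_group)
  show "0 + x = x"
    by (rule ambient_eqI)
      (simp_all add: abelian_monoid.l_zero abelian_group.axioms(1) cstar_abelian_group)
  show "- x + x = 0"
  proof (rule ambient_eqI)
    fix A :: "'a star_alg" assume A: "cstar_algebra A"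
    then interpret cstar_algebra A .
    show "coord (- x + x) A = coord 0 A" using A by (simp flip: minus_eq_scale add: l_neg)
  qed simp
  show "x - y = x + - y" by (rule minus_ambient_def)
  show "x * y * z = x * (y * z)" by (rule ambient_eqI) (simp_all add: c)
  show "(x + y) * z = x * z + y * z" by (rule ambient_eqI) (simp_all add: c algebra_simps)
  show "x * (y + z) = x * y + x * z" by (rule ambient_eqI) (simp_all add: c algebra_simps)
  show "1 * x = x" "x * 1 = x" by (rule ambient_eqI; simp add: c)+
  show "(0::'a ambient) \<noteq> 1"
  proof
    assume "(0::'a ambient) = 1"
    then have "scalar (0::'a ambient) = scalar (1::'a ambient)" by simp
    then show False by simp
  qed
  show "scaleR r (x + y) = scaleR r x + scaleR r y"
    by (rule ambient_eqI) (simp_all add: c algebra_simps)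
  show "scaleR (r + s) x = scaleR r x + scaleR s x" by (rule ambient_eqI) (simp_all add: c algebra_simps)
  show "scaleR r (scaleR s x) = scaleR (r * s) x" by (rule ambient_eqI) (simp_all add: c)
  show "scaleR 1 x = x" by (rule ambient_eqI) (simp_all add: c)
  show "scaleR r x * y = scaleR r (x * y)" "x * scaleR r y = scaleR r (x * y)"
    by (rule ambient_eqI; simp add: cstar_algebra.umult_scale)+
qed

end

lemma coord_diff: "cstar_algebra A \<Longrightarrow> coord (x - y) A = coord x A \<ominus>\<^bsub>A\<^esub> coord y A"
  and scalar_diff: "scalar (x - y) = scalar x - scalar y"
  by (simp_all only: minus_ambient_def ambient_simps a_minus_def cstar_algebra.minus_eq_scale[OF _ coord_closed]
      diff_conv_add_uminus)

definition ambient_star :: "'a ambient \<Rightarrow> 'a ambient" where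
  "ambient_star x = mk (\<lambda>A. star A (coord x A)) (cnj (scalar x))"

definition ambient_i :: "'a ambient" where
  "ambient_i = mk (\<lambda>A. \<zero>\<^bsub>A\<^esub>) \<i>"

lemma ambient_star_simps [simp]:
  "scalar (ambient_star x) = cnj (scalar x)"
  "cstar_algebra A \<Longrightarrow> coord (ambient_star x) A = star A (coord x A)"
  "scalar ambient_i = \<i>" "cstar_algebra A \<Longrightarrow> coord ambient_i A = \<zero>\<^bsub>A\<^esub>"
  by (simp_all add: ambient_star_def ambient_i_def coord_mk scalar_mk cstar_zero_closed cstar_algebra.star_closed)

text \<open>Taking the maximum with \<open>|scalar x|\<close> makes this a norm on the forced unitization, also when \<open>A\<close>
  has an identity already.\<close>

definition ambient_nrm :: "'a star_alg \<Rightarrow> 'a ambient \<Rightarrow> real" where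
  "ambient_nrm A x = max (cstar_algebra.opnorm A (coord x A) (scalar x)) (cmod (scalar x))"

lemma (in cstar_algebra) star_zero: "star A \<zero> = \<zero>"
  using star_scale[of \<zero> 0] by (simp add: zero_scale star_closed)

lemma (in cstar_algebra) norm_dist_metric: "Metric_space (carrier A) (norm_dist A)"
proof
  have d: "norm_dist A x y = nrm A (x \<ominus> y)" if "x \<in> carrier A" "y \<in> carrier A" for x y
    using that by (simp add: norm_dist_def)
  have swap: "y \<ominus> x = (-1) \<odot> (x \<ominus> y)" if "x \<in> carrier A" "y \<in> carrier A" for x y
    using that by (simp add: a_minus_def minus_eq_scale scale_add_right scale_scale scale_one scale_closed a_comm)
  show "0 \<le> norm_dist A x y" for x y by (simp add: norm_dist_def nrm_nonneg)
  show "norm_dist A x y = norm_dist A y x" for x y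
    using swap[of x y] by (simp add: norm_dist_def nrm_scale)
  show "norm_dist A x y = 0 \<longleftrightarrow> x = y" if "x \<in> carrier A" "y \<in> carrier A" for x y
  proof
    assume "norm_dist A x y = 0"
    then have "x \<ominus> y = \<zero>" using that by (simp add: d nrm_eq_0_iff)
    moreover have "x = (x \<ominus> y) \<oplus> y" using that by (simp add: a_minus_def a_assoc l_neg)
    ultimately show "x = y" using that by simp
  next
    assume "x = y"
    then show "norm_dist A x y = 0" using that by (simp add: d a_minus_def r_neg nrm_zero)
  qed
  show "norm_dist A x z \<le> norm_dist A x y + norm_dist A y z"
    if c: "x \<in> carrier A" "y \<in> carrier A" "z \<in> carrier A" for x y z
  proof -
    have "x \<ominus> z = (x \<ominus> y) \<oplus> (y \<ominus> z)"
      using c by (simp add: a_minus_def a_assoc) (metis a_inv_closed l_neg l_zero a_assoc)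
    then show ?thesis using c nrm_triangle[of "x \<ominus> y" "y \<ominus> z"] by (simp add: d)
  qed
qed

lemma ambient_cstar_seminorm:
  assumes A: "cstar_algebra A"
  shows "cstar_seminorm ambient_star ambient_i (ambient_nrm A)"
proof
  interpret cstar_algebra A by (rule A)
  note [simp] = A coord_closed[OF A]
  let ?n = "ambient_nrm A"
  show "ambient_star (x + y) = ambient_star x + ambient_star y" for x y :: "'a ambient"
    by (rule ambient_eqI) (simp_all add: cstar_algebra.star_add)
  show "ambient_star (x * y) = ambient_star y * ambient_star x" for x y :: "'a ambient"
    by (rule ambient_eqI) (simp_all add: cstar_algebra.umult_star)
  show "ambient_star (ambient_star x) = x" for x :: "'a ambient"
    by (rule ambient_eqI) (simp_all add: cstar_algebra.star_star)
  show "ambient_star (r *\<^sub>R x) = r *\<^sub>R ambient_star x" for r and x :: "'a ambient"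
    by (rule ambient_eqI) (simp_all add: cstar_algebra.star_scale)
  show "ambient_i * ambient_i = (-1 :: 'a ambient)"
    by (rule ambient_eqI) (simp_all add: cstar_algebra.umult_one cstar_algebra.scale_zero cstar_zero_closed)
  show "ambient_i * x = x * ambient_i" for x :: "'a ambient"
    by (rule ambient_eqI) (simp_all add: cstar_algebra.umult_one)
  show "ambient_star ambient_i = - (ambient_i :: 'a ambient)"
    by (rule ambient_eqI) (simp_all add: cstar_algebra.star_zero cstar_algebra.scale_zero)
  show "?n (x + y) \<le> ?n x + ?n y" for x y
    using opnorm_triangle[OF coord_closed[OF A, of x] coord_closed[OF A, of y], of "scalar x" "scalar y"] norm_triangle_ineq[of "scalar x" "scalar y"]
    unfolding ambient_nrm_def by (simp only: ambient_simps A coord_closed)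
  show "?n (r *\<^sub>R x) = \<bar>r\<bar> * ?n x" for r x
    by (simp add: ambient_nrm_def opnorm_scale norm_mult max_mult_distrib_left)
  show "?n (x * y) \<le> ?n x * ?n y" for x y
  proof -
    have "opnorm (coord x A) (scalar x) * opnorm (coord y A) (scalar y) \<le> ?n x * ?n y"
      "cmod (scalar x) * cmod (scalar y) \<le> ?n x * ?n y"
      unfolding ambient_nrm_def
      by (intro mult_mono max.cobounded1 max.cobounded2 opnorm_nonneg; simp add: opnorm_nonneg le_max_iff_disj)+
    then show ?thesis
      using opnorm_umult[of "coord x A" "coord y A" "scalar x" "scalar y"]
      by (simp add: ambient_nrm_def[of A "x * y"] norm_mult)
  qed
  show "(?n x)\<^sup>2 \<le> ?n (ambient_star x * x)" for x
  proof -
    have "(opnorm (coord x A) (scalar x))\<^sup>2 \<le> ?n (ambient_star x * x)"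
      using opnorm_cstar[of "coord x A" "scalar x"] by (simp add: ambient_nrm_def le_max_iff_disj)
    moreover have "(cmod (scalar x))\<^sup>2 \<le> ?n (ambient_star x * x)"
      by (simp add: ambient_nrm_def le_max_iff_disj norm_mult power2_eq_square)
    ultimately show ?thesis by (simp add: ambient_nrm_def[of A x] max_def)
  qed
  fix f :: "nat \<Rightarrow> 'a ambient"
  assume cauchy: "\<forall>e>0. \<exists>N. \<forall>i\<ge>N. \<forall>j\<ge>N. ?n (f i - f j) < e"
  have sc: "cmod (scalar (f i) - scalar (f j)) \<le> ?n (f i - f j)" for i j
    by (simp add: ambient_nrm_def scalar_diff)
  have "Cauchy (\<lambda>i. scalar (f i))"
    unfolding Cauchy_def dist_norm using cauchy sc by (meson le_less_trans)
  then obtain s where s: "(\<lambda>i. scalar (f i)) \<longlonglongrightarrow> s"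
    by (auto simp: Cauchy_convergent_iff convergent_def)
  interpret MS: Metric_space "carrier A" "norm_dist A" by (rule norm_dist_metric)
  \<comment> \<open>Completeness is obtained separately for the scalar part and for the coordinate
    at \<open>A\<close>. The coordinate arises by subtracting the scalar part, which costs a factor
    2.\<close>
  have dist: "norm_dist A (coord (f i) A) (coord (f j) A) \<le> 2 * ?n (f i - f j)" for i j
  proof -
    let ?a = "coord (f i) A \<ominus>\<^bsub>A\<^esub> coord (f j) A" and ?t = "scalar (f i) - scalar (f j)"
    have a: "?a \<in> carrier A" by simp
    have "opnorm (?a \<oplus>\<^bsub>A\<^esub> \<zero>\<^bsub>A\<^esub>) (?t + - ?t) \<le> opnorm ?a ?t + opnorm \<zero>\<^bsub>A\<^esub> (- ?t)"
      by (rule opnorm_triangle[OF a zero_closed])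
    then have "nrm A ?a \<le> opnorm ?a ?t + opnorm \<zero>\<^bsub>A\<^esub> (- ?t)"
      using opnorm_zero_scalar[OF a] a by simp
    also have "opnorm \<zero>\<^bsub>A\<^esub> (- ?t) \<le> cmod ?t" using opnorm_le[of "\<zero>\<^bsub>A\<^esub>" "- ?t"] by (simp add: nrm_zero norm_minus_commute)
    also have "opnorm ?a ?t \<le> ?n (f i - f j)" by (simp add: ambient_nrm_def coord_diff scalar_diff)
    finally show ?thesis using sc[of i j] by (simp add: norm_dist_def)
  qed
  have "MS.MCauchy (\<lambda>i. coord (f i) A)"
    unfolding MS.MCauchy_def
  proof (intro conjI allI impI)
    fix e :: real assume "e > 0"
    then have "e / 2 > 0" by simp
    then obtain N where N: "\<forall>i\<ge>N. \<forall>j\<ge>N. ?n (f i - f j) < e / 2" using cauchy by blast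
    show "\<exists>N. \<forall>i i'. N \<le> i \<longrightarrow> N \<le> i' \<longrightarrow> norm_dist A (coord (f i) A) (coord (f i') A) < e"
    proof (intro exI[of _ N] allI impI)
      fix i i' assume "N \<le> i" "N \<le> i'"
      then have "?n (f i - f i') < e / 2" using N by blast
      then show "norm_dist A (coord (f i) A) (coord (f i') A) < e" using dist[of i i'] by linarith
    qed
  qed auto
  then obtain a where a: "limitin MS.mtopology (\<lambda>i. coord (f i) A) a sequentially"
    using complete unfolding MS.mcomplete_def by blast
  then have ac: "a \<in> carrier A" and lim: "\<forall>e>0. \<exists>N. \<forall>i\<ge>N. norm_dist A (coord (f i) A) a < e"
    using MS.limit_metric_sequentially by auto
  \<comment> \<open>The seminorm sees only the coordinate at \<open>A\<close>, so the others may be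
    filled with zeros.\<close>
  define l where "l = mk (\<lambda>B. if B = A then a else \<zero>\<^bsub>B\<^esub>) s"
  have l: "coord l A = a" "scalar l = s"
    using ac by (simp_all add: l_def coord_mk scalar_mk cstar_zero_closed)
  show "\<exists>l. \<forall>e>0. \<exists>N. \<forall>i\<ge>N. ?n (f i - l) < e"
  proof (rule exI[of _ l], intro allI impI)
    fix e :: real assume "e > 0"
    then have e: "e / 2 > 0" by simp
    obtain N where N: "\<forall>i\<ge>N. norm_dist A (coord (f i) A) a < e / 2" using lim e by blast
    obtain N' where N': "\<forall>i\<ge>N'. cmod (scalar (f i) - s) < e / 2" using s e unfolding LIMSEQ_def dist_norm by blast
    have "?n (f i - l) < e" if i: "i \<ge> max N N'" for i
    proof -
      have "?n (f i - l) \<le> nrm A (coord (f i) A \<ominus>\<^bsub>A\<^esub> a) + cmod (scalar (f i) - s)"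
        using opnorm_le[of "coord (f i) A \<ominus>\<^bsub>A\<^esub> a" "scalar (f i) - s"] nrm_nonneg[of "coord (f i) A \<ominus>\<^bsub>A\<^esub> a"] ac
        by (simp add: ambient_nrm_def coord_diff scalar_diff l)
      moreover have "nrm A (coord (f i) A \<ominus>\<^bsub>A\<^esub> a) < e / 2" using N i ac by (simp add: norm_dist_def)
      moreover have "cmod (scalar (f i) - s) < e / 2" using N' i by simp
      ultimately show ?thesis by linarith
    qed
    then show "\<exists>N. \<forall>i\<ge>N. ?n (f i - l) < e" by blast
  qed
qed

section \<open>Lifting of invertibles\<close>

context cstar_seminorm
begin

definition sub_lifting :: "'p set \<Rightarrow> 'p \<Rightarrow> 'p set \<Rightarrow> bool" where
  "sub_lifting A u L \<longleftrightarrow> (\<forall>b\<in>A. (\<exists>c\<in>A. c * b - u \<in> L \<and> b * c - u \<in> L) \<longrightarrow>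
     (\<exists>v\<in>A. (\<exists>w\<in>A. w * v \<asymp> u \<and> v * w \<asymp> u) \<and> b - v \<in> L))"

lemma sub_lifting_UNIV:
  assumes L: "cideal L"
  shows "sub_lifting UNIV 1 L \<longleftrightarrow> lifting L"
proof -
  have "(\<exists>c. c * b - 1 \<in> K \<and> b * c - 1 \<in> K) \<longleftrightarrow> invm K b" if "cideal K" for K b
    using invm_obtain[OF cidealD[OF that], of b] by (metis invmI)
  from this[OF L] this[OF cideal_null] show ?thesis by (simp add: sub_lifting_def lifting_def eqn_def)
qed

text \<open>Elements pass from \<open>J\<close> to the ring by adding a nonzero multiple of
  \<open>1 - u\<close>, and back by multiplication with \<open>u\<close>. As \<open>L\<close> lies
  in \<open>J\<close>, the component in \<open>1 - u\<close> is carried along unchanged.\<close>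

lemma sub_lifting_unital_ideal:
  assumes J: "cideal J" and uJ: "u \<in> J" and ul: "\<And>x. x \<in> J \<Longrightarrow> u * x \<asymp> x" and ur: "\<And>x. x \<in> J \<Longrightarrow> x * u \<asymp> x"
    and J1: "1 \<notin> J" and UN: "unitization J = UNIV" and L: "cideal L" and LJ: "L \<subseteq> J"
  shows "sub_lifting J u L \<longleftrightarrow> lifting L"
proof -
  note Jid = cidealD[OF J] and Lid = cidealD[OF L]
  have muJ: "a * u \<in> J" for a by (rule ideal_lmult[OF Jid uJ])
  have mum: "a * u * (b * u) \<asymp> a * b * u" for a b by (rule mult_unit_mult[OF J uJ ul ur])
  have corner: "(a + scal p * (1 - u)) * (b + scal q * (1 - u)) \<asymp> a * b + scal p * scal q * (1 - u)"
    if "a \<in> J" "b \<in> J" for a b p q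
  proof -
    have s1: "a * scal q = scal q * a" and s2: "(1 - u) * scal q = scal q * (1 - u)"
      by (rule scal_commute[symmetric])+
    have "(a + scal p * (1 - u)) * (b + scal q * (1 - u))
        = a * b + (a * scal q) * (1 - u) + scal p * (b - u * b) + scal p * ((1 - u) * scal q) * (1 - u)"
      by (simp add: algebra_simps)
    also have "\<dots> = a * b + scal q * (a - a * u) + scal p * (b - u * b) + (scal p * scal q) * (1 - u - (u - u * u))"
      unfolding s1 s2 by (simp add: algebra_simps)
    also have "\<dots> \<asymp> a * b + scal q * (a - a) + scal p * (b - b) + (scal p * scal q) * (1 - u - (u - u))"
      using that uJ by (intro eqn_add eqn_multl eqn_diff ul ur) simp_all
    finally show ?thesis by simp
  qed
  show ?thesis
  proof
    assume S: "sub_lifting J u L"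
    show "lifting L" unfolding lifting_def
    proof (intro allI impI)
      fix x assume xL: "invm L x"
      obtain s where s: "x - scal s \<in> J" using UN by (auto simp: unitization_def)
      obtain c where c: "c * x - 1 \<in> L" "x * c - 1 \<in> L" by (rule invm_obtain[OF Lid xL])
      \<comment> \<open>Otherwise \<open>x\<close> lies in \<open>J\<close>, and its inverse modulo
        \<open>L \<subseteq> J\<close> would put 1 into \<open>J\<close>.\<close>
      have s0: "s \<noteq> 0"
      proof
        assume "s = 0"
        then have xJ: "x \<in> J" using s by simp
        have "1 = c * x - (c * x - 1)" by simp
        also have "\<dots> \<in> J" by (rule ideal_diff[OF Jid ideal_lmult[OF Jid xJ] subsetD[OF LJ c(1)]])
        finally show False using J1 by simp
      qed
      have cu: "c * u * (x * u) - u \<in> L" "x * u * (c * u) - u \<in> L"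
      proof -
        have "c * u * (x * u) - u \<asymp> c * x * u - u" "x * u * (c * u) - u \<asymp> x * c * u - u"
          by (intro eqn_diff mum eqn_refl)+
        moreover have "c * x * u - u = (c * x - 1) * u" "x * c * u - u = (x * c - 1) * u"
          by (simp_all add: left_diff_distrib)
        ultimately show "c * u * (x * u) - u \<in> L" "x * u * (c * u) - u \<in> L"
          using eqn_mem[OF L] ideal_rmult[OF Lid] c by metis+
      qed
      then obtain v w where v: "v \<in> J" "w \<in> J" "w * v \<asymp> u" "v * w \<asymp> u" "x * u - v \<in> L"
        using S muJ unfolding sub_lifting_def by blast
      let ?v = "v + scal s * (1 - u)" and ?w = "w + scal (1/s) * (1 - u)"
      have "?w * ?v \<asymp> u + (1 - u)"
        using eqn_trans[OF corner[OF v(2,1), of "1/s" s] eqn_add[OF v(3) eqn_refl]] scal_inverse[OF s0] by simp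
      moreover have "?v * ?w \<asymp> u + (1 - u)"
        using eqn_trans[OF corner[OF v(1,2), of s "1/s"] eqn_add[OF v(4) eqn_refl]] scal_inverse[OF s0] by simp
      ultimately have "invm null ?v" by (intro invmI[of ?w]) (simp_all add: eqn_def)
      moreover have "x - ?v \<in> L"
      proof -
        have "x - ?v = (x * u - v) - ((x - scal s) * u - (x - scal s))" by (simp add: algebra_simps)
        also have "\<dots> \<in> L" using v(5) eqn_cong_mem[OF L ur[OF s]] by (rule ideal_diff[OF Lid])
        finally show ?thesis .
      qed
      ultimately show "\<exists>v. invm null v \<and> x - v \<in> L" by blast
    qed
  next
    assume lift: "lifting L"
    show "sub_lifting J u L" unfolding sub_lifting_def
    proof (intro ballI impI)
      fix b assume b: "b \<in> J" and "\<exists>c\<in>J. c * b - u \<in> L \<and> b * c - u \<in> L"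
      then obtain c where c: "c \<in> J" "c * b - u \<in> L" "b * c - u \<in> L" by blast
      let ?x = "b + scal 1 * (1 - u)" and ?y = "c + scal 1 * (1 - u)"
      have "?y * ?x - 1 \<asymp> c * b + scal 1 * scal 1 * (1 - u) - 1" by (intro eqn_diff corner c b eqn_refl)
      then have 1: "?y * ?x - 1 \<in> L" using eqn_mem[OF L] c(2) by simp
      have "?x * ?y - 1 \<asymp> b * c + scal 1 * scal 1 * (1 - u) - 1" by (intro eqn_diff corner c b eqn_refl)
      then have 2: "?x * ?y - 1 \<in> L" using eqn_mem[OF L] c(3) by simp
      obtain v where v: "invm null v" "?x - v \<in> L" using lift invmI[OF 1 2] unfolding lifting_def by blast
      obtain w where w: "w * v \<asymp> 1" "v * w \<asymp> 1" using invm_obtain[OF null_ideal v(1)] by (auto simp: eqn_def)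
      have "w * u * (v * u) \<asymp> u" "v * u * (w * u) \<asymp> u"
        using eqn_trans[OF mum eqn_multr[OF w(1), of u]] eqn_trans[OF mum eqn_multr[OF w(2), of u]] by simp_all
      moreover have "b - v * u \<in> L"
      proof -
        have "b - v * u = (?x - v) * u - (b * u - b) - (u - u * u)" by (simp add: algebra_simps)
        also have "\<dots> \<in> L"
          by (rule ideal_diff[OF Lid ideal_diff[OF Lid ideal_rmult[OF Lid v(2)] eqn_cong_mem[OF L ur[OF b]]]
              eqn_cong_mem[OF L eqn_sym[OF ul[OF uJ]]]])
        finally show ?thesis .
      qed
      ultimately show "\<exists>v\<in>J. (\<exists>w\<in>J. w * v \<asymp> u \<and> v * w \<asymp> u) \<and> b - v \<in> L" using muJ by blast
    qed
  qed
qed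

lemma ideal_IR_UNIV: "unitization J = UNIV \<Longrightarrow> ideal_IR J \<longleftrightarrow> IR"
  by (simp add: ideal_IR_def IR_def)

end

context star_alg_embedding
begin

lemma invertibles_lift_sub_lifting:
  assumes e: "is_identity U e" and K: "closed_ideal U K"
  shows "invertibles_lift U K \<longleftrightarrow> sub_lifting \<A> (\<phi> e) (range_hull K)"
proof -
  have diff: "x - y \<in> range_hull K \<longleftrightarrow> b \<ominus> v \<in> K"
    if "b \<in> carrier U" "x \<asymp> \<phi> b" "v \<in> carrier U" "y \<asymp> \<phi> v" for x y b v
  proof -
    have eq: "x - y \<asymp> \<phi> (b \<ominus> v)"
      using that by (intro eqn_trans[OF eqn_diff eqn_sym[OF \<phi>_minus]])
    have "x - y \<in> range_hull K \<longleftrightarrow> \<phi> (b \<ominus> v) \<in> range_hull K"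
      using range_hull_eqn[OF eq] range_hull_eqn[OF eqn_sym[OF eq]] by blast
    then show ?thesis using \<phi>_in_range_hull_iff[OF closed_idealD(1)[OF K]] that by (simp add: minus_closed)
  qed
  have inv: "(\<exists>c\<in>\<A>. c * x - \<phi> e \<in> range_hull K \<and> x * c - \<phi> e \<in> range_hull K) \<longleftrightarrow>
      (\<exists>c\<in>carrier U. c \<otimes> b \<ominus> e \<in> K \<and> b \<otimes> c \<ominus> e \<in> K)" if b: "b \<in> carrier U" "x \<asymp> \<phi> b" for b x
  proof
    assume "\<exists>c\<in>\<A>. c * x - \<phi> e \<in> range_hull K \<and> x * c - \<phi> e \<in> range_hull K"
    then obtain y c where c: "c \<in> carrier U" "y \<asymp> \<phi> c" "y * x - \<phi> e \<in> range_hull K" "x * y - \<phi> e \<in> range_hull K"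
      by (auto simp: range_hull_def[of "carrier U"])
    then show "\<exists>c\<in>carrier U. c \<otimes> b \<ominus> e \<in> K \<and> b \<otimes> c \<ominus> e \<in> K"
      using mult_in_range_hull_iff[OF e K c(1,2) b] mult_in_range_hull_iff[OF e K b c(1,2)] by blast
  next
    assume "\<exists>c\<in>carrier U. c \<otimes> b \<ominus> e \<in> K \<and> b \<otimes> c \<ominus> e \<in> K"
    then obtain c where c: "c \<in> carrier U" "c \<otimes> b \<ominus> e \<in> K" "b \<otimes> c \<ominus> e \<in> K" by blast
    then show "\<exists>c\<in>\<A>. c * x - \<phi> e \<in> range_hull K \<and> x * c - \<phi> e \<in> range_hull K"
      using mult_in_range_hull_iff[OF e K c(1) eqn_refl b] mult_in_range_hull_iff[OF e K b c(1) eqn_refl]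
        \<phi>_in_range_hull by blast
  qed
  have GLc: "GL U \<subseteq> carrier U" by (auto simp: GL_def)
  have step: "(\<exists>v\<in>\<A>. (\<exists>w\<in>\<A>. w * v \<asymp> \<phi> e \<and> v * w \<asymp> \<phi> e) \<and> x - v \<in> range_hull K) \<longleftrightarrow>
      (\<exists>v\<in>GL U. b \<ominus> v \<in> K)" if b: "b \<in> carrier U" "x \<asymp> \<phi> b" for b x
  proof
    assume "\<exists>v\<in>\<A>. (\<exists>w\<in>\<A>. w * v \<asymp> \<phi> e \<and> v * w \<asymp> \<phi> e) \<and> x - v \<in> range_hull K"
    then obtain y where y: "y \<in> \<A>" "\<exists>w\<in>\<A>. w * y \<asymp> \<phi> e \<and> y * w \<asymp> \<phi> e" "x - y \<in> range_hull K" by blast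
    then obtain v where v: "v \<in> carrier U" "y \<asymp> \<phi> v" by (auto simp: range_hull_def)
    then show "\<exists>v\<in>GL U. b \<ominus> v \<in> K" using y GL_range_iff[OF e v] diff[OF b v] by blast
  next
    assume "\<exists>v\<in>GL U. b \<ominus> v \<in> K"
    then obtain v where v: "v \<in> GL U" "b \<ominus> v \<in> K" by blast
    then have vc: "v \<in> carrier U" using GLc by blast
    show "\<exists>v\<in>\<A>. (\<exists>w\<in>\<A>. w * v \<asymp> \<phi> e \<and> v * w \<asymp> \<phi> e) \<and> x - v \<in> range_hull K"
      using v GL_range_iff[OF e vc eqn_refl] diff[OF b vc eqn_refl] \<phi>_in_range_hull[OF vc] by blast
  qed
  have all: "(\<forall>x\<in>\<A>. P x) \<longleftrightarrow> (\<forall>b\<in>carrier U. Q b)"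
    if "\<And>b x. b \<in> carrier U \<Longrightarrow> x \<asymp> \<phi> b \<Longrightarrow> P x \<longleftrightarrow> Q b" for P Q
    using that eqn_refl unfolding range_hull_def by blast
  show ?thesis
    unfolding invertibles_lift_iff[OF closed_ideal_alg_ideal[OF K] e] sub_lifting_def
    by (rule all[symmetric]) (simp only: inv step)
qed

end

section \<open>Restriction and quotient\<close>

context cstar_algebra
begin

lemma closedin_norm_topology_iff:
  "closedin (norm_topology A) S \<longleftrightarrow>
     S \<subseteq> carrier A \<and> (\<forall>x\<in>carrier A. (\<forall>e>0. \<exists>y\<in>S. nrm A (x \<ominus> y) < e) \<longrightarrow> x \<in> S)"
proof -
  interpret Metric_space "carrier A" "norm_dist A" by (rule norm_dist_metric)
  have top: "topspace (norm_topology A) = carrier A" by (simp add: norm_topology_def)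
  have "x \<in> norm_topology A closure_of S \<longleftrightarrow> x \<in> carrier A \<and> (\<forall>e>0. \<exists>y\<in>S. nrm A (x \<ominus> y) < e)"
    if "S \<subseteq> carrier A" for x
    using that unfolding norm_topology_def metric_closure_of by (auto simp: norm_dist_def subset_iff)
  then show ?thesis unfolding closure_of_subset_eq[symmetric] top by auto
qed

lemma closed_ideal_carrier: "closed_ideal A (carrier A)"
proof -
  have "additive_subgroup (carrier A) A"
    by (rule additive_subgroupI) (rule group.subgroup_self[OF a_group, simplified])
  then show ?thesis by (simp add: closed_ideal_def closedin_norm_topology_iff alg_closed)
qed

end

locale cstar_ideal = cstar_algebra A for A :: "'a star_alg" (structure) +
  fixes I assumes closed_ideal: "closed_ideal A I"
begin

lemma ideal_simps:
  "x \<in> I \<Longrightarrow> x \<in> carrier A" "\<zero> \<in> I" "x \<in> I \<Longrightarrow> y \<in> I \<Longrightarrow> x \<oplus> y \<in> I" "x \<in> I \<Longrightarrow> c \<odot> x \<in> I"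
  "x \<in> I \<Longrightarrow> a \<in> carrier A \<Longrightarrow> a \<otimes> x \<in> I" "x \<in> I \<Longrightarrow> a \<in> carrier A \<Longrightarrow> x \<otimes> a \<in> I"
proof -
  interpret additive_subgroup I A using closed_ideal by (simp add: closed_ideal_def)
  show "x \<in> I \<Longrightarrow> x \<in> carrier A" "\<zero> \<in> I" "x \<in> I \<Longrightarrow> y \<in> I \<Longrightarrow> x \<oplus> y \<in> I"
    using a_Hcarr zero_closed a_closed by auto
qed (use closed_ideal in \<open>simp_all add: closed_ideal_def\<close>)

lemma ideal_closed_limit:
  assumes "x \<in> carrier A" "\<And>e. e > 0 \<Longrightarrow> \<exists>y\<in>I. nrm A (x \<ominus> y) < e"
  shows "x \<in> I"
  using closed_ideal assms by (simp add: closed_ideal_def closedin_norm_topology_iff)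

sublocale nonunital_ring A
  by unfold_locales (simp_all add: mult_closed distrib_left distrib_right)

lemma cstar: "cstar_algebra A" by (rule cstar_algebra_axioms)

sublocale P: cstar_seminorm ambient_star ambient_i "ambient_nrm A"
  by (rule ambient_cstar_seminorm[OF cstar])

section \<open>The algebra and its ideal inside the ambient algebra\<close>

definition \<iota> :: "'a \<Rightarrow> 'a ambient" where
  "\<iota> a = mk (\<lambda>B. if B = A then a else \<zero>\<^bsub>B\<^esub>) 0"

lemma \<iota>_simps [simp]: "a \<in> carrier A \<Longrightarrow> coord (\<iota> a) A = a" "a \<in> carrier A \<Longrightarrow> scalar (\<iota> a) = 0"
  using cstar by (simp_all add: \<iota>_def coord_mk scalar_mk cstar_zero_closed)

lemma coord_simps [simp]:
  "coord x A \<in> carrier A"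
  "coord 0 A = \<zero>" "coord 1 A = \<zero>" "coord (x + y) A = coord x A \<oplus> coord y A"
  "coord (- x) A = (-1) \<odot> coord x A" "coord (x - y) A = coord x A \<ominus> coord y A"
  "coord (x * y) A = umult (coord x A) (scalar x) (coord y A) (scalar y)"
  "coord (r *\<^sub>R x) A = of_real r \<odot> coord x A"
  "coord ambient_i A = \<zero>" "coord (ambient_star x) A = star A (coord x A)"
  using cstar by (simp_all add: coord_diff)

declare scalar_diff [simp]

lemma scal_simps [simp]: "scalar (P.scal c) = c" "coord (P.scal c) A = \<zero>"
  by (simp_all add: P.scal_def scale_zero) (simp add: complex_eq_iff)

lemma nrm_scalar_zero: "scalar x = 0 \<Longrightarrow> ambient_nrm A x = nrm A (coord x A)"
  by (simp add: ambient_nrm_def opnorm_zero_scalar nrm_nonneg)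

lemma eqn_iff: "P.eqn x y \<longleftrightarrow> scalar x = scalar y \<and> coord x A = coord y A"
proof
  assume "P.eqn x y"
  then have n: "ambient_nrm A (x - y) = 0" by (simp add: P.eqn_def P.null_def)
  then have "cmod (scalar (x - y)) \<le> 0" by (simp add: ambient_nrm_def max_def split: if_splits)
  then have s: "scalar (x - y) = 0" by simp
  then have "nrm A (coord (x - y) A) = 0" using n nrm_scalar_zero by simp
  then have "coord x A \<ominus> coord y A = \<zero>" by (simp add: nrm_eq_0_iff)
  moreover have "coord x A = (coord x A \<ominus> coord y A) \<oplus> coord y A" by (simp add: a_minus_def a_assoc l_neg)
  ultimately show "scalar x = scalar y \<and> coord x A = coord y A" using s by simp
next
  assume "scalar x = scalar y \<and> coord x A = coord y A"
  then have "ambient_nrm A (x - y) = 0" by (simp add: nrm_scalar_zero a_minus_def r_neg nrm_zero)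
  then show "P.eqn x y" by (simp add: P.eqn_def P.null_def)
qed

text \<open>The coordinates at other algebras are unrestricted, since they lie in the kernel of the
  seminorm; this makes the set saturated under equality up to the kernel.\<close>

definition emb :: "'a set \<Rightarrow> 'a ambient set" where
  "emb S = {x. scalar x = 0 \<and> coord x A \<in> S}"

lemma cideal_emb: "P.cideal (emb I)"
  unfolding P.cideal_def two_sided_ideal_def
proof (intro conjI ballI allI impI)
  show "0 \<in> emb I" by (simp add: emb_def ideal_simps)
  show "x + y \<in> emb I" if "x \<in> emb I" "y \<in> emb I" for x y
    using that by (simp add: emb_def ideal_simps)
  show "a * x \<in> emb I" "x * a \<in> emb I" if "x \<in> emb I" for x a
    using that by (simp_all add: emb_def umult_def ideal_simps zero_scale alg_closed)
  fix x assume x: "\<forall>e>0. \<exists>y\<in>emb I. ambient_nrm A (x - y) < e"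
  have "cmod (scalar x) \<le> 0 + e" if e: "e > 0" for e
  proof -
    obtain y where y: "y \<in> emb I" "ambient_nrm A (x - y) < e" using x e by blast
    then show ?thesis by (simp add: ambient_nrm_def emb_def)
  qed
  then have "cmod (scalar x) \<le> 0" by (rule field_le_epsilon)
  then have s: "scalar x = 0" by simp
  moreover have "coord x A \<in> I"
  proof (rule ideal_closed_limit)
    fix e :: real assume "e > 0"
    then obtain y where "y \<in> emb I" "ambient_nrm A (x - y) < e" using x by blast
    then show "\<exists>y\<in>I. nrm A (coord x A \<ominus> y) < e" using s by (auto simp: emb_def nrm_scalar_zero)
  qed simp
  ultimately show "x \<in> emb I" by (simp add: emb_def)
qed

lemma emb_carrier: "emb (carrier A) = {x. scalar x = 0}"
  by (simp add: emb_def)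

lemma restriction_embedding:
  "star_alg_embedding ambient_star ambient_i (ambient_nrm A) (A\<lparr>carrier := I\<rparr>) \<iota> (ambient_nrm A) 1"
proof (unfold_locales)
  show "P.eqn (\<iota> (x \<oplus>\<^bsub>A\<lparr>carrier := I\<rparr>\<^esub> y)) (\<iota> x + \<iota> y)"
    if "x \<in> carrier (A\<lparr>carrier := I\<rparr>)" "y \<in> carrier (A\<lparr>carrier := I\<rparr>)" for x y
    using that by (simp add: eqn_iff ideal_simps)
  show "P.eqn (\<iota> (x \<otimes>\<^bsub>A\<lparr>carrier := I\<rparr>\<^esub> y)) (\<iota> x * \<iota> y)"
    if "x \<in> carrier (A\<lparr>carrier := I\<rparr>)" "y \<in> carrier (A\<lparr>carrier := I\<rparr>)" for x y
    using that by (simp add: eqn_iff ideal_simps umult_def zero_scale alg_closed)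
  show "P.eqn (\<iota> (c \<odot>\<^bsub>A\<lparr>carrier := I\<rparr>\<^esub> x)) (P.scal c * \<iota> x)"
    if "x \<in> carrier (A\<lparr>carrier := I\<rparr>)" for c x
    using that by (simp add: eqn_iff ideal_simps umult_one scale_closed)
  show "x = y" if "x \<in> carrier (A\<lparr>carrier := I\<rparr>)" "y \<in> carrier (A\<lparr>carrier := I\<rparr>)" "P.eqn (\<iota> x) (\<iota> y)" for x y
    using that by (simp add: eqn_iff ideal_simps)
  show "nrm (A\<lparr>carrier := I\<rparr>) x = ambient_nrm A (\<iota> x)" if "x \<in> carrier (A\<lparr>carrier := I\<rparr>)" for x
    using that by (simp add: nrm_scalar_zero ideal_simps)
qed (auto simp: ideal_simps eqn_iff P.n_triangle)

lemma range_hull_eq: "{t. \<exists>x\<in>I. P.eqn t (\<iota> x)} = emb I"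
  by (auto simp: eqn_iff emb_def ideal_simps intro!: bexI[of _ "coord _ A"])

lemma has_IR_ideal: "has_IR (A\<lparr>carrier := I\<rparr>) \<longleftrightarrow> P.ideal_IR (emb I)"
proof -
  interpret E: star_alg_embedding ambient_star ambient_i "ambient_nrm A" "A\<lparr>carrier := I\<rparr>" \<iota> "ambient_nrm A" 1
    by (rule restriction_embedding)
  have hull: "E.range_hull (carrier (A\<lparr>carrier := I\<rparr>)) = emb I"
    using range_hull_eq by (simp add: E.range_hull_def)
  interpret ideal_embedding ambient_star ambient_i "ambient_nrm A" "A\<lparr>carrier := I\<rparr>" \<iota>
    by unfold_locales (simp only: hull cideal_emb)
  show ?thesis using has_IR_iff hull by simp
qed

lemma unitization_emb_carrier: "P.unitization (emb (carrier A)) = UNIV"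
  by (auto simp: P.unitization_def emb_carrier intro!: exI[of _ "scalar _"])

lemma cstar_ideal_carrier: "cstar_ideal A (carrier A)"
  by unfold_locales (rule closed_ideal_carrier)

text \<open>The algebra itself is the closed ideal of scalar part 0, so the result for ideals
  applies to it. Together with the scalars this ideal fills the ambient ring, and
  \<open>ideal_IR\<close> turns into \<open>IR\<close>; for unital \<open>A\<close> the extra
  summand was dealt with in \<open>has_IR_iff\<close>.\<close>

lemma has_IR_algebra: "has_IR A \<longleftrightarrow> P.IR"
proof -
  interpret C: cstar_ideal A "carrier A" by (rule cstar_ideal_carrier)
  have "A\<lparr>carrier := carrier A\<rparr> = A" by simp
  then show ?thesis
    using C.has_IR_ideal P.ideal_IR_UNIV[OF unitization_emb_carrier] by simp
qed

section \<open>The quotient algebra inside the ambient algebra\<close>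

lemma alg_ideal_I: "alg_ideal I" by (rule closed_ideal_alg_ideal[OF closed_ideal])

lemma I_subgroup: "abelian_subgroup I A" by (rule K_subgroup[OF alg_ideal_I])

definition rep :: "'a set \<Rightarrow> 'a" where
  "rep X = (SOME x. x \<in> carrier A \<and> X = I +> x)"

lemma rep:
  assumes "X \<in> carrier (quotient_alg A I)"
  shows "rep X \<in> carrier A" "X = I +> rep X"
proof -
  have "\<exists>x. x \<in> carrier A \<and> X = I +> x" using assms quotient_carrier[OF alg_ideal_I] by auto
  from someI_ex[OF this] show "rep X \<in> carrier A" "X = I +> rep X" by (auto simp: rep_def)
qed

lemma rep_coset: "a \<in> carrier A \<Longrightarrow> rep (I +> a) \<ominus> a \<in> I"
proof -
  assume a: "a \<in> carrier A"
  have X: "I +> a \<in> carrier (quotient_alg A I)" using a by (simp add: quotient_carrier[OF alg_ideal_I])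
  show ?thesis using rep[OF X] coset_eq_iff[OF alg_ideal_I rep(1)[OF X] a] by simp
qed

lemma quotient_ops:
  assumes "a \<in> carrier A" "b \<in> carrier A"
  shows "(I +> a) \<oplus>\<^bsub>quotient_alg A I\<^esub> (I +> b) = I +> (a \<oplus> b)"
    "(I +> a) \<otimes>\<^bsub>quotient_alg A I\<^esub> (I +> b) = I +> (a \<otimes> b)"
    "c \<odot>\<^bsub>quotient_alg A I\<^esub> (I +> a) = I +> (c \<odot> a)"
    "\<zero>\<^bsub>quotient_alg A I\<^esub> = I +> \<zero>"
proof -
  interpret S: abelian_subgroup I A by (rule I_subgroup)
  show "(I +> a) \<oplus>\<^bsub>quotient_alg A I\<^esub> (I +> b) = I +> (a \<oplus> b)"
    using assms by (simp add: quotient_alg_def S.a_rcos_sum)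
  show "(I +> a) \<otimes>\<^bsub>quotient_alg A I\<^esub> (I +> b) = I +> (a \<otimes> b)"
    by (rule quotient_mult[OF alg_ideal_I assms])
  show "\<zero>\<^bsub>quotient_alg A I\<^esub> = I +> \<zero>" using S.a_rcos_const[OF ideal_simps(2)] by (simp add: quotient_alg_def)
  have "I +> (c \<odot> x) = I +> (c \<odot> a)" if "x \<in> I +> a" for x
  proof -
    obtain k where k: "k \<in> I" "x = k \<oplus> a" using \<open>x \<in> I +> a\<close> by (auto simp: a_r_coset_def')
    then have "c \<odot> x = c \<odot> k \<oplus> c \<odot> a" using assms by (simp add: scale_add_right ideal_simps)
    then show ?thesis using coset_absorb[OF alg_ideal_I ideal_simps(4)[OF k(1)] scale_closed[OF assms(1)]] by simp
  qed
  moreover have "I +> a \<noteq> {}" using S.a_rcos_self[OF assms(1)] by blast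
  ultimately have "(\<Union>x\<in>I +> a. I +> (c \<odot> x)) = I +> (c \<odot> a)" by (intro SUP_eq_const)
  then show "c \<odot>\<^bsub>quotient_alg A I\<^esub> (I +> a) = I +> (c \<odot> a)" by (simp add: quotient_alg_def)
qed

sublocale Q: cstar_seminorm ambient_star ambient_i "P.nq (emb I)"
  by (rule P.nq_cstar_seminorm[OF cideal_emb])

lemma Q_eqn_iff: "Q.eqn x y \<longleftrightarrow> x - y \<in> emb I"
  by (simp add: Q.eqn_def P.nq_null[OF cideal_emb])

lemma nq_\<iota>:
  assumes a: "a \<in> carrier A"
  shows "P.nq (emb I) (\<iota> a) = nrm (quotient_alg A I) (I +> a)"
proof -
  have "(\<lambda>y. ambient_nrm A (\<iota> a - y)) ` emb I = nrm A ` (I +> a)"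
  proof (intro equalityI subsetI)
    fix r assume "r \<in> (\<lambda>y. ambient_nrm A (\<iota> a - y)) ` emb I"
    then obtain y where y: "scalar y = 0" "coord y A \<in> I" "r = ambient_nrm A (\<iota> a - y)" by (auto simp: emb_def)
    have "r = nrm A (a \<ominus> coord y A)" using a y by (simp add: nrm_scalar_zero)
    also have "a \<ominus> coord y A = (-1) \<odot> coord y A \<oplus> a" using a by (simp add: a_minus_def minus_eq_scale a_comm scale_closed)
    finally show "r \<in> nrm A ` (I +> a)" using ideal_simps(4)[OF y(2), of "-1"] by (auto simp: a_r_coset_def')
  next
    fix r assume "r \<in> nrm A ` (I +> a)"
    then obtain k where k: "k \<in> I" "r = nrm A (k \<oplus> a)" by (auto simp: a_r_coset_def')
    let ?y = "\<iota> ((-1) \<odot> k)"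
    have kc: "k \<in> carrier A" using k ideal_simps(1) by blast
    have "?y \<in> emb I" using k kc by (simp add: emb_def ideal_simps scale_closed)
    moreover have "ambient_nrm A (\<iota> a - ?y) = r"
      using a kc k(2) by (simp add: nrm_scalar_zero scale_closed a_minus_def minus_eq_scale scale_scale scale_one a_comm)
    ultimately show "r \<in> (\<lambda>y. ambient_nrm A (\<iota> a - y)) ` emb I" by (metis imageI)
  qed
  then show ?thesis by (simp add: P.nq_def quotient_alg_def)
qed

lemma quotient_embedding:
  "star_alg_embedding ambient_star ambient_i (P.nq (emb I)) (quotient_alg A I) (\<lambda>X. \<iota> (rep X)) (P.nq (emb I)) 1"
proof -
  let ?Q = "quotient_alg A I"
  have cosetE: "\<exists>a\<in>carrier A. X = I +> a" if "X \<in> carrier ?Q" for X using rep[OF that] by blast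
  have mem: "I +> a \<in> carrier ?Q" if "a \<in> carrier A" for a using that by (simp add: quotient_carrier[OF alg_ideal_I])
  have eq: "Q.eqn (\<iota> (rep (I +> a))) (\<iota> a)" if "a \<in> carrier A" for a
    unfolding Q_eqn_iff using that rep(1)[OF mem[OF that]] rep_coset[OF that] by (simp add: emb_def)
  have P_Q: "Q.eqn x y" if "P.eqn x y" for x y
    using that P.eqn_cong_mem[OF cideal_emb] by (simp add: Q_eqn_iff)
  have \<iota>_add: "Q.eqn (\<iota> (a \<oplus> b)) (\<iota> a + \<iota> b)" and \<iota>_mult: "Q.eqn (\<iota> (a \<otimes> b)) (\<iota> a * \<iota> b)"
    and \<iota>_smult: "Q.eqn (\<iota> (c \<odot> a)) (Q.scal c * \<iota> a)"
    if "a \<in> carrier A" "b \<in> carrier A" for a b c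
    using that by (auto intro!: P_Q simp: eqn_iff umult_def umult_one zero_scale mult_zero_left alg_closed)
  show ?thesis
  proof (unfold_locales)
    show "\<zero>\<^bsub>?Q\<^esub> \<in> carrier ?Q" using quotient_ops(4)[of \<zero> \<zero>] mem by simp
    show "Q.eqn (\<iota> (rep \<zero>\<^bsub>?Q\<^esub>)) 0"
      using Q.eqn_trans[OF eq[of \<zero>] P_Q[of "\<iota> \<zero>" 0]] quotient_ops(4)[of \<zero> \<zero>] by (simp add: eqn_iff)
    fix X assume X: "X \<in> carrier ?Q"
    then obtain a where a: "a \<in> carrier A" "X = I +> a" using cosetE by blast
    show "c \<odot>\<^bsub>?Q\<^esub> X \<in> carrier ?Q" for c
      using a quotient_ops(3)[OF a(1,1)] mem[OF scale_closed] by simp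
    have "Q.eqn (\<iota> (rep (c \<odot>\<^bsub>?Q\<^esub> X))) (\<iota> (c \<odot> a))" for c
      using eq[OF scale_closed[OF a(1)]] quotient_ops(3)[OF a(1,1)] a(2) by simp
    then show "Q.eqn (\<iota> (rep (c \<odot>\<^bsub>?Q\<^esub> X))) (Q.scal c * \<iota> (rep X))" for c
      using Q.eqn_trans[OF Q.eqn_trans[OF _ \<iota>_smult[OF a(1,1)]] Q.eqn_multl[OF Q.eqn_sym[OF eq[OF a(1)]]]] a(2) by blast
    show "nrm ?Q X = P.nq (emb I) (\<iota> (rep X))" using nq_\<iota>[OF rep(1)[OF X]] rep(2)[OF X] by simp
    show "P.nq (emb I) (\<iota> (rep X)) \<le> 1 * P.nq (emb I) (\<iota> (rep X))" by simp
    fix Y assume Y: "Y \<in> carrier ?Q"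
    then obtain b where b: "b \<in> carrier A" "Y = I +> b" using cosetE by blast
    show "X \<oplus>\<^bsub>?Q\<^esub> Y \<in> carrier ?Q" "X \<otimes>\<^bsub>?Q\<^esub> Y \<in> carrier ?Q"
      using a b quotient_ops(1,2)[OF a(1) b(1)] mem mult_closed by simp_all
    have "Q.eqn (\<iota> (rep (X \<oplus>\<^bsub>?Q\<^esub> Y))) (\<iota> (a \<oplus> b))" "Q.eqn (\<iota> (rep (X \<otimes>\<^bsub>?Q\<^esub> Y))) (\<iota> (a \<otimes> b))"
      using a b eq quotient_ops(1,2)[OF a(1) b(1)] mult_closed by simp_all
    then show "Q.eqn (\<iota> (rep (X \<oplus>\<^bsub>?Q\<^esub> Y))) (\<iota> (rep X) + \<iota> (rep Y))"
      "Q.eqn (\<iota> (rep (X \<otimes>\<^bsub>?Q\<^esub> Y))) (\<iota> (rep X) * \<iota> (rep Y))"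
      using Q.eqn_trans[OF Q.eqn_trans[OF _ \<iota>_add[OF a(1) b(1)]] Q.eqn_add[OF Q.eqn_sym[OF eq[OF a(1)]] Q.eqn_sym[OF eq[OF b(1)]]]]
        Q.eqn_trans[OF Q.eqn_trans[OF _ \<iota>_mult[OF a(1) b(1)]] Q.eqn_mult[OF Q.eqn_sym[OF eq[OF a(1)]] Q.eqn_sym[OF eq[OF b(1)]]]]
        a(2) b(2) by blast+
    assume "Q.eqn (\<iota> (rep X)) (\<iota> (rep Y))"
    then have "rep X \<ominus> rep Y \<in> I"
      unfolding Q_eqn_iff using rep(1)[OF X] rep(1)[OF Y] by (simp add: emb_def)
    then show "X = Y" using coset_eq_iff[OF alg_ideal_I rep(1)[OF X] rep(1)[OF Y]] rep(2)[OF X] rep(2)[OF Y] by simp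
  qed (simp_all add: Q.n_triangle)
qed

text \<open>The ring and the ideal of scalar part 0 are the same as for the algebra; only the
  seminorm is now that of the quotient by \<open>emb I\<close>.\<close>

lemma has_IR_quotient: "has_IR (quotient_alg A I) \<longleftrightarrow> Q.IR"
proof -
  interpret E: star_alg_embedding ambient_star ambient_i "P.nq (emb I)" "quotient_alg A I" "\<lambda>X. \<iota> (rep X)" "P.nq (emb I)" 1
    by (rule quotient_embedding)
  interpret C: cstar_ideal A "carrier A" by (rule cstar_ideal_carrier)
  have hull: "E.range_hull (carrier (quotient_alg A I)) = emb (carrier A)"
  proof (intro equalityI subsetI)
    fix t assume "t \<in> E.range_hull (carrier (quotient_alg A I))"
    then obtain X where X: "X \<in> carrier (quotient_alg A I)" "t - \<iota> (rep X) \<in> emb I"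
      by (auto simp: E.range_hull_def Q_eqn_iff)
    then show "t \<in> emb (carrier A)" using rep(1)[OF X(1)] by (simp add: emb_def)
  next
    fix t assume "t \<in> emb (carrier A)"
    then have t: "scalar t = 0" by (simp add: emb_def)
    let ?X = "I +> coord t A"
    have X: "?X \<in> carrier (quotient_alg A I)" by (simp add: quotient_carrier[OF alg_ideal_I])
    have "coord t A \<ominus> rep ?X \<in> I"
      using coset_eq_iff[OF alg_ideal_I coord_simps(1)[of t] rep(1)[OF X]] rep(2)[OF X] by simp
    then have "t - \<iota> (rep ?X) \<in> emb I" using t rep(1)[OF X] by (simp add: emb_def)
    then show "t \<in> E.range_hull (carrier (quotient_alg A I))" using X by (auto simp: E.range_hull_def Q_eqn_iff)
  qed
  have "emb I \<subseteq> emb (carrier A)" by (auto simp: emb_def)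
  then have cid: "Q.cideal (emb (carrier A))"
    using P.nq_cideal_iff[OF cideal_emb] C.cideal_emb by simp
  interpret ideal_embedding ambient_star ambient_i "P.nq (emb I)" "quotient_alg A I" "\<lambda>X. \<iota> (rep X)"
    by unfold_locales (simp only: hull cid)
  show ?thesis using has_IR_iff hull Q.ideal_IR_UNIV[OF unitization_emb_carrier] by simp
qed

section \<open>The lifting condition with and without an identity\<close>

lemma lifting_unital:
  assumes e: "is_identity A e"
  shows "invertibles_lift A I \<longleftrightarrow> P.lifting (emb I)"
proof -
  interpret C: cstar_ideal A "carrier A" by (rule cstar_ideal_carrier)
  have A: "A\<lparr>carrier := carrier A\<rparr> = A" by simp
  interpret E: star_alg_embedding ambient_star ambient_i "ambient_nrm A" A \<iota> "ambient_nrm A" 1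
    using C.restriction_embedding unfolding A .
  have ec: "e \<in> carrier A" using e by (simp add: is_identity_def)
  have "invertibles_lift A I \<longleftrightarrow> P.sub_lifting (emb (carrier A)) (\<iota> e) (emb I)"
    using E.invertibles_lift_sub_lifting[OF e closed_ideal] range_hull_eq C.range_hull_eq
    by (simp add: E.range_hull_def)
  also have "\<dots> \<longleftrightarrow> P.lifting (emb I)"
  proof (rule P.sub_lifting_unital_ideal[OF C.cideal_emb _ _ _ _ unitization_emb_carrier cideal_emb])
    show "\<iota> e \<in> emb (carrier A)" "1 \<notin> emb (carrier A)" "emb I \<subseteq> emb (carrier A)"
      using ec by (auto simp: emb_def)
    show "P.eqn (\<iota> e * x) x" "P.eqn (x * \<iota> e) x" if "x \<in> emb (carrier A)" for x
      using that ec e by (simp_all add: eqn_iff emb_def umult_def zero_scale is_identity_def)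
  qed
  finally show ?thesis .
qed

text \<open>Up to the kernel, \<open>adjoin_identity A\<close> is the whole ambient ring with
  identity 1, and the copy of \<open>I\<close> in it is the preimage of \<open>emb I\<close>; no
  extra summand has to be split off.\<close>

lemma lifting_nonunital:
  assumes nu: "\<not> unital A"
  shows "invertibles_lift (adjoin_identity A) ((\<lambda>a. (a, 0)) ` I) \<longleftrightarrow> P.lifting (emb I)"
proof -
  interpret C: cstar_ideal A "carrier A" by (rule cstar_ideal_carrier)
  have A: "A\<lparr>carrier := carrier A\<rparr> = A" by simp
  interpret E: star_alg_embedding ambient_star ambient_i "ambient_nrm A" A \<iota> "ambient_nrm A" 1
    using C.restriction_embedding unfolding A .
  have hull: "E.range_hull (carrier A) = emb (carrier A)" using C.range_hull_eq by (simp add: E.range_hull_def)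
  interpret M: ideal_embedding ambient_star ambient_i "ambient_nrm A" A \<iota>
    by unfold_locales (simp only: hull C.cideal_emb)
  let ?D = "adjoin_identity A"
  obtain K where "star_alg_embedding ambient_star ambient_i (ambient_nrm A) ?D M.\<Phi> M.opn K"
    by (rule M.adjoin_embedding[OF nu])
  then interpret D: star_alg_embedding ambient_star ambient_i "ambient_nrm A" ?D M.\<Phi> M.opn K .
  have D\<A>: "D.range_hull (carrier ?D) = UNIV"
    using M.adjoin_range hull unitization_emb_carrier by (simp add: D.range_hull_def)
  have \<Phi>: "coord (M.\<Phi> (a, s)) A = a \<and> scalar (M.\<Phi> (a, s)) = s" if "a \<in> carrier A" for a s
    using M.\<Phi>_eq[of "(a, s)"] that by (simp add: eqn_iff)
  have sub: "P.sub_cideal UNIV (emb I)"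
    using P.sub_cideal_restrict[OF cideal_emb, of UNIV] by simp
  have K: "(\<lambda>a. (a, 0)) ` I = {p \<in> carrier ?D. M.\<Phi> p \<in> emb I}"
    by (auto simp: M.adjoin_simps emb_def \<Phi> ideal_simps)
  have cl: "closed_ideal ?D ((\<lambda>a. (a, 0)) ` I)"
    unfolding K using D.closed_ideal_preimage sub D\<A> by simp
  have "D.range_hull ((\<lambda>a. (a, 0)) ` I) = emb I"
    unfolding K using D.range_hull_preimage sub D\<A> by simp
  then show ?thesis
    using D.invertibles_lift_sub_lifting[OF M.adjoin_is_identity[OF nu] cl] P.sub_lifting_UNIV[OF cideal_emb] D\<A>
    by (simp add: M.\<Phi>_def)
qed

end

theorem theorem2p5:
  fixes A :: "'a star_alg" and I :: "'a set"
  assumes "cstar_algebra A" and "closed_ideal A I"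
  shows "has_IR A \<longleftrightarrow>
    has_IR (A\<lparr>carrier := I\<rparr>) \<and> has_IR (quotient_alg A I) \<and>
    (if unital A then invertibles_lift A I
     else invertibles_lift (adjoin_identity A) ((\<lambda>a. (a, 0)) ` I))"
proof -
  interpret cstar_ideal A I
    using assms by (simp add: cstar_ideal_def cstar_ideal_axioms_def)
  have "P.IR \<longleftrightarrow> P.ideal_IR (emb I) \<and> Q.IR \<and> P.lifting (emb I)"
    by (rule P.IR_extension[OF cideal_emb])
  then show ?thesis
    using has_IR_algebra has_IR_ideal has_IR_quotient lifting_unital lifting_nonunital
    by (auto simp: unital_def)
qed

end
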